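(* Let $(\Lambda,\le)$, $R$, $F$, $M$, the basic subset $D$, the function $f$, the basic module $V(D,f)$, the set $\Omega$, the subgroups $H\unlhd I\le M$, the linear character $\lambda:H\to F^*$ and the $1$-dimensional $H$-module $W$ be as in the context. Suppose that $R$ is finite, $D$ has no special triple, and $S=I/H$ is abelian (this is equivalent to $[\Omega,\Omega]\subseteq\Gamma$). Assume, in addition, that $I$ is a strongly ascendant subgroup of $M$. Then $V(D,f)$ has the following decomposition into non-isomorphic $M$-modules: $$V(D,f)\cong\bigoplus_{\chi\in\mathrm{Irr}(S)}\mathrm{ind}_I^MW_1(\chi),$$ where $W_1(\chi)$ is the vector space $W$ acted upon by $I$ via the only extension of $\lambda$ to a homomorphism $I\to F^*$ that satisfies $1+re_{\sigma\tau}\mapsto\chi\big((1+re_{\sigma\tau})H\big)$ for all $(\sigma,\tau)\in\Omega$ and $r\in R$.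
   Context: Representation theory conventions: $F$ is a field; a $G$-module is a left $FG$-module, possibly infinite dimensional; $\mathrm{ind}_H^GW=FG\otimes_{FH}W$. For the finite abelian group $S$, $\mathrm{Irr}(S)$ is the set of irreducible characters of $S$ over $F$ (under the hypotheses these are group homomorphisms $S\to F^*$). McLain group: $R$ is a ring with $1\ne0$ (not necessarily commutative), $(\Lambda,\leq)$ is a non-empty totally ordered set, $\Phi=\{(\alpha,\beta)\in\Lambda\times\Lambda:\alpha<\beta\}$. $J$ is the free left $R$-module with basis $e_{\alpha\beta}$, $(\alpha,\beta)\in\Phi$, made into a ring by $(re_{\alpha\beta})(se_{\beta\gamma})=rs\,e_{\alpha\gamma}$ and $(re_{\alpha\beta})(se_{\gamma\delta})=0$ if $\beta\neq\gamma$, extended additively. $J$ is nil, and $M=\{1+x:x\in J\}$ is a group under multiplication. $M_{\alpha\beta}=\{1+re_{\alpha\beta}:r\in R\}$. A subset $\Delta\subseteq\Phi$ is closed if $(\alpha,\beta),(\beta,\gamma)\in\Delta$ implies $(\alpha,\gamma)\in\Delta$; then $M(\Delta)=\langle M_{\alpha\beta}:(\alpha,\beta)\in\Delta\rangle$. For $\Delta\subseteq\Phi$, $[\Delta,\Delta]$ is the set of all $(\alpha,\beta)\in\Phi$ for which there is a chain $(\gamma_1,\gamma_2),\dots,(\gamma_{n-1},\gamma_n)\in\Delta$ with $n\geq3$, $\gamma_1=\alpha$, $\gamma_n=\beta$. A linear character (group homomorphism) $R^+\to F^*$ is right primitive if its kernel contains no right ideal of $R$ other than $(0)$. It is assumed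 throughout that $R$ admits a right primitive linear character $R^+\to F^*$. Elementary modules: let $(\alpha,\beta)\in\Phi$ and let $\mu:R^+\to F^*$ be right primitive. Let $L$ be the subgroup generated by all $M_{\gamma\delta}$ with $\alpha\le\gamma<\delta\le\beta$; let $P$ be the subgroup of $L$ generated by all $M_{\gamma\beta}$ with $\alpha\le\gamma<\beta$ and all $M_{\gamma\delta}$ with $\alpha<\gamma<\delta<\beta$. There is a $1$-dimensional $P$-module on which $1+re_{\alpha\beta}$ acts as $\mu(r)$ and all the other listed generators act trivially; $V(\alpha,\beta,\mu)$ is the $L$-module induced from it, viewed as an $M$-module through $M=N\rtimes L$, where $N$ is the normal subgroup generated by all $M_{\gamma\delta}$ with $\gamma<\alpha$ or $\delta>\beta$, and $N$ acts trivially. Basic modules: $D=\{(\alpha_1,\beta_1),\dots,(\alpha_m,\beta_m)\}\subseteq\Phi$ ($m\ge1$) is basic if the $\alpha_i$ are distinct and the $\beta_i$ are distinct. $f$ assigns to each $(\alpha_i,\beta_i)$ a right primitive linear character $\lambda_i:R^+\to F^*$. The basic $M$-module is $V(D,f)=V(\alpha_m,\beta_m,\lambda_m)\otimes_F\cdots\otimes_FV(\alpha_1,\beta_1,\lambda_1)$ with diagonal action. Notation attached to $(D,f)$: $\Gamma=\Phi\setminus\bigcup_i\{(\alpha_i,\gamma)\in\Phi:\gamma<\beta_i\}$ and $H=M(\Gamma)$. For each $i$, $H_i=M(\Phi\setminus\{(\alpha_i,\gamma)\in\Phi:\gamma<\beta_i\})$ and $\widehat{\lambda_i}:H_i\to F^*$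 is the homomorphism with $1+re_{\alpha_i\beta_i}\mapsto\lambda_i(r)$ that is trivial on all $M_{\alpha\beta}$ with $(\alpha,\beta)\in\Phi\setminus\{(\alpha_i,\gamma)\in\Phi:\gamma\le\beta_i\}$. Then $H=\bigcap_iH_i$, $\lambda=\widehat{\lambda_1}|_H\cdots\widehat{\lambda_m}|_H$, and $W=Fw$ is the $1$-dimensional $H$-module on which $H$ acts via $\lambda$. $\Omega=\{(\alpha,\gamma)\in\Phi:\exists\,(\alpha,\beta),(\gamma,\delta)\in D\text{ with }\alpha<\gamma<\beta<\delta\}$, $\Gamma_1=\Gamma\cup\Omega$ (a closed subset of $\Phi$), and $I=M(\Gamma_1)$; $H$ is normal in $I$. $D$ has a special triple if it contains three elements $(a_1,b_1),(a_2,b_2),(a_3,b_3)$ with $a_1<a_2<a_3=b_1<b_2<b_3$. A subgroup $S_0$ of a group $T$ is strongly ascendant (relative to $\mathrm{char}(F)$) if there is a well-ordered set $(X,\leq)$ with first element $x_0$ and last element $x_1$, and subgroups $T_x$, $x\in X$, of $T$ such that: $T_{x_0}=S_0$; $T_{x_1}=T$; for every $x\in X$, $x\neq x_1$, with successor $x'\in X$, $T_x$ is normal of finite index in $T_{x'}$ with $\mathrm{char}(F)\nmid[T_{x'}:T_x]$ (vacuous in characteristic $0$); and if $x\in X$, $x\neq x_0$, has no immediate predecessor in $X$, then $T_x=\bigcup_{y<x}T_y$. *)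

theory Defs
  imports
    "HOL-Algebra.Module"
    "HOL-Algebra.AbelCoset"
    "HOL-Algebra.Generated_Groups"
    "HOL-Library.Poly_Mapping"
    "Jordan_Normal_Form.Matrix"
begin

section \<open>Modules for a group over a field\<close>

abbreviation scalars :: "'f::field ring" where
  "scalars \<equiv> \<lparr>carrier = UNIV, monoid.mult = (*), one = 1, ring.zero = 0, ring.add = (+)\<rparr>"

text \<open>
  A left \<open>FG\<close>-module is an \<open>F\<close>-vector space with a linear action of \<open>G\<close>. The fields
  \<^const>\<open>monoid.mult\<close> and \<^const>\<open>one\<close>, which \<^typ>\<open>('f, 'v) module\<close> inherits from the ring record,
  play no role.
\<close>

record ('f, 'v, 'g) gmodule = "('f, 'v) module" +
  act :: "'g \<Rightarrow> 'v \<Rightarrow> 'v"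

locale gmodule = group G + module scalars V
  for G :: "('g, 'm) monoid_scheme" (structure) and V :: "('f::field, 'v, 'g) gmodule" +
  assumes act_closed: "\<lbrakk>g \<in> carrier G; v \<in> carrier V\<rbrakk> \<Longrightarrow> act V g v \<in> carrier V"
    and act_add: "\<lbrakk>g \<in> carrier G; v \<in> carrier V; w \<in> carrier V\<rbrakk>
      \<Longrightarrow> act V g (v \<oplus>\<^bsub>V\<^esub> w) = act V g v \<oplus>\<^bsub>V\<^esub> act V g w"
    and act_smult: "\<lbrakk>g \<in> carrier G; v \<in> carrier V\<rbrakk>
      \<Longrightarrow> act V g (c \<odot>\<^bsub>V\<^esub> v) = c \<odot>\<^bsub>V\<^esub> act V g v"
    and act_one: "v \<in> carrier V \<Longrightarrow> act V \<one> v = v"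
    and act_mult: "\<lbrakk>g \<in> carrier G; h \<in> carrier G; v \<in> carrier V\<rbrakk>
      \<Longrightarrow> act V (g \<otimes> h) v = act V g (act V h v)"

definition gmodule_iso ::
  "('g, 'm) monoid_scheme \<Rightarrow> ('f::field, 'v, 'g) gmodule \<Rightarrow> ('f, 'w, 'g) gmodule \<Rightarrow> bool" where
  "gmodule_iso G V W \<longleftrightarrow>
    (\<exists>\<phi>. bij_betw \<phi> (carrier V) (carrier W) \<and>
      (\<forall>v\<in>carrier V. \<forall>w\<in>carrier V. \<phi> (v \<oplus>\<^bsub>V\<^esub> w) = \<phi> v \<oplus>\<^bsub>W\<^esub> \<phi> w) \<and>
      (\<forall>c. \<forall>v\<in>carrier V. \<phi> (c \<odot>\<^bsub>V\<^esub> v) = c \<odot>\<^bsub>W\<^esub> \<phi> v) \<and>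
      (\<forall>g\<in>carrier G. \<forall>v\<in>carrier V. \<phi> (act V g v) = act W g (\<phi> v)))"

definition irreducible_gmodule ::
  "('g, 'm) monoid_scheme \<Rightarrow> ('f::field, 'v, 'g) gmodule \<Rightarrow> bool" where
  "irreducible_gmodule G V \<longleftrightarrow> gmodule G V \<and> carrier V \<noteq> {\<zero>\<^bsub>V\<^esub>} \<and>
    (\<forall>U. submodule U scalars V \<and> (\<forall>g\<in>carrier G. \<forall>u\<in>U. act V g u \<in> U)
      \<longrightarrow> U = {\<zero>\<^bsub>V\<^esub>} \<or> U = carrier V)"

definition direct_sum ::
  "'i set \<Rightarrow> ('i \<Rightarrow> ('f::field, 'v, 'g) gmodule) \<Rightarrow> ('f, 'i \<Rightarrow> 'v, 'g) gmodule" where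
  "direct_sum I V =
    \<lparr>carrier = {v \<in> (\<Pi>\<^sub>E i\<in>I. carrier (V i)). finite {i \<in> I. v i \<noteq> \<zero>\<^bsub>V i\<^esub>}},
     monoid.mult = undefined, one = undefined,
     ring.zero = (\<lambda>i\<in>I. \<zero>\<^bsub>V i\<^esub>),
     ring.add = (\<lambda>v w. \<lambda>i\<in>I. v i \<oplus>\<^bsub>V i\<^esub> w i),
     smult = (\<lambda>c v. \<lambda>i\<in>I. c \<odot>\<^bsub>V i\<^esub> v i),
     act = (\<lambda>g v. \<lambda>i\<in>I. act (V i) g (v i))\<rparr>"

text \<open>
  The free vector space on a set \<open>B\<close>, on which \<open>g\<close> acts linearly through a map \<open>\<sigma> g\<close> of the
  basis; the basis vector \<open>b\<close> is \<^term>\<open>Poly_Mapping.single b 1\<close>.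
\<close>

definition free_gmodule ::
  "'b set \<Rightarrow> ('g \<Rightarrow> 'b \<Rightarrow> 'b) \<Rightarrow> ('f::field, 'b \<Rightarrow>\<^sub>0 'f, 'g) gmodule" where
  "free_gmodule B \<sigma> =
    \<lparr>carrier = {u. Poly_Mapping.keys u \<subseteq> B},
     monoid.mult = undefined, one = undefined, ring.zero = 0, ring.add = (+),
     smult = (\<lambda>c u. Poly_Mapping.map ((*) c) u),
     act = (\<lambda>g u. \<Sum>b\<in>Poly_Mapping.keys u. Poly_Mapping.single (\<sigma> g b) (Poly_Mapping.lookup u b))\<rparr>"

definition generated_submodule :: "('f::field, 'v, 'g) gmodule \<Rightarrow> 'v set \<Rightarrow> 'v set" where
  "generated_submodule V X = \<Inter>{U. submodule U scalars V \<and> X \<subseteq> U}"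

definition quotient_gmodule ::
  "('f::field, 'v, 'g) gmodule \<Rightarrow> 'v set \<Rightarrow> ('f, 'v set, 'g) gmodule" where
  "quotient_gmodule V K =
    \<lparr>carrier = a_rcosets\<^bsub>V\<^esub> K,
     monoid.mult = undefined, one = undefined,
     ring.zero = K,
     ring.add = (\<lambda>C D. C <+>\<^bsub>V\<^esub> D),
     smult = (\<lambda>c C. K <+>\<^bsub>V\<^esub> ((\<lambda>v. c \<odot>\<^bsub>V\<^esub> v) ` C)),
     act = (\<lambda>g C. K <+>\<^bsub>V\<^esub> (act V g ` C))\<rparr>"

text \<open>
  The tensor product over \<open>F\<close> of a finite family of modules, with diagonal action: the free
  vector space on the families \<open>v\<close> (which stand for the pure tensors) modulo multilinearity.
\<close>

definition tensor_relations ::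
  "'i set \<Rightarrow> ('i \<Rightarrow> ('f::field, 'v, 'g) gmodule) \<Rightarrow> (('i \<Rightarrow> 'v) \<Rightarrow>\<^sub>0 'f) set" where
  "tensor_relations I V =
    {Poly_Mapping.single (v(i := x \<oplus>\<^bsub>V i\<^esub> y)) 1 - Poly_Mapping.single (v(i := x)) 1
        - Poly_Mapping.single (v(i := y)) 1 |v i x y.
      v \<in> (\<Pi>\<^sub>E j\<in>I. carrier (V j)) \<and> i \<in> I \<and> x \<in> carrier (V i) \<and> y \<in> carrier (V i)} \<union>
    {Poly_Mapping.single (v(i := c \<odot>\<^bsub>V i\<^esub> x)) 1 - Poly_Mapping.single (v(i := x)) c |v i c x.
      v \<in> (\<Pi>\<^sub>E j\<in>I. carrier (V j)) \<and> i \<in> I \<and> x \<in> carrier (V i)}"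

definition tensor_product ::
  "'i set \<Rightarrow> ('i \<Rightarrow> ('f::field, 'v, 'g) gmodule) \<Rightarrow> ('f, (('i \<Rightarrow> 'v) \<Rightarrow>\<^sub>0 'f) set, 'g) gmodule"
  where
  "tensor_product I V =
    (let X = free_gmodule (\<Pi>\<^sub>E i\<in>I. carrier (V i)) (\<lambda>g v. \<lambda>i\<in>I. act (V i) g (v i))
     in quotient_gmodule X (generated_submodule X (tensor_relations I V)))"


section \<open>Group algebras and induced modules\<close>

definition group_algebra :: "('g, 'm) monoid_scheme \<Rightarrow> ('g \<Rightarrow>\<^sub>0 'f::field) set" where
  "group_algebra G = {x. Poly_Mapping.keys x \<subseteq> carrier G}"

definition conv :: "('g, 'm) monoid_scheme \<Rightarrow> ('g \<Rightarrow>\<^sub>0 'f::field) \<Rightarrow> ('g \<Rightarrow>\<^sub>0 'f) \<Rightarrow> ('g \<Rightarrow>\<^sub>0 'f)"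
  where
  "conv G x y = (\<Sum>g\<in>Poly_Mapping.keys x. \<Sum>h\<in>Poly_Mapping.keys y.
     Poly_Mapping.single (g \<otimes>\<^bsub>G\<^esub> h) (Poly_Mapping.lookup x g * Poly_Mapping.lookup y h))"

definition algebra_act :: "('f::field, 'v, 'g) gmodule \<Rightarrow> ('g \<Rightarrow>\<^sub>0 'f) \<Rightarrow> 'v \<Rightarrow> 'v" where
  "algebra_act V a v = (\<Oplus>\<^bsub>V\<^esub>g\<in>Poly_Mapping.keys a. Poly_Mapping.lookup a g \<odot>\<^bsub>V\<^esub> act V g v)"

text \<open>
  \<open>FG \<otimes>\<^bsub>FH\<^esub> W\<close>: the free vector space on \<open>FG \<times> W\<close> modulo biadditivity, the \<open>FH\<close>-balance
  relations, and the relations which make \<open>c(x \<otimes> w) = cx \<otimes> w\<close> the scalar multiplication.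
  The group \<open>G\<close> acts by left multiplication on \<open>FG\<close>.
\<close>

definition induction_relations ::
  "('g, 'm) monoid_scheme \<Rightarrow> 'g set \<Rightarrow> ('f::field, 'v, 'g) gmodule
    \<Rightarrow> ((('g \<Rightarrow>\<^sub>0 'f) \<times> 'v) \<Rightarrow>\<^sub>0 'f) set" where
  "induction_relations G H W =
    {Poly_Mapping.single (x + y, w) 1 - Poly_Mapping.single (x, w) 1 - Poly_Mapping.single (y, w) 1
      |x y w. x \<in> group_algebra G \<and> y \<in> group_algebra G \<and> w \<in> carrier W} \<union>
    {Poly_Mapping.single (x, v \<oplus>\<^bsub>W\<^esub> w) 1 - Poly_Mapping.single (x, v) 1 - Poly_Mapping.single (x, w) 1
      |x v w. x \<in> group_algebra G \<and> v \<in> carrier W \<and> w \<in> carrier W} \<union>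
    {Poly_Mapping.single (conv G x a, w) 1 - Poly_Mapping.single (x, algebra_act W a w) 1
      |x a w. x \<in> group_algebra G \<and> a \<in> group_algebra (G\<lparr>carrier := H\<rparr>) \<and> w \<in> carrier W} \<union>
    {Poly_Mapping.single (Poly_Mapping.map ((*) c) x, w) 1 - Poly_Mapping.single (x, w) c
      |c x w. x \<in> group_algebra G \<and> w \<in> carrier W}"

definition ind ::
  "('g, 'm) monoid_scheme \<Rightarrow> 'g set \<Rightarrow> ('f::field, 'v, 'g) gmodule
    \<Rightarrow> ('f, ((('g \<Rightarrow>\<^sub>0 'f) \<times> 'v) \<Rightarrow>\<^sub>0 'f) set, 'g) gmodule" where
  "ind G H W =
    (let X = free_gmodule (group_algebra G \<times> carrier W)
               (\<lambda>g (x, w). (conv G (Poly_Mapping.single g 1) x, w))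
     in quotient_gmodule X (generated_submodule X (induction_relations G H W)))"


section \<open>Characters\<close>

text \<open>Homomorphisms \<open>G \<rightarrow> F\<^sup>*\<close>, made extensional so that they are determined by their values on \<open>G\<close>.\<close>

definition linear_character :: "('g, 'm) monoid_scheme \<Rightarrow> ('g \<Rightarrow> 'f::field) \<Rightarrow> bool" where
  "linear_character G \<kappa> \<longleftrightarrow> \<kappa> \<in> extensional (carrier G) \<and>
    (\<forall>x\<in>carrier G. \<kappa> x \<noteq> 0) \<and>
    (\<forall>x\<in>carrier G. \<forall>y\<in>carrier G. \<kappa> (x \<otimes>\<^bsub>G\<^esub> y) = \<kappa> x * \<kappa> y)"

definition char_module :: "('g \<Rightarrow> 'f::field) \<Rightarrow> ('f, 'f, 'g) gmodule" where
  "char_module \<kappa> =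
    \<lparr>carrier = UNIV, monoid.mult = undefined, one = undefined, ring.zero = 0, ring.add = (+), smult = (*),
     act = (\<lambda>g c. \<kappa> g * c)\<rparr>"

definition matrix_gmodule :: "nat \<Rightarrow> ('g \<Rightarrow> 'f::field mat) \<Rightarrow> ('f, 'f vec, 'g) gmodule" where
  "matrix_gmodule n A =
    \<lparr>carrier = carrier_vec n, monoid.mult = undefined, one = undefined,
     ring.zero = 0\<^sub>v n, ring.add = (+), smult = (\<cdot>\<^sub>v), act = (\<lambda>g v. A g *\<^sub>v v)\<rparr>"

text \<open>
  Irreducible characters are the traces of the irreducible matrix representations, again as
  extensional functions on \<open>G\<close>.
\<close>

definition Irr :: "('g, 'm) monoid_scheme \<Rightarrow> ('g \<Rightarrow> 'f::field) set" where
  "Irr G = {\<lambda>g\<in>carrier G. \<Sum>i<n. A g $$ (i, i) |n A.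
    (\<forall>g\<in>carrier G. A g \<in> carrier_mat n n) \<and> irreducible_gmodule G (matrix_gmodule n A)}"

definition right_ideal :: "'r::ring_1 set \<Rightarrow> bool" where
  "right_ideal A \<longleftrightarrow> 0 \<in> A \<and> (\<forall>x\<in>A. \<forall>y\<in>A. x - y \<in> A) \<and> (\<forall>x\<in>A. \<forall>r. x * r \<in> A)"

definition right_primitive :: "('r::ring_1 \<Rightarrow> 'f::field) \<Rightarrow> bool" where
  "right_primitive \<mu> \<longleftrightarrow> (\<forall>r. \<mu> r \<noteq> 0) \<and> (\<forall>r s. \<mu> (r + s) = \<mu> r * \<mu> s) \<and>
    (\<forall>A. right_ideal A \<and> A \<subseteq> {r. \<mu> r = 1} \<longrightarrow> A = {0})"


section \<open>The McLain group\<close>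

definition Phi :: "('l::linorder \<times> 'l) set" where
  "Phi = {(\<alpha>, \<beta>). \<alpha> < \<beta>}"

text \<open>
  The element \<open>1 + x\<close>, \<open>x \<in> J\<close>, is represented by its matrix of coefficients: the diagonal
  entries are \<open>1\<close>, and the entry at \<open>(\<alpha>, \<beta>) \<in> \<Phi>\<close> is the coefficient of \<open>e\<^bsub>\<alpha>\<beta>\<^esub>\<close> in \<open>x\<close>. For such
  matrices the set over which the product is summed is finite.
\<close>

definition mclain :: "('l::linorder \<Rightarrow> 'l \<Rightarrow> 'r::ring_1) monoid" where
  "mclain =
    \<lparr>carrier = {X. (\<forall>\<alpha>. X \<alpha> \<alpha> = 1) \<and> (\<forall>\<alpha> \<beta>. \<beta> < \<alpha> \<longrightarrow> X \<alpha> \<beta> = 0) \<and>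
       finite {(\<alpha>, \<beta>) \<in> Phi. X \<alpha> \<beta> \<noteq> 0}},
     monoid.mult = (\<lambda>X Y \<alpha> \<gamma>. \<Sum>\<beta> | X \<alpha> \<beta> \<noteq> 0 \<and> Y \<beta> \<gamma> \<noteq> 0. X \<alpha> \<beta> * Y \<beta> \<gamma>),
     one = (\<lambda>\<alpha> \<beta>. if \<alpha> = \<beta> then 1 else 0)\<rparr>"

text \<open>\<^term>\<open>root_elem (\<alpha>, \<beta>) r\<close> is \<open>1 + re\<^bsub>\<alpha>\<beta>\<^esub>\<close>.\<close>

definition root_elem :: "'l::linorder \<times> 'l \<Rightarrow> 'r::ring_1 \<Rightarrow> ('l \<Rightarrow> 'l \<Rightarrow> 'r)" where
  "root_elem d r = (\<lambda>\<gamma> \<delta>. if \<gamma> = \<delta> then 1 else if (\<gamma>, \<delta>) = d then r else 0)"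

definition mclain_gen :: "('l::linorder \<times> 'l) set \<Rightarrow> ('l \<Rightarrow> 'l \<Rightarrow> 'r::ring_1) set" where
  "mclain_gen \<Delta> = generate mclain {root_elem d r |d r. d \<in> \<Delta>}"

abbreviation mclain_sub ::
  "('l::linorder \<Rightarrow> 'l \<Rightarrow> 'r::ring_1) set \<Rightarrow> ('l \<Rightarrow> 'l \<Rightarrow> 'r) monoid" where
  "mclain_sub K \<equiv> mclain\<lparr>carrier := K\<rparr>"


section \<open>Elementary and basic modules\<close>

definition L_grp :: "'l::linorder \<times> 'l \<Rightarrow> ('l \<Rightarrow> 'l \<Rightarrow> 'r::ring_1) set" where
  "L_grp = (\<lambda>(\<alpha>, \<beta>). mclain_gen {(\<gamma>, \<delta>). \<alpha> \<le> \<gamma> \<and> \<gamma> < \<delta> \<and> \<delta> \<le> \<beta>})"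

definition P_roots :: "'l::linorder \<times> 'l \<Rightarrow> ('l \<times> 'l) set" where
  "P_roots = (\<lambda>(\<alpha>, \<beta>). {(\<gamma>, \<delta>). \<alpha> \<le> \<gamma> \<and> \<gamma> < \<beta> \<and> \<delta> = \<beta>} \<union>
     {(\<gamma>, \<delta>). \<alpha> < \<gamma> \<and> \<gamma> < \<delta> \<and> \<delta> < \<beta>})"

definition P_grp :: "'l::linorder \<times> 'l \<Rightarrow> ('l \<Rightarrow> 'l \<Rightarrow> 'r::ring_1) set" where
  "P_grp d = mclain_gen (P_roots d)"

definition N_grp :: "'l::linorder \<times> 'l \<Rightarrow> ('l \<Rightarrow> 'l \<Rightarrow> 'r::ring_1) set" where
  "N_grp = (\<lambda>(\<alpha>, \<beta>). \<Inter>{K. K \<lhd> mclain \<and>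
     {root_elem (\<gamma>, \<delta>) r |\<gamma> \<delta> r. \<gamma> < \<delta> \<and> (\<gamma> < \<alpha> \<or> \<beta> < \<delta>)} \<subseteq> K})"

definition P_char :: "'l::linorder \<times> 'l \<Rightarrow> ('r::ring_1 \<Rightarrow> 'f::field) \<Rightarrow> ('l \<Rightarrow> 'l \<Rightarrow> 'r) \<Rightarrow> 'f" where
  "P_char d \<mu> = (THE \<kappa>. linear_character (mclain_sub (P_grp d)) \<kappa> \<and>
     (\<forall>r. \<kappa> (root_elem d r) = \<mu> r) \<and>
     (\<forall>d'\<in>P_roots d - {d}. \<forall>r. \<kappa> (root_elem d' r) = 1))"

text \<open>The projection of \<open>M = N \<rtimes> L\<close> onto \<open>L\<close>.\<close>

definition L_proj :: "'l::linorder \<times> 'l \<Rightarrow> ('l \<Rightarrow> 'l \<Rightarrow> 'r::ring_1) \<Rightarrow> ('l \<Rightarrow> 'l \<Rightarrow> 'r)" where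
  "L_proj d g = (THE l. l \<in> L_grp d \<and> (\<exists>n\<in>N_grp d. g = n \<otimes>\<^bsub>mclain\<^esub> l))"

type_synonym ('l, 'r, 'f) ind_space =
  "(((('l \<Rightarrow> 'l \<Rightarrow> 'r) \<Rightarrow>\<^sub>0 'f) \<times> 'f) \<Rightarrow>\<^sub>0 'f) set"

definition elementary_module ::
  "'l::linorder \<times> 'l \<Rightarrow> ('r::ring_1 \<Rightarrow> 'f::field)
    \<Rightarrow> ('f, ('l, 'r, 'f) ind_space, 'l \<Rightarrow> 'l \<Rightarrow> 'r) gmodule" where
  "elementary_module d \<mu> =
    (let V = ind (mclain_sub (L_grp d)) (P_grp d) (char_module (P_char d \<mu>))
     in V\<lparr>act := (\<lambda>g. act V (L_proj d g))\<rparr>)"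

definition basic_subset :: "('l::linorder \<times> 'l) set \<Rightarrow> bool" where
  "basic_subset D \<longleftrightarrow> finite D \<and> D \<noteq> {} \<and> D \<subseteq> Phi \<and> inj_on fst D \<and> inj_on snd D"

definition basic_module ::
  "('l::linorder \<times> 'l) set \<Rightarrow> ('l \<times> 'l \<Rightarrow> 'r::ring_1 \<Rightarrow> 'f::field)
    \<Rightarrow> ('f, (('l \<times> 'l \<Rightarrow> ('l, 'r, 'f) ind_space) \<Rightarrow>\<^sub>0 'f) set, 'l \<Rightarrow> 'l \<Rightarrow> 'r) gmodule" where
  "basic_module D f = tensor_product D (\<lambda>d. elementary_module d (f d))"


section \<open>The groups and characters attached to a basic subset\<close>

definition Gamma :: "('l::linorder \<times> 'l) set \<Rightarrow> ('l \<times> 'l) set" where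
  "Gamma D = Phi - (\<Union>(\<alpha>, \<beta>)\<in>D. {(\<alpha>', \<gamma>) \<in> Phi. \<alpha>' = \<alpha> \<and> \<gamma> < \<beta>})"

definition Omega :: "('l::linorder \<times> 'l) set \<Rightarrow> ('l \<times> 'l) set" where
  "Omega D = {(\<alpha>, \<gamma>) \<in> Phi. \<exists>\<beta> \<delta>. (\<alpha>, \<beta>) \<in> D \<and> (\<gamma>, \<delta>) \<in> D \<and> \<alpha> < \<gamma> \<and> \<gamma> < \<beta> \<and> \<beta> < \<delta>}"

definition H_grp :: "('l::linorder \<times> 'l) set \<Rightarrow> ('l \<Rightarrow> 'l \<Rightarrow> 'r::ring_1) set" where
  "H_grp D = mclain_gen (Gamma D)"

definition I_grp :: "('l::linorder \<times> 'l) set \<Rightarrow> ('l \<Rightarrow> 'l \<Rightarrow> 'r::ring_1) set" where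
  "I_grp D = mclain_gen (Gamma D \<union> Omega D)"

definition S_grp :: "('l::linorder \<times> 'l) set \<Rightarrow> ('l \<Rightarrow> 'l \<Rightarrow> 'r::ring_1) set monoid" where
  "S_grp D = mclain_sub (I_grp D) Mod H_grp D"

definition Hi_grp :: "'l::linorder \<times> 'l \<Rightarrow> ('l \<Rightarrow> 'l \<Rightarrow> 'r::ring_1) set" where
  "Hi_grp = (\<lambda>(\<alpha>, \<beta>). mclain_gen (Phi - {(\<alpha>', \<gamma>) \<in> Phi. \<alpha>' = \<alpha> \<and> \<gamma> < \<beta>}))"

definition lambda_hat ::
  "'l::linorder \<times> 'l \<Rightarrow> ('r::ring_1 \<Rightarrow> 'f::field) \<Rightarrow> ('l \<Rightarrow> 'l \<Rightarrow> 'r) \<Rightarrow> 'f" where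
  "lambda_hat d \<mu> = (THE \<kappa>. linear_character (mclain_sub (Hi_grp d)) \<kappa> \<and>
     (\<forall>r. \<kappa> (root_elem d r) = \<mu> r) \<and>
     (\<forall>d'\<in>Phi - {(\<alpha>, \<gamma>) \<in> Phi. \<alpha> = fst d \<and> \<gamma> \<le> snd d}. \<forall>r. \<kappa> (root_elem d' r) = 1))"

definition lambda_char ::
  "('l::linorder \<times> 'l) set \<Rightarrow> ('l \<times> 'l \<Rightarrow> 'r::ring_1 \<Rightarrow> 'f::field) \<Rightarrow> ('l \<Rightarrow> 'l \<Rightarrow> 'r) \<Rightarrow> 'f" where
  "lambda_char D f = (\<lambda>x\<in>H_grp D. \<Prod>d\<in>D. lambda_hat d (f d) x)"

definition extends_lambda ::
  "('l::linorder \<times> 'l) set \<Rightarrow> ('l \<times> 'l \<Rightarrow> 'r::ring_1 \<Rightarrow> 'f::field)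
    \<Rightarrow> (('l \<Rightarrow> 'l \<Rightarrow> 'r) set \<Rightarrow> 'f) \<Rightarrow> (('l \<Rightarrow> 'l \<Rightarrow> 'r) \<Rightarrow> 'f) \<Rightarrow> bool" where
  "extends_lambda D f \<chi> \<kappa> \<longleftrightarrow> linear_character (mclain_sub (I_grp D)) \<kappa> \<and>
     (\<forall>x\<in>H_grp D. \<kappa> x = lambda_char D f x) \<and>
     (\<forall>d\<in>Omega D. \<forall>r. \<kappa> (root_elem d r) = \<chi> (root_elem d r <#\<^bsub>mclain\<^esub> H_grp D))"

definition W1 ::
  "('l::linorder \<times> 'l) set \<Rightarrow> ('l \<times> 'l \<Rightarrow> 'r::ring_1 \<Rightarrow> 'f::field)
    \<Rightarrow> (('l \<Rightarrow> 'l \<Rightarrow> 'r) set \<Rightarrow> 'f) \<Rightarrow> ('f, 'f, 'l \<Rightarrow> 'l \<Rightarrow> 'r) gmodule" where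
  "W1 D f \<chi> = char_module (THE \<kappa>. extends_lambda D f \<chi> \<kappa>)"

definition special_triple :: "('l::linorder \<times> 'l) set \<Rightarrow> bool" where
  "special_triple D \<longleftrightarrow> (\<exists>a1 b1 a2 b2 a3 b3.
     (a1, b1) \<in> D \<and> (a2, b2) \<in> D \<and> (a3, b3) \<in> D \<and>
     a1 < a2 \<and> a2 < a3 \<and> a3 = b1 \<and> b1 < b2 \<and> b2 < b3)"

text \<open>
  The index set of the ascending series is a well-ordered type \<open>'x\<close>, given by its
  \<^typ>\<open>'x itself\<close> argument. When the predicate is a hypothesis and \<open>'x\<close> is a free type variable
  which occurs nowhere else, the hypothesis amounts to the existence of a series over some
  well-ordered set. The parameter \<open>p\<close> is the characteristic of the field.
\<close>

definition strongly_ascendant ::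
  "'x::wellorder itself \<Rightarrow> nat \<Rightarrow> 'g set \<Rightarrow> ('g, 'm) monoid_scheme \<Rightarrow> bool" where
  "strongly_ascendant X p S G \<longleftrightarrow>
    (\<exists>(T :: 'x \<Rightarrow> 'g set) x0 x1.
      (\<forall>x. x0 \<le> x \<and> x \<le> x1) \<and> (\<forall>x. subgroup (T x) G) \<and> T x0 = S \<and> T x1 = carrier G \<and>
      (\<forall>x y. x < y \<and> (\<nexists>z. x < z \<and> z < y) \<longrightarrow>
        T x \<lhd> G\<lparr>carrier := T y\<rparr> \<and>
        finite (rcosets\<^bsub>G\<lparr>carrier := T y\<rparr>\<^esub> T x) \<and>
        (p = 0 \<or> \<not> p dvd card (rcosets\<^bsub>G\<lparr>carrier := T y\<rparr>\<^esub> T x))) \<and>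
      (\<forall>x. x \<noteq> x0 \<and> (\<nexists>y. y < x \<and> (\<nexists>z. y < z \<and> z < x)) \<longrightarrow> T x = (\<Union>y\<in>{..<x}. T y)))"

end

theory Submission
  imports Defs "HOL-Library.Function_Algebras" "HOL-Computational_Algebra.Polynomial"
    "HOL-Computational_Algebra.Primes"
begin

text \<open>
  For a linear character \<open>\<kappa>\<close> of \<open>K \<le> G\<close>, the module induced from \<open>\<kappa>\<close> is realised as the space of
  functions \<open>\<phi>\<close> on \<open>G\<close> with \<open>\<phi>(yk) \<kappa>(k) = \<phi>(y)\<close> and support in finitely many cosets, with \<open>G\<close>
  acting by left translation. An elementary module is then induced from \<open>H\<^sub>i\<close> to \<open>M\<close>, and the
  pointwise product of functions identifies \<open>V(D, f)\<close> with the module induced from \<open>\<lambda>\<close>, because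
  \<open>M / H \<rightarrow> \<Prod>\<^sub>i M / H\<^sub>i\<close> is a bijection.

  Without special triples, \<open>x \<mapsto> \<Prod>\<^sub>i \<lambda>\<^sub>i(x\<^bsub>\<alpha>\<^sub>i\<beta>\<^sub>i\<^esub>)\<close> is a character of \<open>I\<close> extending \<open>\<lambda>\<close>, and each extension in
  question is its product with a character of \<open>S\<close>. Right translation, twisted by this extension,
  makes \<open>S\<close> act on the module induced from \<open>\<lambda>\<close>. The group \<open>S\<close> has exponent dividing \<open>N = |\<lambda>\<^sub>1(R)|\<close>,
  and \<open>x\<^sup>N - 1\<close> splits over \<open>F\<close> into distinct linear factors, so that this action is diagonalisable;
  its eigenspaces are the modules induced from \<open>I\<close>.

  They are not isomorphic, since a vector of the module induced from \<open>W\<^sub>1(\<chi>)\<close> on which \<open>H\<close> acts by \<open>\<lambda>\<close>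
  is a multiple of the generator: for \<open>t \<notin> I\<close> there is an \<open>h \<in> H\<close> with \<open>t\<inverse>ht \<in> H\<close> and
  \<open>\<lambda>(t\<inverse>ht) \<noteq> \<lambda>(h)\<close>.
\<close>

section \<open>Quotients of free modules\<close>

text \<open>Induced modules and tensor products are quotients by generated submodules, hence by
  intersections with no explicit members. Functions make these explicit: the relations reduce every
  vector to a few basis vectors, point evaluations show the functions of those to be independent, so
  the generated submodule is exactly the kernel of the map to functions. Afterwards everything lives
  in one space of functions on \<open>M\<close>, and the decomposition is an equality of subspaces.

  The number \<open>N\<close> plays two roles. As \<open>N R\<close> is a right ideal in the kernel
  of \<open>\<lambda>\<^sub>1\<close>, it is zero, so root elements have order dividing
  \<open>N\<close>. And \<open>\<lambda>\<^sub>1(R)\<close> consists of \<open>N\<close> distinct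
  roots of unity in \<open>F\<close> itself, which forces the characteristic not to divide
  \<open>N\<close>; hence averaging over this group works over \<open>F\<close> without algebraic
  closure.

  Finiteness of \<open>R\<close> makes \<open>I / H\<close> finite, because a coset is determined by
  the finitely many entries at \<open>Omega D\<close>. Therefore support in finitely many cosets of
  \<open>I\<close> and of \<open>H\<close> is the same condition.\<close>

interpretation fs: vector_space "\<lambda>(c::'f::field) (\<phi>::'g \<Rightarrow> 'f) y. c * \<phi> y"
  by standard (auto simp: fun_eq_iff algebra_simps)

lemma lookup_scale [simp]:
  "Poly_Mapping.lookup (Poly_Mapping.map ((*) c) u) b = (c::'f::field) * Poly_Mapping.lookup u b"
  by (simp add: Poly_Mapping.map.rep_eq when_def)

text \<open>The scaling is literally that of \<open>free_gmodule\<close>, so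
  \<open>pm.subspace\<close> and \<open>pm.span\<close> speak about its submodules.\<close>

interpretation pm: vector_space "\<lambda>(c::'f::field) (u::'b \<Rightarrow>\<^sub>0 'f). Poly_Mapping.map ((*) c) u"
  by (standard; rule poly_mapping_eqI; simp only: lookup_scale lookup_add distrib_left distrib_right mult_1 mult.assoc)

lemma keys_scale: "Poly_Mapping.keys (Poly_Mapping.map ((*) (c::'f::field)) u) \<subseteq> Poly_Mapping.keys u"
  by (auto simp: in_keys_iff)

lemma keys_uminus: "Poly_Mapping.keys (- u) = Poly_Mapping.keys (u :: 'b \<Rightarrow>\<^sub>0 'f::field)"
  by (auto simp: in_keys_iff)

lemma poly_mapping_eq_sum_single:
  "u = (\<Sum>b\<in>Poly_Mapping.keys u. Poly_Mapping.single b (Poly_Mapping.lookup u b))"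
  by (rule poly_mapping_eqI)
    (auto simp: lookup_sum lookup_single when_def in_keys_iff if_distrib sum.delta' cong: if_cong)

lemma sum_apply: "(\<Sum>i\<in>A. u i) y = (\<Sum>i\<in>A. u i y)" for u :: "'i \<Rightarrow> 'g \<Rightarrow> 'f::comm_monoid_add"
  by (induction A rule: infinite_finite_induct) auto

text \<open>The linear map out of a free space with \<open>b\<close> going to the function
  \<open>\<theta> b\<close>. For each quotient below a \<open>\<theta>\<close> is chosen so that
  this map has the relations as its kernel.\<close>

definition lin_ext :: "('b \<Rightarrow> 'g \<Rightarrow> 'f::field) \<Rightarrow> ('b \<Rightarrow>\<^sub>0 'f) \<Rightarrow> 'g \<Rightarrow> 'f" where
  "lin_ext \<theta> u = (\<lambda>y. \<Sum>b\<in>Poly_Mapping.keys u. Poly_Mapping.lookup u b * \<theta> b y)"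

lemma lin_ext_superset:
  assumes "finite A" "Poly_Mapping.keys u \<subseteq> A"
  shows "lin_ext \<theta> u y = (\<Sum>b\<in>A. Poly_Mapping.lookup u b * \<theta> b y)"
  unfolding lin_ext_def by (rule sum.mono_neutral_left) (use assms in \<open>auto simp: in_keys_iff\<close>)

lemma lin_ext_add: "lin_ext \<theta> (u + v) = lin_ext \<theta> u + lin_ext \<theta> v"
proof
  fix y
  let ?A = "Poly_Mapping.keys u \<union> Poly_Mapping.keys v"
  show "lin_ext \<theta> (u + v) y = (lin_ext \<theta> u + lin_ext \<theta> v) y"
    using Poly_Mapping.keys_add[of u v]
    by (simp add: lin_ext_superset[of ?A] lookup_add ring_distribs sum.distrib)
qed

lemma lin_ext_scale: "lin_ext \<theta> (Poly_Mapping.map ((*) c) u) = (\<lambda>y. c * lin_ext \<theta> u y)"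
proof
  fix y
  show "lin_ext \<theta> (Poly_Mapping.map ((*) c) u) y = c * lin_ext \<theta> u y"
    using keys_scale[of c u]
    by (simp add: lin_ext_superset[of "Poly_Mapping.keys u"] sum_distrib_left mult.assoc)
qed

lemma lin_ext_cong:
  assumes "\<And>b. b \<in> Poly_Mapping.keys u \<Longrightarrow> \<theta> b = \<theta>' b"
  shows "lin_ext \<theta> u = lin_ext \<theta>' u"
  using assms by (auto simp: lin_ext_def fun_eq_iff intro!: sum.cong)

lemma lin_ext_0 [simp]: "lin_ext \<theta> 0 = 0"
  by (simp add: lin_ext_def fun_eq_iff)

lemma lin_ext_uminus: "lin_ext \<theta> (- u) = - lin_ext \<theta> u"
  proof -
  have "- u = Poly_Mapping.map ((*) (-1)) u" by (rule poly_mapping_eqI) (simp only: lookup_scale lookup_uminus mult_minus1)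
  then show ?thesis by (simp only: lin_ext_scale) (simp add: fun_eq_iff)
qed

lemma lin_ext_diff: "lin_ext \<theta> (u - v) = lin_ext \<theta> u - lin_ext \<theta> v"
  using lin_ext_add[of \<theta> u "- v"] by (simp add: lin_ext_uminus)

lemma lin_ext_single [simp]: "lin_ext \<theta> (Poly_Mapping.single b c) = (\<lambda>y. c * \<theta> b y)"
  by (auto simp: lin_ext_def)

lemma lin_ext_sum: "lin_ext \<theta> (\<Sum>i\<in>A. u i) = (\<Sum>i\<in>A. lin_ext \<theta> (u i))"
  by (induction A rule: infinite_finite_induct) (auto simp: lin_ext_add)

lemma lin_ext_in_span: "lin_ext \<theta> u \<in> fs.span (\<theta> ` Poly_Mapping.keys u)"
proof -
  have "lin_ext \<theta> u = (\<Sum>b\<in>Poly_Mapping.keys u. (\<lambda>y. Poly_Mapping.lookup u b * \<theta> b y))"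
    by (simp add: lin_ext_def fun_eq_iff sum_apply)
  also have "\<dots> \<in> fs.span (\<theta> ` Poly_Mapping.keys u)"
    by (intro fs.span_sum fs.span_scale fs.span_base imageI)
  finally show ?thesis .
qed

lemma lin_ext_image:
  fixes \<theta> :: "'b \<Rightarrow> 'g \<Rightarrow> 'f::field"
  shows "lin_ext \<theta> ` {u. Poly_Mapping.keys u \<subseteq> B} = fs.span (\<theta> ` B)"
proof
  show "lin_ext \<theta> ` {u. Poly_Mapping.keys u \<subseteq> B} \<subseteq> fs.span (\<theta> ` B)"
    using subsetD[OF fs.span_mono[OF image_mono] lin_ext_in_span] by blast
  have "fs.subspace (lin_ext \<theta> ` {u. Poly_Mapping.keys u \<subseteq> B})"
    unfolding fs.subspace_def
  proof safe
    show "0 \<in> lin_ext \<theta> ` {u. Poly_Mapping.keys u \<subseteq> B}"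
      by (rule image_eqI[of _ _ 0]) auto
  next
    fix u v :: "'b \<Rightarrow>\<^sub>0 'f" assume "Poly_Mapping.keys u \<subseteq> B" "Poly_Mapping.keys v \<subseteq> B"
    then show "lin_ext \<theta> u + lin_ext \<theta> v \<in> lin_ext \<theta> ` {u. Poly_Mapping.keys u \<subseteq> B}"
      using Poly_Mapping.keys_add[of u v] by (intro image_eqI[of _ _ "u + v"]) (auto simp: lin_ext_add)
  next
    fix c and u :: "'b \<Rightarrow>\<^sub>0 'f" assume "Poly_Mapping.keys u \<subseteq> B"
    then show "(\<lambda>y. c * lin_ext \<theta> u y) \<in> lin_ext \<theta> ` {u. Poly_Mapping.keys u \<subseteq> B}"
      using keys_scale[of c u]
      by (intro image_eqI[of _ _ "Poly_Mapping.map ((*) c) u"]) (auto simp: lin_ext_scale)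
  qed
  moreover have "\<theta> b \<in> lin_ext \<theta> ` {u. Poly_Mapping.keys u \<subseteq> B}" if "b \<in> B" for b
    by (rule image_eqI[of _ _ "Poly_Mapping.single b 1"]) (use that in auto)
  ultimately show "fs.span (\<theta> ` B) \<subseteq> lin_ext \<theta> ` {u. Poly_Mapping.keys u \<subseteq> B}"
    by (intro fs.span_minimal image_subsetI)
qed

text \<open>Evaluation at the point that belongs to \<open>b\<close> kills all other terms, so each
  coefficient of \<open>u\<close> vanishes.\<close>

lemma lin_ext_separated:
  assumes sep: "\<And>b. b \<in> B0 \<Longrightarrow> \<exists>y. \<theta> b y \<noteq> 0 \<and> (\<forall>b'\<in>B0. b' \<noteq> b \<longrightarrow> \<theta> b' y = 0)"
    and "Poly_Mapping.keys u \<subseteq> B0" "lin_ext \<theta> u = 0"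
  shows "u = 0"
proof (rule poly_mapping_eqI)
  fix b
  show "Poly_Mapping.lookup u b = Poly_Mapping.lookup 0 b"
  proof (cases "b \<in> Poly_Mapping.keys u")
    case True
    then obtain y where y: "\<theta> b y \<noteq> 0" "\<forall>b'\<in>B0. b' \<noteq> b \<longrightarrow> \<theta> b' y = 0"
      using sep assms(2) by blast
    have "0 = lin_ext \<theta> u y" using assms(3) by simp
    also have "\<dots> = (\<Sum>b'\<in>Poly_Mapping.keys u. if b' = b then Poly_Mapping.lookup u b * \<theta> b y else 0)"
      unfolding lin_ext_def using y assms(2) by (intro sum.cong) auto
    finally show ?thesis using y True by simp
  qed (simp add: in_keys_iff)
qed

text \<open>A sum and not a renaming of keys, since \<open>\<sigma>\<close> may identify basis
  vectors; this is the action in \<open>free_gmodule\<close>.\<close>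

definition push :: "('b \<Rightarrow> 'b) \<Rightarrow> ('b \<Rightarrow>\<^sub>0 'f::field) \<Rightarrow> ('b \<Rightarrow>\<^sub>0 'f)" where
  "push \<sigma> u = (\<Sum>b\<in>Poly_Mapping.keys u. Poly_Mapping.single (\<sigma> b) (Poly_Mapping.lookup u b))"

lemma keys_push: "Poly_Mapping.keys (push \<sigma> u) \<subseteq> \<sigma> ` Poly_Mapping.keys u"
  unfolding push_def using Poly_Mapping.keys_sum by (force split: if_splits)

lemma lin_ext_push: "lin_ext \<theta> (push \<sigma> u) = lin_ext (\<lambda>b. \<theta> (\<sigma> b)) u"
  by (simp add: push_def lin_ext_sum) (simp add: lin_ext_def fun_eq_iff sum_apply)

text \<open>Functions on a group are total functions that vanish off the carrier; the value 0 keeps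
  translation within this class.\<close>

definition ltrans :: "('g, 'm) monoid_scheme \<Rightarrow> 'g \<Rightarrow> ('g \<Rightarrow> 'f::field) \<Rightarrow> 'g \<Rightarrow> 'f" where
  "ltrans G g \<phi> = (\<lambda>y. if y \<in> carrier G then \<phi> (inv\<^bsub>G\<^esub> g \<otimes>\<^bsub>G\<^esub> y) else 0)"

lemma ltrans_add: "ltrans G g (\<phi> + \<psi>) = ltrans G g \<phi> + ltrans G g \<psi>"
  by (auto simp: ltrans_def)

lemma ltrans_0 [simp]: "ltrans G g 0 = 0"
  by (auto simp: ltrans_def)

lemma ltrans_scale: "ltrans G g (\<lambda>y. c * \<phi> y) = (\<lambda>y. c * ltrans G g \<phi> y)"
  by (auto simp: ltrans_def)

lemma ltrans_sum: "ltrans G g (\<Sum>i\<in>A. u i) = (\<Sum>i\<in>A. ltrans G g (u i))"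
  by (auto simp: ltrans_def sum_apply fun_eq_iff)

lemma ltrans_lin_ext: "ltrans G g (lin_ext \<theta> u) = lin_ext (\<lambda>b. ltrans G g (\<theta> b)) u"
  by (auto simp: ltrans_def lin_ext_def)

lemma (in group) ltrans_one:
  assumes "\<And>y. y \<notin> carrier G \<Longrightarrow> \<phi> y = 0"
  shows "ltrans G \<one> \<phi> = \<phi>"
  using assms by (auto simp: ltrans_def)

lemma (in group) ltrans_mult:
  assumes "g \<in> carrier G" "h \<in> carrier G"
  shows "ltrans G (g \<otimes> h) \<phi> = ltrans G g (ltrans G h \<phi>)"
  using assms by (auto simp: ltrans_def inv_mult_group m_assoc)

text \<open>The module axioms are not required of \<open>V\<close>: it inherits them from the function space.\<close>

definition fun_model ::
  "('g, 'm) monoid_scheme \<Rightarrow> 'g set \<Rightarrow> ('f::field, 'v, 'g) gmodule \<Rightarrow> ('g \<Rightarrow> 'f) set \<Rightarrow> ('v \<Rightarrow> 'g \<Rightarrow> 'f) \<Rightarrow> bool"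
  where
  "fun_model G A V Y \<Psi> \<longleftrightarrow> bij_betw \<Psi> (carrier V) Y \<and>
    \<zero>\<^bsub>V\<^esub> \<in> carrier V \<and> \<Psi> \<zero>\<^bsub>V\<^esub> = 0 \<and>
    (\<forall>v\<in>carrier V. \<forall>w\<in>carrier V. v \<oplus>\<^bsub>V\<^esub> w \<in> carrier V \<and> \<Psi> (v \<oplus>\<^bsub>V\<^esub> w) = \<Psi> v + \<Psi> w) \<and>
    (\<forall>c. \<forall>v\<in>carrier V. c \<odot>\<^bsub>V\<^esub> v \<in> carrier V \<and> \<Psi> (c \<odot>\<^bsub>V\<^esub> v) = (\<lambda>y. c * \<Psi> v y)) \<and>
    (\<forall>g\<in>A. \<forall>v\<in>carrier V. act V g v \<in> carrier V \<and> \<Psi> (act V g v) = ltrans G g (\<Psi> v))"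

lemma fun_modelD:
  assumes "fun_model G A V Y \<Psi>"
  shows "bij_betw \<Psi> (carrier V) Y" "\<zero>\<^bsub>V\<^esub> \<in> carrier V" "\<Psi> \<zero>\<^bsub>V\<^esub> = 0"
    "\<And>v w. v \<in> carrier V \<Longrightarrow> w \<in> carrier V \<Longrightarrow> v \<oplus>\<^bsub>V\<^esub> w \<in> carrier V"
    "\<And>v w. v \<in> carrier V \<Longrightarrow> w \<in> carrier V \<Longrightarrow> \<Psi> (v \<oplus>\<^bsub>V\<^esub> w) = \<Psi> v + \<Psi> w"
    "\<And>c v. v \<in> carrier V \<Longrightarrow> c \<odot>\<^bsub>V\<^esub> v \<in> carrier V"
    "\<And>c v. v \<in> carrier V \<Longrightarrow> \<Psi> (c \<odot>\<^bsub>V\<^esub> v) = (\<lambda>y. c * \<Psi> v y)"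
    "\<And>g v. g \<in> A \<Longrightarrow> v \<in> carrier V \<Longrightarrow> act V g v \<in> carrier V"
    "\<And>g v. g \<in> A \<Longrightarrow> v \<in> carrier V \<Longrightarrow> \<Psi> (act V g v) = ltrans G g (\<Psi> v)"
    "\<And>v. v \<in> carrier V \<Longrightarrow> \<Psi> v \<in> Y"
    "\<And>v w. v \<in> carrier V \<Longrightarrow> w \<in> carrier V \<Longrightarrow> \<Psi> v = \<Psi> w \<Longrightarrow> v = w"
  using assms unfolding fun_model_def bij_betw_def inj_on_def by auto

lemma cring_scalars: "cring (scalars :: 'f::field ring)"
proof (rule cringI)
  show "abelian_group (scalars :: 'f ring)"
    by (rule abelian_groupI) (auto simp: algebra_simps intro: exI[of _ "- _"])
  show "comm_monoid (scalars :: 'f ring)"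
    by (rule comm_monoidI) (auto simp: algebra_simps)
qed (auto simp: algebra_simps)

text \<open>Each axiom holds for functions and is pulled back along the injective
  \<open>\<Psi>\<close>. Vanishing off the carrier is what makes translation by the unit the
  identity.\<close>

lemma fun_model_gmodule:
  assumes G: "group G" and A: "subgroup A G" and m: "fun_model G A V Y \<Psi>"
    and supp: "\<And>\<phi> y. \<phi> \<in> Y \<Longrightarrow> y \<notin> carrier G \<Longrightarrow> \<phi> y = 0"
  shows "gmodule (G\<lparr>carrier := A\<rparr>) V"
proof -
  interpret G: group G by fact
  note D = fun_modelD[OF m] and E = fun_modelD(2-9)[OF m]
  \<comment> \<open>The additive inverse has to be exhibited; scaling by -1 supplies it.\<close>
  have neg: "\<exists>w\<in>carrier V. w \<oplus>\<^bsub>V\<^esub> v = \<zero>\<^bsub>V\<^esub>" if "v \<in> carrier V" for v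
  proof (intro bexI[of _ "(-1) \<odot>\<^bsub>V\<^esub> v"])
    show "(- 1) \<odot>\<^bsub>V\<^esub> v \<oplus>\<^bsub>V\<^esub> v = \<zero>\<^bsub>V\<^esub>"
      by (rule D(11)) (use that in \<open>auto simp: E fun_eq_iff\<close>)
  qed (use that in \<open>auto simp: E\<close>)
  have ab: "abelian_group V"
  proof (rule abelian_groupI)
    show "x \<oplus>\<^bsub>V\<^esub> y \<oplus>\<^bsub>V\<^esub> z = x \<oplus>\<^bsub>V\<^esub> (y \<oplus>\<^bsub>V\<^esub> z)" if "x \<in> carrier V" "y \<in> carrier V" "z \<in> carrier V" for x y z
      by (rule D(11)) (use that in \<open>auto simp: E add.assoc\<close>)
    show "x \<oplus>\<^bsub>V\<^esub> y = y \<oplus>\<^bsub>V\<^esub> x" if "x \<in> carrier V" "y \<in> carrier V" for x y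
      by (rule D(11)) (use that in \<open>auto simp: E add.commute\<close>)
    show "\<zero>\<^bsub>V\<^esub> \<oplus>\<^bsub>V\<^esub> x = x" if "x \<in> carrier V" for x
      by (rule D(11)) (use that in \<open>auto simp: E\<close>)
  qed (use neg in \<open>auto simp: E\<close>)
  have l: "(a + b) \<odot>\<^bsub>V\<^esub> x = a \<odot>\<^bsub>V\<^esub> x \<oplus>\<^bsub>V\<^esub> b \<odot>\<^bsub>V\<^esub> x" if "x \<in> carrier V" for a b x
    by (rule D(11)) (use that in \<open>auto simp: E fun_eq_iff algebra_simps\<close>)
  have r: "a \<odot>\<^bsub>V\<^esub> (x \<oplus>\<^bsub>V\<^esub> y) = a \<odot>\<^bsub>V\<^esub> x \<oplus>\<^bsub>V\<^esub> a \<odot>\<^bsub>V\<^esub> y" if "x \<in> carrier V" "y \<in> carrier V" for a x y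
    by (rule D(11)) (use that in \<open>auto simp: E fun_eq_iff algebra_simps\<close>)
  have assoc: "(a * b) \<odot>\<^bsub>V\<^esub> x = a \<odot>\<^bsub>V\<^esub> (b \<odot>\<^bsub>V\<^esub> x)" if x: "x \<in> carrier V" for a b x
  proof (rule D(11))
    show "\<Psi> ((a * b) \<odot>\<^bsub>V\<^esub> x) = \<Psi> (a \<odot>\<^bsub>V\<^esub> (b \<odot>\<^bsub>V\<^esub> x))"
      by (simp only: D(7)[OF x] D(7)[OF D(6)[OF x]] mult.assoc)
  qed (intro D(6) x)+
  have one: "1 \<odot>\<^bsub>V\<^esub> x = x" if "x \<in> carrier V" for x
    by (rule D(11)) (use that in \<open>simp_all add: E\<close>)
  have mod: "module scalars V"
    by (rule moduleI[OF cring_scalars ab]) (simp_all add: E l r one assoc)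
  have Asub: "g \<in> carrier G" if "g \<in> A" for g using that subgroup.subset[OF A] by blast
  have oneA: "\<one>\<^bsub>G\<^esub> \<in> A" by (rule subgroup.one_closed[OF A])
  have aadd: "act V g (v \<oplus>\<^bsub>V\<^esub> w) = act V g v \<oplus>\<^bsub>V\<^esub> act V g w"
    if "g \<in> A" "v \<in> carrier V" "w \<in> carrier V" for g v w
    by (rule D(11)) (use that in \<open>simp_all add: E ltrans_add\<close>)
  have asm: "act V g (c \<odot>\<^bsub>V\<^esub> v) = c \<odot>\<^bsub>V\<^esub> act V g v" if "g \<in> A" "v \<in> carrier V" for g c v
    by (rule D(11)) (use that in \<open>simp_all add: E ltrans_scale\<close>)
  have aone: "act V \<one>\<^bsub>G\<^esub> v = v" if "v \<in> carrier V" for v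
    by (rule D(11)) (use that oneA in \<open>simp_all add: E(7,8) G.ltrans_one supp[OF D(10)]\<close>)
  have amul: "act V (g \<otimes>\<^bsub>G\<^esub> h) v = act V g (act V h v)" if "g \<in> A" "h \<in> A" "v \<in> carrier V" for g h v
    by (rule D(11)) (use that in \<open>simp_all add: subgroup.m_closed[OF A] E(7,8) Asub G.ltrans_mult\<close>)
  show ?thesis
    by (intro gmodule.intro gmodule_axioms.intro mod G.subgroup_imp_group A) (simp_all add: E aadd asm aone amul)
qed

section \<open>Submodules of free modules and quotients by relations\<close>

lemma free_gmodule_simps [simp]:
  "carrier (free_gmodule B \<sigma>) = {u. Poly_Mapping.keys u \<subseteq> B}"
  "\<zero>\<^bsub>free_gmodule B \<sigma>\<^esub> = 0"
  "u \<oplus>\<^bsub>free_gmodule B \<sigma>\<^esub> v = u + v"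
  "c \<odot>\<^bsub>free_gmodule B \<sigma>\<^esub> u = Poly_Mapping.map ((*) c) u"
  "act (free_gmodule B \<sigma>) g u = push (\<sigma> g) u"
  by (auto simp: free_gmodule_def push_def)

lemma submodule_free_gmodule_iff:
  "submodule U scalars (free_gmodule B \<sigma>) \<longleftrightarrow> U \<subseteq> {u. Poly_Mapping.keys u \<subseteq> B} \<and> pm.subspace U"
proof -
  let ?X = "free_gmodule B \<sigma>"
  \<comment> \<open>Additive subgroups must be closed under the inverse of the additive monoid, a
    definite description that first has to be recognised as unary minus.\<close>
  have inv: "inv\<^bsub>add_monoid ?X\<^esub> x = - x" if "Poly_Mapping.keys x \<subseteq> B" for x
    unfolding m_inv_def
  proof (rule the_equality)
    show "- x \<in> carrier (add_monoid ?X) \<and> x \<otimes>\<^bsub>add_monoid ?X\<^esub> - x = \<one>\<^bsub>add_monoid ?X\<^esub> \<and>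
      - x \<otimes>\<^bsub>add_monoid ?X\<^esub> x = \<one>\<^bsub>add_monoid ?X\<^esub>"
      using that by (simp add: keys_uminus)
    show "y = - x" if "y \<in> carrier (add_monoid ?X) \<and> x \<otimes>\<^bsub>add_monoid ?X\<^esub> y = \<one>\<^bsub>add_monoid ?X\<^esub> \<and>
      y \<otimes>\<^bsub>add_monoid ?X\<^esub> x = \<one>\<^bsub>add_monoid ?X\<^esub>" for y
      using that minus_unique[of x y] by simp
  qed
  show ?thesis
  proof
    assume "submodule U scalars ?X"
    then interpret submodule U scalars ?X .
    show "U \<subseteq> {u. Poly_Mapping.keys u \<subseteq> B} \<and> pm.subspace U"
      unfolding pm.subspace_def using subset m_closed one_closed smult_closed by simp
  next
    assume *: "U \<subseteq> {u. Poly_Mapping.keys u \<subseteq> B} \<and> pm.subspace U"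
    have "subgroup U (add_monoid ?X)"
    proof (rule subgroup.intro)
      show "inv\<^bsub>add_monoid ?X\<^esub> x \<in> U" if "x \<in> U" for x
      proof -
        have "inv\<^bsub>add_monoid ?X\<^esub> x = - x" using that * by (intro inv) auto
        then show ?thesis using pm.subspace_neg[of U x] * that by auto
      qed
    qed (use * in \<open>auto simp: pm.subspace_def\<close>)
    moreover have "submodule_axioms U scalars ?X"
      unfolding submodule_axioms_def using * by (auto simp: pm.subspace_def)
    ultimately show "submodule U scalars ?X" by (rule submodule.intro)
  qed
qed

text \<open>Here \<open>R\<close> is a set of relations and \<open>B0\<close> the prospective basis
  of the quotient: reducibility of all basis vectors is the spanning half of that claim.\<close>

definition reducible :: "('b \<Rightarrow>\<^sub>0 'f::field) set \<Rightarrow> 'b set \<Rightarrow> ('b \<Rightarrow>\<^sub>0 'f) \<Rightarrow> bool" where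
  "reducible R B0 u \<longleftrightarrow> (\<exists>u0. Poly_Mapping.keys u0 \<subseteq> B0 \<and> u - u0 \<in> pm.span R)"

lemma reducible_keys: "Poly_Mapping.keys u \<subseteq> B0 \<Longrightarrow> reducible R B0 u"
  unfolding reducible_def by (rule exI[of _ u]) (simp add: pm.span_zero)

lemma reducible_add:
  assumes "reducible R B0 u" "reducible R B0 v"
  shows "reducible R B0 (u + v)"
proof -
  obtain u0 v0 where uv: "Poly_Mapping.keys u0 \<subseteq> B0" "u - u0 \<in> pm.span R"
    "Poly_Mapping.keys v0 \<subseteq> B0" "v - v0 \<in> pm.span R" using assms unfolding reducible_def by blast
  have eq: "(u + v) - (u0 + v0) = (u - u0) + (v - v0)" by (simp add: algebra_simps)
  have "(u + v) - (u0 + v0) \<in> pm.span R" unfolding eq by (rule pm.span_add[OF uv(2,4)])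
  moreover have "Poly_Mapping.keys (u0 + v0) \<subseteq> B0" using Poly_Mapping.keys_add[of u0 v0] uv by blast
  ultimately show ?thesis unfolding reducible_def by blast
qed

lemma reducible_scale:
  assumes "reducible R B0 u"
  shows "reducible R B0 (Poly_Mapping.map ((*) c) u)"
proof -
  obtain u0 where u0: "Poly_Mapping.keys u0 \<subseteq> B0" "u - u0 \<in> pm.span R"
    using assms unfolding reducible_def by blast
  have "Poly_Mapping.map ((*) c) u - Poly_Mapping.map ((*) c) u0 \<in> pm.span R"
    using pm.span_scale[OF u0(2), of c] by (simp add: pm.scale_right_diff_distrib)
  moreover have "Poly_Mapping.keys (Poly_Mapping.map ((*) c) u0) \<subseteq> B0"
    using order_trans[OF keys_scale u0(1)] .
  ultimately show ?thesis unfolding reducible_def by blast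
qed

lemma reducible_cong:
  assumes "reducible R B0 v" "u - v \<in> pm.span R"
  shows "reducible R B0 u"
proof -
  obtain u0 where u0: "Poly_Mapping.keys u0 \<subseteq> B0" "v - u0 \<in> pm.span R"
    using assms unfolding reducible_def by blast
  have eq: "u - u0 = (u - v) + (v - u0)" by simp
  have "u - u0 \<in> pm.span R" unfolding eq by (rule pm.span_add[OF assms(2) u0(2)])
  then show ?thesis using u0 unfolding reducible_def by blast
qed

text \<open>A kernel element is congruent to some \<open>u0\<close> supported on \<open>B0\<close>.
  Since relations go to zero, so does \<open>u0\<close>, and separation forces
  \<open>u0 = 0\<close>; the element was a combination of relations all along.\<close>

lemma generated_submodule_eq_kernel:
  assumes rel: "\<And>r. r \<in> R \<Longrightarrow> Poly_Mapping.keys r \<subseteq> B \<and> lin_ext \<theta> r = 0"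
    and sep: "\<And>b. b \<in> B0 \<Longrightarrow> \<exists>y. \<theta> b y \<noteq> 0 \<and> (\<forall>b'\<in>B0. b' \<noteq> b \<longrightarrow> \<theta> b' y = 0)"
    and red: "\<And>b. b \<in> B \<Longrightarrow> reducible R B0 (Poly_Mapping.single b 1)"
  shows "generated_submodule (free_gmodule B \<sigma>) R = {u. Poly_Mapping.keys u \<subseteq> B \<and> lin_ext \<theta> u = 0}"
    (is "?K = ?ker")
proof
  have sub: "pm.subspace ?ker"
    by (rule pm.subspaceI)
      (auto simp: lin_ext_add lin_ext_scale fun_eq_iff dest: subsetD[OF Poly_Mapping.keys_add] subsetD[OF keys_scale])
  then show "?K \<subseteq> ?ker"
    unfolding generated_submodule_def using rel by (intro Inter_lower) (auto simp: submodule_free_gmodule_iff)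
  have span_ker: "pm.span R \<subseteq> ?ker" using sub rel by (intro pm.span_minimal) auto
  have red': "reducible R B0 u" if "Poly_Mapping.keys u \<subseteq> B" for u
  proof -
    have sA: "reducible R B0 (\<Sum>b\<in>A. Poly_Mapping.map ((*) (Poly_Mapping.lookup u b)) (Poly_Mapping.single b 1))"
      if "finite A" "A \<subseteq> B" for A
      using that
    proof (induction A rule: finite_induct)
      case (insert b A)
      then show ?case by (simp del: map_single add: reducible_add reducible_scale red)
    qed (simp add: reducible_keys)
    have "(\<Sum>b\<in>Poly_Mapping.keys u. Poly_Mapping.map ((*) (Poly_Mapping.lookup u b)) (Poly_Mapping.single b 1)) = u"
      by (subst (2) poly_mapping_eq_sum_single[of u]) simp
    then show ?thesis using sA[of "Poly_Mapping.keys u"] that by simp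
  qed
  have "?ker \<subseteq> pm.span R"
  proof safe
    fix u assume u: "Poly_Mapping.keys u \<subseteq> B" "lin_ext \<theta> u = 0"
    obtain u0 where u0: "Poly_Mapping.keys u0 \<subseteq> B0" "u - u0 \<in> pm.span R" using red'[OF u(1)] unfolding reducible_def by blast
    have "lin_ext \<theta> (u - u0) = 0" using u0(2) span_ker by auto
    then have "lin_ext \<theta> u0 = 0" using u(2) by (simp add: lin_ext_diff)
    then have "u0 = 0" using lin_ext_separated[of B0 \<theta> u0] sep u0(1) by blast
    then show "u \<in> pm.span R" using u0 by simp
  qed
  also have "pm.span R \<subseteq> ?K"
    unfolding generated_submodule_def
    by (intro Inter_greatest) (auto simp: submodule_free_gmodule_iff intro: subsetD[OF pm.span_minimal])
  finally show "?ker \<subseteq> ?K" .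
qed

text \<open>The first isomorphism theorem: the cosets of the kernel are the fibres
  \<open>F \<phi>\<close> of \<open>lin_ext \<theta>\<close>, and the set operations of the quotient
  become operations on \<open>\<phi>\<close>.\<close>

lemma quotient_fun_model:
  assumes G: "group G" and A: "A \<subseteq> carrier G"
    and \<sigma>: "\<And>g b. g \<in> A \<Longrightarrow> b \<in> B \<Longrightarrow> \<sigma> g b \<in> B \<and> \<theta> (\<sigma> g b) = ltrans G g (\<theta> b)"
    and K: "generated_submodule (free_gmodule B \<sigma>) R = {u. Poly_Mapping.keys u \<subseteq> B \<and> lin_ext \<theta> u = 0}"
  defines "Q \<equiv> quotient_gmodule (free_gmodule B \<sigma>) (generated_submodule (free_gmodule B \<sigma>) R)"
  obtains \<Psi> where "fun_model G A Q (fs.span (\<theta> ` B)) \<Psi>"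
proof -
  let ?X = "free_gmodule B \<sigma>"
  let ?K = "generated_submodule ?X R"
  define F where "F = (\<lambda>\<phi>. {u. Poly_Mapping.keys u \<subseteq> B \<and> lin_ext \<theta> u = \<phi>})"
  let ?Y = "fs.span (\<theta> ` B)"
  have Fne: "\<exists>u. Poly_Mapping.keys u \<subseteq> B \<and> lin_ext \<theta> u = \<phi>" if "\<phi> \<in> ?Y" for \<phi>
    using that lin_ext_image[of \<theta> B] by (force simp: F_def)
  \<comment> \<open>Only one summand has to be a full fibre. This matters for scaling and acting,
    where the image of a coset may be a proper part of a fibre (scaling by 0, say) until the kernel
    is added.\<close>
  have add: "C <+>\<^bsub>?X\<^esub> E = F (\<phi> + \<psi>)"
    if "C \<subseteq> F \<phi>" "C \<noteq> {}" "E = F \<psi>" for \<phi> \<psi> C E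
  proof -
    have "w \<in> C <+>\<^bsub>?X\<^esub> E" if w: "w \<in> F (\<phi> + \<psi>)" for w
    proof -
      obtain c where c: "c \<in> C" using \<open>C \<noteq> {}\<close> by blast
      then have "c \<in> F \<phi>" using \<open>C \<subseteq> F \<phi>\<close> by blast
      then have "w - c \<in> E" using \<open>E = F \<psi>\<close> w Poly_Mapping.keys_diff[of w c]
        by (auto simp: F_def lin_ext_diff)
      then show ?thesis using c unfolding set_add_def'
        by (intro UN_I[of c] UN_I[of "w - c"]) auto
    qed
    moreover have "w \<in> F (\<phi> + \<psi>)" if w: "w \<in> C <+>\<^bsub>?X\<^esub> E" for w
    proof -
      obtain c e where ce: "w = c + e" "c \<in> C" "e \<in> E" using w by (auto simp: set_add_def')
      have "c \<in> F \<phi>" "e \<in> F \<psi>" using ce \<open>C \<subseteq> F \<phi>\<close> \<open>E = F \<psi>\<close> by auto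
      then show ?thesis using Poly_Mapping.keys_add[of c e] by (auto simp: ce(1) F_def lin_ext_add)
    qed
    ultimately show ?thesis by blast
  qed
  have add': "?K <+>\<^bsub>?X\<^esub> C = F \<phi>" if "C \<subseteq> F \<phi>" "C \<noteq> {}" for C \<phi>
  proof -
    have "?K <+>\<^bsub>?X\<^esub> C = C <+>\<^bsub>?X\<^esub> ?K"
      unfolding set_add_def' by (auto simp: add.commute)
    also have "\<dots> = F (\<phi> + 0)" by (rule add) (use that K in \<open>auto simp: F_def\<close>)
    finally show ?thesis by simp
  qed
  have coset: "?K +>\<^bsub>?X\<^esub> u = F (lin_ext \<theta> u)" if "Poly_Mapping.keys u \<subseteq> B" for u
  proof -
    have "?K +>\<^bsub>?X\<^esub> u = ?K <+>\<^bsub>?X\<^esub> {u}" unfolding set_add_def' a_r_coset_def' by auto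
    then show ?thesis using that by (simp add: add' F_def)
  qed
  have car: "carrier Q = F ` ?Y"
    unfolding Q_def quotient_gmodule_def lin_ext_image[symmetric]
    by (auto simp: A_RCOSETS_def' coset intro!: image_eqI)
  \<comment> \<open>\<open>lin_ext \<theta>\<close> is constant on a fibre, so the image of a coset
    is a singleton.\<close>
  define \<Psi> where "\<Psi> = (\<lambda>C. the_elem (lin_ext \<theta> ` C))"
  have \<Psi>: "\<Psi> (F \<phi>) = \<phi>" if "\<phi> \<in> ?Y" for \<phi>
  proof -
    have "lin_ext \<theta> ` F \<phi> = {\<phi>}" using Fne[OF that] by (auto simp: F_def)
    then show ?thesis by (simp add: \<Psi>_def)
  qed
  have Fne': "F \<phi> \<noteq> {}" if "\<phi> \<in> ?Y" for \<phi> using Fne[OF that] by (auto simp: F_def)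
  have Qadd: "F \<phi> \<oplus>\<^bsub>Q\<^esub> F \<psi> = F (\<phi> + \<psi>)" if "\<phi> \<in> ?Y" for \<phi> \<psi>
    using that Fne' by (simp add: Q_def quotient_gmodule_def add)
  have Qsm: "c \<odot>\<^bsub>Q\<^esub> F \<phi> = F (\<lambda>y. c * \<phi> y)" if "\<phi> \<in> ?Y" for c \<phi>
  proof -
    have "?K <+>\<^bsub>?X\<^esub> ((\<lambda>v. c \<odot>\<^bsub>?X\<^esub> v) ` F \<phi>) = F (\<lambda>y. c * \<phi> y)"
    proof (rule add')
      show "(\<odot>\<^bsub>?X\<^esub>) c ` F \<phi> \<subseteq> F (\<lambda>y. c * \<phi> y)"
        using keys_scale by (force simp: F_def lin_ext_scale)
    qed (use Fne' that in auto)
    then show ?thesis by (simp add: Q_def quotient_gmodule_def)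
  qed
  have eq: "lin_ext \<theta> (push (\<sigma> g) u) = ltrans G g (lin_ext \<theta> u)" if "g \<in> A" "Poly_Mapping.keys u \<subseteq> B" for g u
    unfolding lin_ext_push ltrans_lin_ext by (rule lin_ext_cong) (use that \<sigma> in auto)
  have Qact: "act Q g (F \<phi>) = F (ltrans G g \<phi>)" if "g \<in> A" "\<phi> \<in> ?Y" for g \<phi>
  proof -
    have "?K <+>\<^bsub>?X\<^esub> ((act ?X g) ` F \<phi>) = F (ltrans G g \<phi>)"
    proof (rule add')
      show "act ?X g ` F \<phi> \<subseteq> F (ltrans G g \<phi>)"
        using keys_push[of "\<sigma> g"] \<sigma>[OF that(1)] that(1) by (fastforce simp: F_def eq)
    qed (use Fne' that in auto)
    then show ?thesis by (simp add: Q_def quotient_gmodule_def)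
  qed
  have lY: "ltrans G g \<phi> \<in> ?Y" if "g \<in> A" "\<phi> \<in> ?Y" for g \<phi>
  proof -
    note gA = that(1)
    obtain u where u: "Poly_Mapping.keys u \<subseteq> B" "lin_ext \<theta> u = \<phi>"
      using Fne[OF \<open>\<phi> \<in> ?Y\<close>] by blast
    have "Poly_Mapping.keys (push (\<sigma> g) u) \<subseteq> B" using keys_push[of "\<sigma> g" u] \<sigma>[OF gA] u by auto
    moreover have "ltrans G g \<phi> = lin_ext \<theta> (push (\<sigma> g) u)" using eq[OF gA u(1)] u(2) by simp
    ultimately show ?thesis unfolding lin_ext_image[symmetric] by blast
  qed
  have Q0: "\<zero>\<^bsub>Q\<^esub> = F 0"
    using K by (simp add: Q_def quotient_gmodule_def F_def)
  have FQ: "F \<phi> \<in> carrier Q" if "\<phi> \<in> ?Y" for \<phi> unfolding car using that by (rule imageI)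
  have "fun_model G A Q ?Y \<Psi>"
    unfolding fun_model_def
  proof (intro conjI ballI allI)
    show "bij_betw \<Psi> (carrier Q) ?Y"
      by (rule bij_betw_byWitness[where f' = F]) (auto simp: car \<Psi>)
    show "\<zero>\<^bsub>Q\<^esub> \<in> carrier Q" "\<Psi> \<zero>\<^bsub>Q\<^esub> = 0"
      by (simp_all only: Q0 FQ \<Psi> fs.span_zero)
    fix v assume "v \<in> carrier Q"
    then obtain \<phi> where \<phi>: "\<phi> \<in> ?Y" "v = F \<phi>" by (auto simp: car)
    show "c \<odot>\<^bsub>Q\<^esub> v \<in> carrier Q" "\<Psi> (c \<odot>\<^bsub>Q\<^esub> v) = (\<lambda>y. c * \<Psi> v y)" for c
      using fs.span_scale[OF \<phi>(1), of c] by (simp_all only: \<phi> Qsm FQ \<Psi>)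
    show "act Q g v \<in> carrier Q" "\<Psi> (act Q g v) = ltrans G g (\<Psi> v)" if "g \<in> A" for g
      using lY[OF that \<phi>(1)] by (simp_all only: that \<phi> Qact FQ \<Psi>)
    fix w assume "w \<in> carrier Q"
    then obtain \<psi> where \<psi>: "\<psi> \<in> ?Y" "w = F \<psi>" by (auto simp: car)
    show "v \<oplus>\<^bsub>Q\<^esub> w \<in> carrier Q" "\<Psi> (v \<oplus>\<^bsub>Q\<^esub> w) = \<Psi> v + \<Psi> w"
      using fs.span_add[OF \<phi>(1) \<psi>(1)] by (simp_all only: \<phi> \<psi> Qadd FQ \<Psi>)
  qed
  then show thesis by (rule that)
qed

section \<open>Induced modules as spaces of functions\<close>

text \<open>The function that represents \<open>g \<otimes> 1\<close>. It lives on the coset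
  \<open>g K\<close>, and replacing \<open>g\<close> by \<open>g k\<close> multiplies it by
  \<open>\<kappa> k\<close>, just as
  \<open>g k \<otimes> 1 = g \<otimes> \<kappa> k\<close>.\<close>

definition ebase :: "('g, 'm) monoid_scheme \<Rightarrow> 'g set \<Rightarrow> ('g \<Rightarrow> 'f::field) \<Rightarrow> 'g \<Rightarrow> 'g \<Rightarrow> 'f" where
  "ebase G K \<kappa> g = (\<lambda>y. if y \<in> carrier G \<and> inv\<^bsub>G\<^esub> y \<otimes>\<^bsub>G\<^esub> g \<in> K then \<kappa> (inv\<^bsub>G\<^esub> y \<otimes>\<^bsub>G\<^esub> g) else 0)"

definition indsp :: "('g, 'm) monoid_scheme \<Rightarrow> 'g set \<Rightarrow> ('g \<Rightarrow> 'f::field) \<Rightarrow> ('g \<Rightarrow> 'f) set" where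
  "indsp G K \<kappa> = {\<phi>. (\<forall>y. y \<notin> carrier G \<longrightarrow> \<phi> y = 0) \<and>
     (\<forall>y\<in>carrier G. \<forall>k\<in>K. \<phi> (y \<otimes>\<^bsub>G\<^esub> k) * \<kappa> k = \<phi> y) \<and>
     (\<exists>A. finite A \<and> A \<subseteq> carrier G \<and> (\<forall>y\<in>carrier G. \<phi> y \<noteq> 0 \<longrightarrow> (\<exists>a\<in>A. inv\<^bsub>G\<^esub> a \<otimes>\<^bsub>G\<^esub> y \<in> K)))}"

text \<open>In contrast to \<open>linear_character\<close>, nothing is asked of
  \<open>\<kappa>\<close> off \<open>K\<close>, so a formula that makes sense for all matrices can
  serve without being restricted.\<close>

locale subgroup_character = group G + K: subgroup K G
  for G :: "('g, 'm) monoid_scheme" (structure) and K :: "'g set" and \<kappa> :: "'g \<Rightarrow> 'f::field" +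
  assumes \<kappa>_nz: "k \<in> K \<Longrightarrow> \<kappa> k \<noteq> 0"
    and \<kappa>_mult: "k \<in> K \<Longrightarrow> l \<in> K \<Longrightarrow> \<kappa> (k \<otimes> l) = \<kappa> k * \<kappa> l"
begin

lemma \<kappa>_one [simp]: "\<kappa> \<one> = 1"
  using \<kappa>_mult[of \<one> \<one>] \<kappa>_nz[of \<one>] by simp

lemma \<kappa>_inv: "k \<in> K \<Longrightarrow> \<kappa> (inv k) * \<kappa> k = 1"
  using \<kappa>_mult[of "inv k" k] by simp

lemma ebase_mult:
  assumes "g \<in> carrier G" "k \<in> K"
  shows "ebase G K \<kappa> (g \<otimes> k) = (\<lambda>y. \<kappa> k * ebase G K \<kappa> g y)"
proof
  fix y
  have "inv y \<otimes> (g \<otimes> k) \<in> K \<longleftrightarrow> inv y \<otimes> g \<in> K" if "y \<in> carrier G"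
  proof -
    have "inv y \<otimes> (g \<otimes> k) = (inv y \<otimes> g) \<otimes> k" using that assms by (simp add: m_assoc)
    moreover have "inv y \<otimes> g = (inv y \<otimes> (g \<otimes> k)) \<otimes> inv k" using that assms by (simp add: m_assoc)
    ultimately show ?thesis using assms by (metis K.m_closed K.m_inv_closed)
  qed
  moreover have "inv y \<otimes> (g \<otimes> k) = (inv y \<otimes> g) \<otimes> k" if "y \<in> carrier G"
    using that assms by (simp add: m_assoc)
  ultimately show "ebase G K \<kappa> (g \<otimes> k) y = \<kappa> k * ebase G K \<kappa> g y"
    using assms by (cases "y \<in> carrier G") (simp_all add: ebase_def \<kappa>_mult)
qed

lemma ltrans_ebase:
  assumes "h \<in> carrier G" "g \<in> carrier G"
  shows "ltrans G h (ebase G K \<kappa> g) = ebase G K \<kappa> (h \<otimes> g)"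
  using assms by (auto simp: ltrans_def ebase_def inv_mult_group m_assoc fun_eq_iff)

lemma ebase_self: "g \<in> carrier G \<Longrightarrow> ebase G K \<kappa> g g = 1"
  by (simp add: ebase_def)

lemma ebase_nonzeroD: "ebase G K \<kappa> g y \<noteq> 0 \<Longrightarrow> y \<in> carrier G \<and> inv y \<otimes> g \<in> K"
  by (auto simp: ebase_def split: if_splits)

lemma coset_sym:
  assumes "y \<in> carrier G" "g \<in> carrier G" "inv y \<otimes> g \<in> K"
  shows "inv g \<otimes> y \<in> K"
proof -
  have "inv g \<otimes> y = inv (inv y \<otimes> g)" using assms(1,2) by (simp add: inv_mult_group)
  then show ?thesis using assms(3) by simp
qed

lemma coset_trans:
  assumes "x \<in> carrier G" "y \<in> carrier G" "g \<in> carrier G" "inv x \<otimes> y \<in> K" "inv y \<otimes> g \<in> K"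
  shows "inv x \<otimes> g \<in> K"
proof -
  have "inv x \<otimes> g = (inv x \<otimes> y) \<otimes> (inv y \<otimes> g)"
    using assms(1-3) by (simp add: m_assoc inv_solve_left flip: m_assoc[of y "inv y" g])
  then show ?thesis using assms(4,5) by simp
qed

text \<open>The predicate under \<open>SOME\<close> depends only on the coset of \<open>g\<close>,
  so congruent elements receive the same representative. The set \<open>L\<close> is there to keep
  representatives inside a smaller subgroup.\<close>

lemma transversal:
  assumes "L \<subseteq> carrier G"
  obtains rep where "\<And>g. g \<in> L \<Longrightarrow> rep g \<in> L \<and> inv (rep g) \<otimes> g \<in> K"
    and "\<And>g h. g \<in> L \<Longrightarrow> h \<in> L \<Longrightarrow> inv (rep g) \<otimes> rep h \<in> K \<Longrightarrow> rep g = rep h"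
proof -
  define rep where "rep = (\<lambda>g. SOME r. r \<in> L \<and> inv r \<otimes> g \<in> K)"
  have LG: "g \<in> carrier G" if "g \<in> L" for g using assms that by blast
  have rep: "rep g \<in> L \<and> inv (rep g) \<otimes> g \<in> K" if "g \<in> L" for g
    unfolding rep_def by (rule someI[of _ g]) (use that LG in auto)
  have "rep g = rep h" if g: "g \<in> L" and h: "h \<in> L" and gh: "inv (rep g) \<otimes> rep h \<in> K" for g h
  proof -
    have rg: "rep g \<in> carrier G" using rep[OF g] LG by blast
    have 1: "inv (rep g) \<otimes> h \<in> K"
      using gh rep[OF h] coset_trans[of "rep g" "rep h" h] LG rg h by blast
    have 2: "inv g \<otimes> h \<in> K"
      using 1 rep[OF g] coset_sym[of "rep g" g] coset_trans[of g "rep g" h] LG rg h g by blast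
    have "inv r \<otimes> g \<in> K \<longleftrightarrow> inv r \<otimes> h \<in> K" if "r \<in> L" for r
      using 2 coset_sym[of g h] coset_trans[of r g h] coset_trans[of r h g] LG that h g by blast
    then have "(\<lambda>r. r \<in> L \<and> inv r \<otimes> g \<in> K) = (\<lambda>r. r \<in> L \<and> inv r \<otimes> h \<in> K)" by blast
    then show ?thesis unfolding rep_def by simp
  qed
  with rep show thesis by (rule that)
qed

lemma indsp_subspace: "fs.subspace (indsp G K \<kappa>)"
proof (rule fs.subspaceI)
  show "0 \<in> indsp G K \<kappa>" by (auto simp: indsp_def)
next
  fix \<phi> \<psi> :: "'g \<Rightarrow> 'f" assume "\<phi> \<in> indsp G K \<kappa>" "\<psi> \<in> indsp G K \<kappa>"
  then obtain A B where
    *: "\<forall>y. y \<notin> carrier G \<longrightarrow> \<phi> y = 0" "\<forall>y\<in>carrier G. \<forall>k\<in>K. \<phi> (y \<otimes>\<^bsub>G\<^esub> k) * \<kappa> k = \<phi> y"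
      "finite A" "A \<subseteq> carrier G" "\<forall>y\<in>carrier G. \<phi> y \<noteq> 0 \<longrightarrow> (\<exists>a\<in>A. inv\<^bsub>G\<^esub> a \<otimes>\<^bsub>G\<^esub> y \<in> K)" and
    **: "\<forall>y. y \<notin> carrier G \<longrightarrow> \<psi> y = 0" "\<forall>y\<in>carrier G. \<forall>k\<in>K. \<psi> (y \<otimes>\<^bsub>G\<^esub> k) * \<kappa> k = \<psi> y"
      "finite B" "B \<subseteq> carrier G" "\<forall>y\<in>carrier G. \<psi> y \<noteq> 0 \<longrightarrow> (\<exists>a\<in>B. inv\<^bsub>G\<^esub> a \<otimes>\<^bsub>G\<^esub> y \<in> K)"
    unfolding indsp_def by auto
  show "\<phi> + \<psi> \<in> indsp G K \<kappa>"
    unfolding indsp_def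
  proof (intro CollectI conjI exI[of _ "A \<union> B"])
    show "\<forall>y\<in>carrier G. (\<phi> + \<psi>) y \<noteq> 0 \<longrightarrow> (\<exists>a\<in>A \<union> B. inv\<^bsub>G\<^esub> a \<otimes>\<^bsub>G\<^esub> y \<in> K)"
    proof (intro ballI impI)
      fix y assume y: "y \<in> carrier G" "(\<phi> + \<psi>) y \<noteq> 0"
      then have "\<phi> y \<noteq> 0 \<or> \<psi> y \<noteq> 0" by auto
      then show "\<exists>a\<in>A \<union> B. inv\<^bsub>G\<^esub> a \<otimes>\<^bsub>G\<^esub> y \<in> K" using y(1) *(5) **(5) by blast
    qed
  qed (use * ** in \<open>auto simp: distrib_right\<close>)
next
  fix c and \<phi> :: "'g \<Rightarrow> 'f" assume "\<phi> \<in> indsp G K \<kappa>"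
  then obtain A where
    *: "\<forall>y. y \<notin> carrier G \<longrightarrow> \<phi> y = 0" "\<forall>y\<in>carrier G. \<forall>k\<in>K. \<phi> (y \<otimes>\<^bsub>G\<^esub> k) * \<kappa> k = \<phi> y"
      "finite A" "A \<subseteq> carrier G" "\<forall>y\<in>carrier G. \<phi> y \<noteq> 0 \<longrightarrow> (\<exists>a\<in>A. inv\<^bsub>G\<^esub> a \<otimes>\<^bsub>G\<^esub> y \<in> K)"
    unfolding indsp_def by auto
  show "(\<lambda>y. c * \<phi> y) \<in> indsp G K \<kappa>"
    unfolding indsp_def
    by (intro CollectI conjI exI[of _ A]) (use * in \<open>auto simp: mult.assoc\<close>)
qed

lemma ebase_in_indsp:
  assumes g: "g \<in> carrier G"
  shows "ebase G K \<kappa> g \<in> indsp G K \<kappa>"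
  unfolding indsp_def
proof (intro CollectI conjI allI impI ballI exI[of _ "{g}"])
  fix y k assume y: "y \<in> carrier G" and k: "k \<in> K"
  have "inv k \<in> K" using k by simp
  have eq: "inv (y \<otimes> k) \<otimes> g = inv k \<otimes> (inv y \<otimes> g)" using y k g by (simp add: inv_mult_group m_assoc)
  have eq': "inv y \<otimes> g = k \<otimes> (inv (y \<otimes> k) \<otimes> g)"
    unfolding eq using y k g by (simp flip: m_assoc)
  show "ebase G K \<kappa> g (y \<otimes> k) * \<kappa> k = ebase G K \<kappa> g y"
  proof (cases "inv y \<otimes> g \<in> K")
    case True
    then have "\<kappa> (inv (y \<otimes> k) \<otimes> g) * \<kappa> k = \<kappa> (inv y \<otimes> g)"
      using \<kappa>_inv[OF k] \<open>inv k \<in> K\<close> by (simp add: eq \<kappa>_mult ac_simps)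
    then show ?thesis using True \<open>inv k \<in> K\<close> y k by (simp add: ebase_def eq)
  next
    case False
    then have "inv (y \<otimes> k) \<otimes> g \<notin> K" using eq' k by (metis K.m_closed)
    then show ?thesis using False by (simp add: ebase_def)
  qed
qed (use g coset_sym in \<open>auto simp: ebase_def split: if_splits\<close>)

text \<open>Induction on a finite set of cosets that covers the support: subtracting
  \<open>\<phi> a\<close> times the function of \<open>a\<close> makes \<open>\<phi>\<close> vanish
  on the whole coset of \<open>a\<close>, as both obey the same transformation law.\<close>

lemma indsp_eq_span: "indsp G K \<kappa> = fs.span (ebase G K \<kappa> ` carrier G)"
proof
  have "\<phi> \<in> fs.span (ebase G K \<kappa> ` carrier G)"
    if "finite A" "A \<subseteq> carrier G" "\<phi> \<in> indsp G K \<kappa>"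
      "\<forall>y\<in>carrier G. \<phi> y \<noteq> 0 \<longrightarrow> (\<exists>a\<in>A. inv a \<otimes> y \<in> K)" for A \<phi>
    using that
  proof (induction A arbitrary: \<phi> rule: finite_induct)
    case empty
    then have "\<phi> = 0" by (auto simp: indsp_def fun_eq_iff)
    then show ?case by (simp only: fs.span_zero)
  next
    case (insert a A)
    have a: "a \<in> carrier G" using insert by simp
    define \<psi> where "\<psi> = \<phi> - (\<lambda>y. \<phi> a * ebase G K \<kappa> a y)"
    have psi: "\<psi> \<in> indsp G K \<kappa>"
      unfolding \<psi>_def
      by (intro fs.subspace_diff[OF indsp_subspace] fs.subspace_scale[OF indsp_subspace] ebase_in_indsp a insert.prems)
    have van: "\<psi> y = 0" if y: "y \<in> carrier G" "inv a \<otimes> y \<in> K" for y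
    proof -
      have ya: "y \<otimes> (inv y \<otimes> a) = a" using y a by (simp flip: m_assoc)
      have K: "inv y \<otimes> a \<in> K" using coset_sym[OF a y(1,2)] .
      have "\<phi> (y \<otimes> (inv y \<otimes> a)) * \<kappa> (inv y \<otimes> a) = \<phi> y"
        using insert.prems(2) y K unfolding indsp_def by blast
      then have "\<phi> a * ebase G K \<kappa> a y = \<phi> y" using K y by (simp add: ya ebase_def)
      then show ?thesis by (simp add: \<psi>_def)
    qed
    have "\<psi> \<in> fs.span (ebase G K \<kappa> ` carrier G)"
    proof (rule insert.IH[OF _ psi])
      show "\<forall>y\<in>carrier G. \<psi> y \<noteq> 0 \<longrightarrow> (\<exists>a\<in>A. inv a \<otimes> y \<in> K)"
      proof (intro ballI impI)
        fix y assume y: "y \<in> carrier G" "\<psi> y \<noteq> 0"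
        then have na: "inv a \<otimes> y \<notin> K" using van by blast
        then have "ebase G K \<kappa> a y = 0" using coset_sym[OF y(1) a] by (auto simp: ebase_def)
        then have "\<phi> y \<noteq> 0" using y(2) by (simp add: \<psi>_def)
        then show "\<exists>a\<in>A. inv a \<otimes> y \<in> K" using insert.prems(3) y(1) na by blast
      qed
    qed (use insert.prems in auto)
    moreover have "(\<lambda>y. \<phi> a * ebase G K \<kappa> a y) \<in> fs.span (ebase G K \<kappa> ` carrier G)"
      using a by (intro fs.span_scale fs.span_base imageI)
    ultimately have "\<psi> + (\<lambda>y. \<phi> a * ebase G K \<kappa> a y) \<in> fs.span (ebase G K \<kappa> ` carrier G)"
      by (rule fs.span_add)
    then show ?case by (simp add: \<psi>_def)
  qed
  then show "indsp G K \<kappa> \<subseteq> fs.span (ebase G K \<kappa> ` carrier G)"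
    unfolding indsp_def by (smt (verit, best) CollectD CollectI subsetI)
  show "fs.span (ebase G K \<kappa> ` carrier G) \<subseteq> indsp G K \<kappa>"
    by (intro fs.span_minimal indsp_subspace) (auto intro: ebase_in_indsp)
qed

lemma indsp_supp: "\<phi> \<in> indsp G K \<kappa> \<Longrightarrow> y \<notin> carrier G \<Longrightarrow> \<phi> y = 0"
  by (simp add: indsp_def)

end

section \<open>Induction from a linear character\<close>

lemma char_module_simps [simp]:
  "carrier (char_module \<kappa>) = UNIV" "x \<oplus>\<^bsub>char_module \<kappa>\<^esub> y = x + y"
  "c \<odot>\<^bsub>char_module \<kappa>\<^esub> x = c * x" "act (char_module \<kappa>) g x = \<kappa> g * x" "\<zero>\<^bsub>char_module \<kappa>\<^esub> = 0"
  by (simp_all add: char_module_def)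

lemma finsum_char_module:
  fixes \<kappa> :: "'g \<Rightarrow> 'f::field"
  shows "finite A \<Longrightarrow> finsum (char_module \<kappa>) h A = sum h A"
proof (induction A rule: finite_induct)
  interpret abelian_monoid "char_module \<kappa>"
    by (rule abelian_monoidI) (auto simp: algebra_simps)
  {
    case empty
    show ?case using finsum_empty by simp
  next
    case (insert x F)
    then show ?case by (subst finsum_insert) auto
  }
qed

lemma algebra_act_char_module:
  "algebra_act (char_module \<kappa>) a w = (\<Sum>g\<in>Poly_Mapping.keys a. Poly_Mapping.lookup a g * \<kappa> g) * w"
  by (simp add: algebra_act_def finsum_char_module sum_distrib_right mult.assoc)

lemma algebra_act_single:
  "algebra_act (char_module \<kappa>) (Poly_Mapping.single k c) w = c * \<kappa> k * w"
  by (cases "c = 0") (simp_all add: algebra_act_char_module)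

lemma conv_single_single: "conv G (Poly_Mapping.single g c) (Poly_Mapping.single h d) = Poly_Mapping.single (g \<otimes>\<^bsub>G\<^esub> h) (c * d)"
  by (simp add: conv_def)

lemma lin_ext_conv:
  "lin_ext \<theta> (conv G x a) y =
    (\<Sum>g\<in>Poly_Mapping.keys x. \<Sum>h\<in>Poly_Mapping.keys a. Poly_Mapping.lookup x g * Poly_Mapping.lookup a h * \<theta> (g \<otimes>\<^bsub>G\<^esub> h) y)"
  unfolding conv_def lin_ext_sum lin_ext_single sum_apply ..

lemma keys_conv: "Poly_Mapping.keys (conv G x a) \<subseteq> {g \<otimes>\<^bsub>G\<^esub> h |g h. g \<in> Poly_Mapping.keys x \<and> h \<in> Poly_Mapping.keys a}"
proof -
  have "Poly_Mapping.keys (conv G x a) \<subseteq> (\<Union>g\<in>Poly_Mapping.keys x. \<Union>h\<in>Poly_Mapping.keys a.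
      Poly_Mapping.keys (Poly_Mapping.single (g \<otimes>\<^bsub>G\<^esub> h) (Poly_Mapping.lookup x g * Poly_Mapping.lookup a h)))"
    unfolding conv_def by (rule order_trans[OF Poly_Mapping.keys_sum UN_mono[OF order_refl Poly_Mapping.keys_sum]])
  then show ?thesis by (fastforce split: if_splits)
qed

text \<open>Inducing from \<open>K \<inter> L\<close> to \<open>L\<close> is modelled on functions
  on all of \<open>G\<close>, since \<open>L\<close> meets a coset of \<open>K\<close> in a coset of
  \<open>K \<inter> L\<close> or not at all. In this form a module induced inside the group
  \<open>L\<close> of an elementary module can be compared with one induced to
  \<open>M\<close>.\<close>

lemma (in subgroup_character) ind_fun_model:
  assumes L: "subgroup L G" and agree: "\<And>k. k \<in> K \<inter> L \<Longrightarrow> \<kappa>' k = \<kappa> k"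
  obtains \<Psi> where "fun_model G L (ind (G\<lparr>carrier := L\<rparr>) (K \<inter> L) (char_module \<kappa>')) (fs.span (ebase G K \<kappa> ` L)) \<Psi>"
proof -
  let ?GL = "G\<lparr>carrier := L\<rparr>"
  let ?FG = "group_algebra ?GL :: ('g \<Rightarrow>\<^sub>0 'f) set"
  let ?R = "induction_relations ?GL (K \<inter> L) (char_module \<kappa>')"
  let ?s = "\<lambda>b c. Poly_Mapping.single b (c::'f)"
  define B :: "(('g \<Rightarrow>\<^sub>0 'f) \<times> 'f) set" where "B = ?FG \<times> UNIV"
  define \<theta> where "\<theta> = (\<lambda>(x, w::'f) y. w * lin_ext (ebase G K \<kappa>) x y)"
  define \<sigma> where "\<sigma> = (\<lambda>g (x, w::'f). (conv ?GL (?s g 1) x, w))"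
  have LG: "g \<in> carrier G" if "g \<in> L" for g using subgroup.mem_carrier[OF L that] .
  obtain rep where rep: "\<And>g. g \<in> L \<Longrightarrow> rep g \<in> L \<and> inv (rep g) \<otimes> g \<in> K"
    and rep_eq: "\<And>g h. g \<in> L \<Longrightarrow> h \<in> L \<Longrightarrow> inv (rep g) \<otimes> rep h \<in> K \<Longrightarrow> rep g = rep h"
    by (rule transversal[OF subgroup.subset[OF L]]) blast
  define B0 where "B0 = (\<lambda>g. (?s (rep g) 1, 1::'f)) ` L"
  have Lm: "g \<otimes> h \<in> L" if "g \<in> L" "h \<in> L" for g h using subgroup.m_closed[OF L that] .
  have Li: "inv g \<in> L" if "g \<in> L" for g using subgroup.m_inv_closed[OF L that] .
  have L1: "\<one> \<in> L" using subgroup.one_closed[OF L] .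
  have FG: "x \<in> ?FG \<longleftrightarrow> Poly_Mapping.keys x \<subseteq> L" for x by (simp add: group_algebra_def)
  have convFG: "conv ?GL x a \<in> ?FG" if "x \<in> ?FG" "Poly_Mapping.keys a \<subseteq> L" for x a
    using that keys_conv[of ?GL x a] Lm unfolding FG by force
  have \<sigma>: "\<sigma> g b \<in> B \<and> \<theta> (\<sigma> g b) = ltrans G g (\<theta> b)" if g: "g \<in> L" and b: "b \<in> B" for g b
  proof -
    obtain x w where b': "b = (x, w)" "x \<in> ?FG" using b by (auto simp: B_def)
    have "lin_ext (ebase G K \<kappa>) (conv ?GL (?s g 1) x) y = ltrans G g (lin_ext (ebase G K \<kappa>) x) y" for y
      unfolding lin_ext_conv ltrans_lin_ext
      using b' g LG by (auto simp: FG lin_ext_def ltrans_ebase subset_iff intro!: sum.cong)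
    moreover have "conv ?GL (?s g 1) x \<in> ?FG" using g b' by (intro convFG) (auto simp: FG)
    ultimately show ?thesis by (simp add: b' \<sigma>_def B_def \<theta>_def ltrans_scale)
  qed
  have rel: "Poly_Mapping.keys r \<subseteq> B \<and> lin_ext \<theta> r = 0" if r: "r \<in> ?R" for r
  proof -
    \<comment> \<open>The balance relation: right multiplication by \<open>a\<close> multiplies
      every coset function by the scalar through which \<open>a\<close> acts on the one-dimensional
      module.\<close>
    have ck: "lin_ext (ebase G K \<kappa>) (conv ?GL x a) y
        = (\<Sum>g\<in>Poly_Mapping.keys a. Poly_Mapping.lookup a g * \<kappa>' g) * lin_ext (ebase G K \<kappa>) x y"
      if "x \<in> ?FG" "a \<in> group_algebra (?GL\<lparr>carrier := K \<inter> L\<rparr>)" for x a y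
    proof -
      have "lin_ext (ebase G K \<kappa>) (conv ?GL x a) y = (\<Sum>g\<in>Poly_Mapping.keys x. \<Sum>h\<in>Poly_Mapping.keys a.
          (Poly_Mapping.lookup x g * ebase G K \<kappa> g y) * (Poly_Mapping.lookup a h * \<kappa>' h))"
        unfolding lin_ext_conv
      proof (intro sum.cong refl)
        fix g h assume "g \<in> Poly_Mapping.keys x" "h \<in> Poly_Mapping.keys a"
        then have "g \<in> carrier G" "h \<in> K \<inter> L" using that LG by (auto simp: FG group_algebra_def)
        then show "Poly_Mapping.lookup x g * Poly_Mapping.lookup a h * ebase G K \<kappa> (g \<otimes>\<^bsub>?GL\<^esub> h) y
          = (Poly_Mapping.lookup x g * ebase G K \<kappa> g y) * (Poly_Mapping.lookup a h * \<kappa>' h)"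
          by (simp add: ebase_mult agree)
      qed
      then show ?thesis unfolding sum.swap[of _ "Poly_Mapping.keys a"] by (simp add: lin_ext_def sum_product mult.commute)
    qed
    have car: "(x, w) \<in> B \<longleftrightarrow> x \<in> ?FG" for x w by (simp add: B_def)
    have keys3: "Poly_Mapping.keys (?s p a - ?s q b - ?s r c) \<subseteq> B" if "p \<in> B" "q \<in> B" "r \<in> B" for p q r a b c
      by (rule order_trans[OF keys_diff]) (use that keys_diff[of "?s p a" "?s q b"] in \<open>auto split: if_splits\<close>)
    have keys2: "Poly_Mapping.keys (?s p a - ?s q b) \<subseteq> B" if "p \<in> B" "q \<in> B" for p q a b
      by (rule order_trans[OF keys_diff]) (use that in \<open>auto split: if_splits\<close>)
    have FGadd: "x + y \<in> ?FG" if "x \<in> ?FG" "y \<in> ?FG" for x y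
      using that Poly_Mapping.keys_add[of x y] by (auto simp: FG)
    have FGsm: "Poly_Mapping.map ((*) c) x \<in> ?FG" if "x \<in> ?FG" for x c
      using that keys_scale[of c x] by (auto simp: FG)
    consider
      (a) x y w where "r = ?s (x + y, w) 1 - ?s (x, w) 1 - ?s (y, w) 1" "x \<in> ?FG" "y \<in> ?FG"
    | (b) x v w where "r = ?s (x, v + w) 1 - ?s (x, v) 1 - ?s (x, w) 1" "x \<in> ?FG"
    | (c) x a w where "r = ?s (conv ?GL x a, w) 1 - ?s (x, algebra_act (char_module \<kappa>') a w) 1"
        "x \<in> ?FG" "a \<in> group_algebra (?GL\<lparr>carrier := K \<inter> L\<rparr>)"
    | (d) c x w where "r = ?s (Poly_Mapping.map ((*) c) x, w) 1 - ?s (x, w) c" "x \<in> ?FG"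
      using r unfolding induction_relations_def Un_iff mem_Collect_eq char_module_simps by blast
    then show ?thesis
    proof cases
      case a
      have "lin_ext \<theta> r = 0" unfolding a(1) by (auto simp: lin_ext_diff fun_eq_iff \<theta>_def lin_ext_add algebra_simps)
      moreover have "Poly_Mapping.keys r \<subseteq> B" unfolding a(1) by (rule keys3) (simp_all add: car FGadd a)
      ultimately show ?thesis by blast
    next
      case b
      have "lin_ext \<theta> r = 0" unfolding b(1) by (auto simp: lin_ext_diff lin_ext_add fun_eq_iff \<theta>_def algebra_simps)
      moreover have "Poly_Mapping.keys r \<subseteq> B" unfolding b(1) by (rule keys3) (simp_all add: car b)
      ultimately show ?thesis by blast
    next
      case c
      have "conv ?GL x a \<in> ?FG" using c by (intro convFG) (auto simp: group_algebra_def)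
      then have "Poly_Mapping.keys r \<subseteq> B" unfolding c(1) by (intro keys2) (simp_all add: car c)
      moreover have "lin_ext \<theta> r = 0"
      proof
        fix y
        show "lin_ext \<theta> r y = 0 y"
          unfolding c(1) lin_ext_diff lin_ext_single \<theta>_def prod.case algebra_act_char_module fun_diff_def ck[OF c(2,3)]
          by simp
      qed
      ultimately show ?thesis by blast
    next
      case d
      have "lin_ext \<theta> r = 0" unfolding d(1) by (simp add: lin_ext_diff fun_eq_iff \<theta>_def lin_ext_scale mult.left_commute)
      moreover have "Poly_Mapping.keys r \<subseteq> B" unfolding d(1) by (rule keys2) (simp_all add: car FGsm d)
      ultimately show ?thesis by blast
    qed
  qed
  have sep: "\<exists>y. \<theta> b y \<noteq> 0 \<and> (\<forall>b'\<in>B0. b' \<noteq> b \<longrightarrow> \<theta> b' y = 0)" if "b \<in> B0" for b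
  proof -
    obtain g where g: "g \<in> L" "b = (?s (rep g) 1, 1)" using \<open>b \<in> B0\<close> by (auto simp: B0_def)
    have rg: "rep g \<in> carrier G" using rep[OF g(1)] LG by blast
    have "\<theta> b' (rep g) = 0" if b': "b' \<in> B0" "b' \<noteq> b" for b'
    proof (rule ccontr)
      assume nz: "\<theta> b' (rep g) \<noteq> 0"
      obtain h where h: "h \<in> L" "b' = (?s (rep h) 1, 1)" using b' by (auto simp: B0_def)
      have "inv (rep g) \<otimes> rep h \<in> K" using nz ebase_nonzeroD[of "rep h" "rep g"] by (auto simp: h \<theta>_def)
      then have "rep g = rep h" by (rule rep_eq[OF g(1) h(1)])
      then show False using b'(2) h g by simp
    qed
    moreover have "\<theta> b (rep g) \<noteq> 0" using rg by (simp add: g \<theta>_def ebase_self)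
    ultimately show ?thesis by blast
  qed
  have Rsp: "r \<in> ?R \<Longrightarrow> r \<in> pm.span ?R" for r by (rule pm.span_base)
  have rel_a: "?s (x + y, w) 1 - ?s (x, w) 1 - ?s (y, w) 1 \<in> pm.span ?R" if "x \<in> ?FG" "y \<in> ?FG" for x y w
    by (rule Rsp) (use that in \<open>unfold induction_relations_def char_module_simps, blast\<close>)
  have rel_c: "?s (conv ?GL x a, w) 1 - ?s (x, algebra_act (char_module \<kappa>') a w) 1 \<in> pm.span ?R"
    if "x \<in> ?FG" "a \<in> group_algebra (?GL\<lparr>carrier := K \<inter> L\<rparr>)" for x a w
    by (rule Rsp) (use that in \<open>unfold induction_relations_def char_module_simps, blast\<close>)
  have rel_d: "?s (Poly_Mapping.map ((*) c) x, w) 1 - ?s (x, w) c \<in> pm.span ?R" if "x \<in> ?FG" for c x w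
    by (rule Rsp) (use that in \<open>unfold induction_relations_def char_module_simps, blast\<close>)
  have mv: "?s (?s (r \<otimes> k) c, w) 1 - ?s (?s r 1, c * \<kappa>' k * w) 1 \<in> pm.span ?R"
    if "r \<in> L" "k \<in> K \<inter> L" for r k c w
    using rel_c[of "?s r 1" "?s k c" w] that
    by (simp add: conv_single_single algebra_act_single FG group_algebra_def)
  have red1: "reducible ?R B0 (?s (?s g c, w) 1)" if g: "g \<in> L" for g c w
  proof -
    define r where "r = rep g"
    define k where "k = inv r \<otimes> g"
    have rk: "r \<in> L" "k \<in> K \<inter> L" "r \<otimes> k = g" using rep[OF g] g LG Lm Li
      by (auto simp: r_def k_def simp flip: m_assoc)
    \<comment> \<open>All scalars are gathered in \<open>e\<close>, giving
      \<open>g c \<otimes> w = r \<otimes> e\<close>. Only a scalar in the group algebra slot can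
      become a coefficient, so \<open>e\<close> is carried back there by the balance relation with
      \<open>k = \<one>\<close>.\<close>
    define e where "e = c * \<kappa>' k * w"
    have "Poly_Mapping.map ((*) e) (?s r 1) = ?s r e"
      by (rule poly_mapping_eqI) (simp only: lookup_scale lookup_single when_def, simp)
    then have 1: "?s (?s r e, 1) 1 - ?s (?s r 1, 1) e \<in> pm.span ?R"
      using rel_d[of "?s r 1" e 1] rk by (simp add: FG)
    have "\<kappa>' \<one> = 1" using agree[of \<one>] L1 by simp
    then have 2: "?s (?s r e, 1) 1 - ?s (?s r 1, e) 1 \<in> pm.span ?R"
      using mv[of r \<one> e 1] rk L1 LG by simp
    have 3: "?s (?s g c, w) 1 - ?s (?s r 1, e) 1 \<in> pm.span ?R"
      using mv[of r k c w] rk by (simp add: e_def)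
    have "?s (?s g c, w) 1 - ?s (?s r 1, 1) e =
      (?s (?s g c, w) 1 - ?s (?s r 1, e) 1) - (?s (?s r e, 1) 1 - ?s (?s r 1, e) 1) + (?s (?s r e, 1) 1 - ?s (?s r 1, 1) e)"
      by simp
    also have "\<dots> \<in> pm.span ?R" by (rule pm.span_add[OF pm.span_diff[OF 3 2] 1])
    finally show ?thesis unfolding reducible_def using g by (intro exI[of _ "?s (?s r 1, 1) e"]) (auto simp: B0_def r_def)
  qed
  have redA: "reducible ?R B0 (?s (\<Sum>g\<in>A. ?s g (c g), w) 1)" if "finite A" "A \<subseteq> L" for A c w
    using that
  proof (induction A rule: finite_induct)
    case empty
    \<comment> \<open>The zero of the group algebra is read as the unit with coefficient 0.\<close>
    show ?case using red1[OF L1, of 0 w] by simp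
  next
    case (insert g A)
    have "Poly_Mapping.keys (\<Sum>g\<in>A. ?s g (c g)) \<subseteq> L"
      by (rule order_trans[OF Poly_Mapping.keys_sum]) (use insert in \<open>auto split: if_splits\<close>)
    then have "?s (?s g (c g) + (\<Sum>g\<in>A. ?s g (c g)), w) 1 - ?s (?s g (c g), w) 1 - ?s (\<Sum>g\<in>A. ?s g (c g), w) 1 \<in> pm.span ?R"
      using insert.prems by (intro rel_a) (auto simp: FG split: if_splits)
    moreover have "reducible ?R B0 (?s (?s g (c g), w) 1 + ?s (\<Sum>g\<in>A. ?s g (c g), w) 1)"
      using insert by (intro reducible_add red1) auto
    ultimately show ?case using insert.hyps by (simp add: reducible_cong diff_diff_eq)
  qed
  have red: "reducible ?R B0 (?s b 1)" if b: "b \<in> B" for b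
  proof -
    obtain x w where b': "b = (x, w)" "x \<in> ?FG" using b by (auto simp: B_def)
    have "reducible ?R B0 (?s (\<Sum>g\<in>Poly_Mapping.keys x. ?s g (Poly_Mapping.lookup x g), w) 1)"
      using b' by (intro redA) (auto simp: FG)
    then show ?thesis using poly_mapping_eq_sum_single[of x] by (simp add: b')
  qed
  have K: "generated_submodule (free_gmodule B \<sigma>) ?R = {u. Poly_Mapping.keys u \<subseteq> B \<and> lin_ext \<theta> u = 0}"
    by (rule generated_submodule_eq_kernel[OF rel sep red])
  have sp: "fs.span (\<theta> ` B) = fs.span (ebase G K \<kappa> ` L)"
  proof (intro equalityI fs.span_minimal fs.subspace_span image_subsetI)
    fix b assume "b \<in> B"
    then obtain x w where b: "b = (x, w)" "Poly_Mapping.keys x \<subseteq> L" by (auto simp: B_def FG)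
    have "lin_ext (ebase G K \<kappa>) x \<in> fs.span (ebase G K \<kappa> ` L)"
      unfolding lin_ext_image[symmetric] using b(2) by (intro imageI CollectI)
    then show "\<theta> b \<in> fs.span (ebase G K \<kappa> ` L)" unfolding b(1) \<theta>_def prod.case by (rule fs.span_scale)
  next
    fix g assume g: "g \<in> L"
    have eq: "ebase G K \<kappa> g = \<theta> (?s g 1, 1)" by (simp add: \<theta>_def)
    show "ebase G K \<kappa> g \<in> fs.span (\<theta> ` B)" unfolding eq
      by (intro fs.span_base imageI) (use g in \<open>simp add: B_def FG\<close>)
  qed
  have LG': "L \<subseteq> carrier G" using LG by blast
  obtain \<Psi> where
    "fun_model G L (quotient_gmodule (free_gmodule B \<sigma>) (generated_submodule (free_gmodule B \<sigma>) ?R)) (fs.span (\<theta> ` B)) \<Psi>"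
    by (rule quotient_fun_model[OF group_axioms LG' \<sigma> K])
  moreover have "ind ?GL (K \<inter> L) (char_module \<kappa>') =
      quotient_gmodule (free_gmodule B \<sigma>) (generated_submodule (free_gmodule B \<sigma>) ?R)"
    unfolding ind_def Let_def B_def \<sigma>_def char_module_simps ..
  ultimately show thesis unfolding sp by (intro that) simp
qed

lemma (in subgroup_character) ind_fun_model_full:
  obtains \<Psi> where "fun_model G (carrier G) (ind G K (char_module \<kappa>)) (indsp G K \<kappa>) \<Psi>"
proof -
  have K: "K \<inter> carrier G = K" using K.subset by blast
  have G: "G\<lparr>carrier := carrier G\<rparr> = G" by simp
  obtain \<Psi> where "fun_model G (carrier G) (ind (G\<lparr>carrier := carrier G\<rparr>) (K \<inter> carrier G) (char_module \<kappa>))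
      (fs.span (ebase G K \<kappa> ` carrier G)) \<Psi>"
    by (rule ind_fun_model[OF subgroup_self, of \<kappa>, OF refl])
  then show thesis unfolding K G indsp_eq_span[symmetric] by (rule that)
qed

section \<open>Tensor products of induced modules\<close>

text \<open>A pure tensor goes to the pointwise product of its factors. \<open>H\<close> being the
  intersection of the \<open>K d\<close> makes \<open>G/H\<close> embed in the product of the
  \<open>G/K d\<close>; \<open>indep\<close> says that the embedding is onto, so every tensor
  product of coset functions is a multiple of a coset function for \<open>H\<close>.\<close>

lemma tensor_fun_model:
  fixes G :: "('g, 'm) monoid_scheme" (structure)
    and V :: "'i \<Rightarrow> ('f::field, 'v, 'g) gmodule"
  assumes G: "group G" and D: "finite D"
    and K: "\<And>d. d \<in> D \<Longrightarrow> subgroup_character G (K d) (\<kappa> d)"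
    and m: "\<And>d. d \<in> D \<Longrightarrow> fun_model G (carrier G) (V d) (indsp G (K d) (\<kappa> d)) (\<Psi> d)"
    and H: "subgroup_character G H \<nu>" "\<And>g. g \<in> carrier G \<Longrightarrow> g \<in> H \<longleftrightarrow> (\<forall>d\<in>D. g \<in> K d)"
      "\<And>h. h \<in> H \<Longrightarrow> \<nu> h = (\<Prod>d\<in>D. \<kappa> d h)"
    and indep: "\<And>t. t \<in> D \<rightarrow> carrier G \<Longrightarrow> \<exists>x\<in>carrier G. \<forall>d\<in>D. inv x \<otimes> t d \<in> K d"
  obtains \<Psi>' where "fun_model G (carrier G) (tensor_product D V) (indsp G H \<nu>) \<Psi>'"
proof -
  interpret H: subgroup_character G H \<nu> by fact
  let ?s = "\<lambda>b c. Poly_Mapping.single b (c::'f)"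
  let ?R = "tensor_relations D V"
  define B where "B = (\<Pi>\<^sub>E d\<in>D. carrier (V d))"
  define \<sigma> where "\<sigma> = (\<lambda>g v. \<lambda>d\<in>D. act (V d) g (v d))"
  define \<theta> where "\<theta> = (\<lambda>v y. if y \<in> carrier G then \<Prod>d\<in>D. \<Psi> d (v d) y else 0)"
  define \<iota> where "\<iota> = (\<lambda>d. inv_into (carrier (V d)) (\<Psi> d))"
  define e where "e = (\<lambda>d g. \<iota> d (ebase G (K d) (\<kappa> d) g))"
  define b where "b = (\<lambda>g. \<lambda>d\<in>D. e d g)"
  note md = fun_modelD[OF m]
  have \<iota>: "\<iota> d \<phi> \<in> carrier (V d)" "\<Psi> d (\<iota> d \<phi>) = \<phi>" if "d \<in> D" "\<phi> \<in> indsp G (K d) (\<kappa> d)" for d \<phi>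
    using that md(1)[OF that(1)] unfolding \<iota>_def bij_betw_def by (auto intro: inv_into_into f_inv_into_f)
  have \<iota>_inv: "\<iota> d (\<Psi> d x) = x" if "d \<in> D" "x \<in> carrier (V d)" for d x
    using that md(1)[OF that(1)] unfolding \<iota>_def bij_betw_def by (auto intro: inv_into_f_f)
  have eb: "ebase G (K d) (\<kappa> d) g \<in> indsp G (K d) (\<kappa> d)" if "d \<in> D" "g \<in> carrier G" for d g
    by (rule subgroup_character.ebase_in_indsp[OF K]) (use that in auto)
  have e: "e d g \<in> carrier (V d)" "\<Psi> d (e d g) = ebase G (K d) (\<kappa> d) g" if "d \<in> D" "g \<in> carrier G" for d g
    using \<iota>[OF that(1) eb[OF that]] by (auto simp: e_def)
  have bB: "b g \<in> B" if "g \<in> carrier G" for g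
    using that e by (auto simp: b_def B_def)
  obtain rep where rep: "\<And>g. g \<in> carrier G \<Longrightarrow> rep g \<in> carrier G \<and> inv (rep g) \<otimes> g \<in> H"
    and rep_eq: "\<And>g h. g \<in> carrier G \<Longrightarrow> h \<in> carrier G \<Longrightarrow> inv (rep g) \<otimes> rep h \<in> H \<Longrightarrow> rep g = rep h"
    by (rule H.transversal[OF subset_refl]) blast
  define B0 where "B0 = (\<lambda>g. b (rep g)) ` carrier G"
  \<comment> \<open>For a common \<open>g\<close> the product vanishes as soon as one factor does,
    that is, off the coset of the intersection.\<close>
  have \<theta>b: "\<theta> (b g) = ebase G H \<nu> g" if g: "g \<in> carrier G" for g
  proof
    fix y
    show "\<theta> (b g) y = ebase G H \<nu> g y"
    proof (cases "y \<in> carrier G")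
      case y: True
      have "\<theta> (b g) y = (\<Prod>d\<in>D. ebase G (K d) (\<kappa> d) g y)"
        using y g e by (simp add: \<theta>_def b_def)
      also have "\<dots> = ebase G H \<nu> g y"
      proof (cases "inv y \<otimes> g \<in> H")
        case True
        then show ?thesis using y g H(2)[of "inv y \<otimes> g"] H(3) by (simp add: ebase_def)
      next
        case False
        then obtain d where d: "d \<in> D" "inv y \<otimes> g \<notin> K d" using y g H(2)[of "inv y \<otimes> g"] by auto
        then have "ebase G (K d) (\<kappa> d) g y = 0" by (simp add: ebase_def)
        then show ?thesis using False D d(1) by (auto simp: ebase_def prod_zero_iff)
      qed
      finally show ?thesis .
    qed (simp add: \<theta>_def ebase_def)
  qed
  have \<sigma>: "\<sigma> g v \<in> B \<and> \<theta> (\<sigma> g v) = ltrans G g (\<theta> v)" if g: "g \<in> carrier G" and v: "v \<in> B" for g v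
  proof
    have vd: "v d \<in> carrier (V d)" if "d \<in> D" for d using v that by (auto simp: B_def)
    show "\<sigma> g v \<in> B" using vd md(8) g by (auto simp: \<sigma>_def B_def)
    show "\<theta> (\<sigma> g v) = ltrans G g (\<theta> v)"
    proof
      fix y
      show "\<theta> (\<sigma> g v) y = ltrans G g (\<theta> v) y"
        using g vd md(9) by (simp add: \<theta>_def \<sigma>_def ltrans_def)
    qed
  qed
  have upd: "\<theta> (v(i := x)) y = (if y \<in> carrier G then \<Psi> i x y * (\<Prod>d\<in>D - {i}. \<Psi> d (v d) y) else 0)"
    if "i \<in> D" for v i x y
    using D that by (simp add: \<theta>_def prod.remove[of D i])
  have updB: "v(i := x) \<in> B" if "v \<in> B" "i \<in> D" "x \<in> carrier (V i)" for v i x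
    using that by (auto simp: B_def PiE_iff extensional_def)
  have rel: "Poly_Mapping.keys r \<subseteq> B \<and> lin_ext \<theta> r = 0" if r: "r \<in> ?R" for r
  proof -
    have keys3: "Poly_Mapping.keys (?s p a - ?s q b - ?s r c) \<subseteq> B" if "p \<in> B" "q \<in> B" "r \<in> B" for p q r a b c
      by (rule order_trans[OF keys_diff]) (use that keys_diff[of "?s p a" "?s q b"] in \<open>auto split: if_splits\<close>)
    have keys2: "Poly_Mapping.keys (?s p a - ?s q b) \<subseteq> B" if "p \<in> B" "q \<in> B" for p q a b
      by (rule order_trans[OF keys_diff]) (use that in \<open>auto split: if_splits\<close>)
    consider
      (a) v i x y where "r = ?s (v(i := x \<oplus>\<^bsub>V i\<^esub> y)) 1 - ?s (v(i := x)) 1 - ?s (v(i := y)) 1"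
        "v \<in> B" "i \<in> D" "x \<in> carrier (V i)" "y \<in> carrier (V i)"
    | (c) v i c x where "r = ?s (v(i := c \<odot>\<^bsub>V i\<^esub> x)) 1 - ?s (v(i := x)) c"
        "v \<in> B" "i \<in> D" "x \<in> carrier (V i)"
      using r unfolding tensor_relations_def B_def Un_iff mem_Collect_eq by blast
    then show ?thesis
    proof cases
      case a
      have "Poly_Mapping.keys r \<subseteq> B" unfolding a(1)
        by (intro keys3 updB md(4) a)
      moreover have "lin_ext \<theta> r = 0"
        using a(2-) by (auto simp: a(1) lin_ext_diff lin_ext_add fun_eq_iff upd md(5) algebra_simps)
      ultimately show ?thesis by blast
    next
      case c
      have "Poly_Mapping.keys r \<subseteq> B" unfolding c(1)
        by (intro keys2 updB md(6) c)
      moreover have "lin_ext \<theta> r = 0"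
        using c(2-) by (auto simp: c(1) lin_ext_diff fun_eq_iff upd md(7) algebra_simps)
      ultimately show ?thesis by blast
    qed
  qed
  have sep: "\<exists>y. \<theta> v y \<noteq> 0 \<and> (\<forall>v'\<in>B0. v' \<noteq> v \<longrightarrow> \<theta> v' y = 0)" if v: "v \<in> B0" for v
  proof -
    obtain g where g: "g \<in> carrier G" "v = b (rep g)" using v by (auto simp: B0_def)
    have rg: "rep g \<in> carrier G" using rep[OF g(1)] by blast
    have "\<theta> v' (rep g) = 0" if v': "v' \<in> B0" "v' \<noteq> v" for v'
    proof (rule ccontr)
      assume nz: "\<theta> v' (rep g) \<noteq> 0"
      obtain h where h: "h \<in> carrier G" "v' = b (rep h)" using v' by (auto simp: B0_def)
      have "inv (rep g) \<otimes> rep h \<in> H"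
        using nz H.ebase_nonzeroD[of "rep h" "rep g"] rep[OF h(1)] by (simp add: h \<theta>b)
      then show False using rep_eq[OF g(1) h(1)] v'(2) g h by simp
    qed
    moreover have "\<theta> v (rep g) \<noteq> 0" using rg by (simp add: g \<theta>b H.ebase_self)
    ultimately show ?thesis by blast
  qed
  have rel_a: "?s (v(i := x \<oplus>\<^bsub>V i\<^esub> y)) 1 - ?s (v(i := x)) 1 - ?s (v(i := y)) 1 \<in> pm.span ?R"
    if "v \<in> B" "i \<in> D" "x \<in> carrier (V i)" "y \<in> carrier (V i)" for v i x y
    by (rule pm.span_base) (use that in \<open>unfold tensor_relations_def B_def, blast\<close>)
  have rel_c: "?s (v(i := c \<odot>\<^bsub>V i\<^esub> x)) 1 - ?s (v(i := x)) c \<in> pm.span ?R"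
    if "v \<in> B" "i \<in> D" "x \<in> carrier (V i)" for v i c x
    by (rule pm.span_base) (use that in \<open>unfold tensor_relations_def B_def, blast\<close>)
  \<comment> \<open>Multilinearity pulls the scalars out one component at a time.\<close>
  have scal: "?s (\<lambda>d. if d \<in> J then c d \<odot>\<^bsub>V d\<^esub> u d else u d) 1 - ?s u (\<Prod>d\<in>J. c d) \<in> pm.span ?R"
    if J: "finite J" "J \<subseteq> D" and u: "u \<in> B" for J c u
    using J
  proof (induction J rule: finite_induct)
    case empty
    then show ?case by (simp add: pm.span_zero)
  next
    case (insert j J)
    define v where "v = (\<lambda>d. if d \<in> J then c d \<odot>\<^bsub>V d\<^esub> u d else u d)"
    have j: "j \<in> D" "J \<subseteq> D" using insert.prems by auto
    have ud: "u d \<in> carrier (V d)" if "d \<in> D" for d using u that by (auto simp: B_def)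
    have vB: "v \<in> B" using u j(2) md(6) by (auto simp: v_def B_def PiE_iff extensional_def)
    have vj: "v j = u j" using insert.hyps by (simp add: v_def)
    have 1: "(\<lambda>d. if d \<in> insert j J then c d \<odot>\<^bsub>V d\<^esub> u d else u d) = v(j := c j \<odot>\<^bsub>V j\<^esub> u j)"
      by (auto simp: v_def)
    have vjj: "v(j := u j) = v" using vj by auto
    have 2: "?s (v(j := c j \<odot>\<^bsub>V j\<^esub> u j)) 1 - ?s v (c j) \<in> pm.span ?R"
      using rel_c[OF vB j(1) ud[OF j(1)], of "c j"] unfolding vjj .
    have 3: "Poly_Mapping.map ((*) (c j)) (?s v 1 - ?s u (\<Prod>d\<in>J. c d)) \<in> pm.span ?R"
      using insert.IH[OF j(2)] unfolding v_def by (rule pm.span_scale)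
    have 4: "Poly_Mapping.map ((*) (c j)) (?s v 1 - ?s u (\<Prod>d\<in>J. c d)) = ?s v (c j) - ?s u (\<Prod>d\<in>insert j J. c d)"
      unfolding pm.scale_right_diff_distrib using insert.hyps by simp
    have 5: "?s (v(j := c j \<odot>\<^bsub>V j\<^esub> u j)) 1 - ?s u (\<Prod>d\<in>insert j J. c d)
      = (?s (v(j := c j \<odot>\<^bsub>V j\<^esub> u j)) 1 - ?s v (c j)) + (?s v (c j) - ?s u (\<Prod>d\<in>insert j J. c d))"
      by simp
    show ?case unfolding 1 5 by (rule pm.span_add[OF 2 3[unfolded 4]])
  qed
  have red0: "reducible ?R B0 (?s v 1)"
    if v: "v \<in> B" and t: "t \<in> D \<rightarrow> carrier G" "\<And>d. d \<in> D \<Longrightarrow> v d = e d (t d)" for v t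
  proof -
    \<comment> \<open>The cosets of the \<open>t d\<close> have a common point, so each factor is a
      scalar multiple of the coset function at that one point.\<close>
    obtain x where x: "x \<in> carrier G" "\<forall>d\<in>D. inv x \<otimes> t d \<in> K d" using indep[OF t(1)] by blast
    define g where "g = rep x"
    have g: "g \<in> carrier G" "inv g \<otimes> x \<in> H" using rep[OF x(1)] by (auto simp: g_def)
    have gt: "inv g \<otimes> t d \<in> K d" if "d \<in> D" for d
    proof -
      interpret Kd: subgroup_character G "K d" "\<kappa> d" using K[OF that] .
      show ?thesis using Kd.coset_trans[of g x "t d"] x g that t(1) H(2)[of "inv g \<otimes> x"] by auto
    qed
    have vd: "v d = \<kappa> d (inv g \<otimes> t d) \<odot>\<^bsub>V d\<^esub> b g d" if d: "d \<in> D" for d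
    proof (rule md(11)[OF d])
      interpret Kd: subgroup_character G "K d" "\<kappa> d" using K[OF d] .
      have td: "t d \<in> carrier G" using t(1) d by auto
      show "v d \<in> carrier (V d)" using v d by (auto simp: B_def)
      show "\<kappa> d (inv g \<otimes> t d) \<odot>\<^bsub>V d\<^esub> b g d \<in> carrier (V d)" using e[OF d g(1)] d by (auto simp: b_def md(6))
      have "g \<otimes> (inv g \<otimes> t d) = t d" using g td by (simp flip: H.m_assoc)
      then have "ebase G (K d) (\<kappa> d) (t d) = (\<lambda>y. \<kappa> d (inv g \<otimes> t d) * ebase G (K d) (\<kappa> d) g y)"
        using Kd.ebase_mult[OF g(1) gt[OF d]] by simp
      then show "\<Psi> d (v d) = \<Psi> d (\<kappa> d (inv g \<otimes> t d) \<odot>\<^bsub>V d\<^esub> b g d)"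
        using e[OF d g(1)] e[OF d td] t(2)[OF d] d by (simp add: md(7) b_def)
    qed
    have "v = (\<lambda>d. if d \<in> D then \<kappa> d (inv g \<otimes> t d) \<odot>\<^bsub>V d\<^esub> b g d else b g d)"
    proof
      fix d show "v d = (if d \<in> D then \<kappa> d (inv g \<otimes> t d) \<odot>\<^bsub>V d\<^esub> b g d else b g d)"
        using vd[of d] v by (auto simp: B_def b_def PiE_iff extensional_def)
    qed
    then have "?s v 1 - ?s (b g) (\<Prod>d\<in>D. \<kappa> d (inv g \<otimes> t d)) \<in> pm.span ?R"
      using scal[OF D order_refl bB[OF g(1)], of "\<lambda>d. \<kappa> d (inv g \<otimes> t d)"] by simp
    moreover have "reducible ?R B0 (?s (b g) (\<Prod>d\<in>D. \<kappa> d (inv g \<otimes> t d)))"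
      by (rule reducible_keys) (use x(1) in \<open>auto simp: B0_def g_def\<close>)
    ultimately show ?thesis by (rule reducible_cong[rotated])
  qed
  \<comment> \<open>\<open>J\<close> holds the components that are still arbitrary. In each of them
    the vector is a combination of coset functions, and reducibility is preserved under linear
    combinations in one component.\<close>
  have redJ: "reducible ?R B0 (?s v 1)"
    if "finite J" "J \<subseteq> D" "v \<in> B" "t \<in> D \<rightarrow> carrier G" "\<And>d. d \<in> D - J \<Longrightarrow> v d = e d (t d)" for J v t
    using that
  proof (induction J arbitrary: v t rule: finite_induct)
    case empty
    then show ?case using red0[of v t] by simp
  next
    case (insert j J)
    have j: "j \<in> D" using insert.prems by simp
    let ?Y = "indsp G (K j) (\<kappa> j)"
    interpret Kj: subgroup_character G "K j" "\<kappa> j" using K[OF j] .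
    have vj: "v j \<in> carrier (V j)" using insert.prems(2) j by (auto simp: B_def)
    have "\<Psi> j (v j) \<in> fs.span (ebase G (K j) (\<kappa> j) ` carrier G)"
      using md(10)[OF j vj] by (simp add: Kj.indsp_eq_span)
    then have "\<Psi> j (v j) \<in> ?Y \<and> reducible ?R B0 (?s (v(j := \<iota> j (\<Psi> j (v j)))) 1)"
    proof (rule fs.span_induct)
      fix \<phi> assume "\<phi> \<in> ebase G (K j) (\<kappa> j) ` carrier G"
      then obtain g where g: "g \<in> carrier G" "\<phi> = ebase G (K j) (\<kappa> j) g" by blast
      have "reducible ?R B0 (?s (v(j := e j g)) 1)"
      proof (rule insert.IH[of _ "t(j := g)"])
        show "v(j := e j g) \<in> B" using insert.prems(2) j e[OF j g(1)] by (intro updB)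
      qed (use insert.prems g in auto)
      then show "\<phi> \<in> ?Y \<and> reducible ?R B0 (?s (v(j := \<iota> j \<phi>)) 1)"
        using g by (simp add: e_def Kj.ebase_in_indsp)
    next
      show "fs.subspace {\<phi>. \<phi> \<in> ?Y \<and> reducible ?R B0 (?s (v(j := \<iota> j \<phi>)) 1)}"
      proof (rule fs.subspaceI; clarify)
        have z: "0 \<in> ?Y" by (rule fs.subspace_0[OF Kj.indsp_subspace])
        \<comment> \<open>The zero vector is 0 times itself, so the scaling relation with
          \<open>c = 0\<close> makes the pure tensor congruent to zero.\<close>
        have i0: "\<iota> j 0 = 0 \<odot>\<^bsub>V j\<^esub> \<iota> j 0"
          by (rule md(11)[OF j]) (use \<iota>[OF j z] md(6,7)[OF j] in \<open>auto simp: fun_eq_iff\<close>)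
        have "?s (v(j := \<iota> j 0)) 1 - ?s (v(j := \<iota> j 0)) 0 \<in> pm.span ?R"
          using rel_c[OF insert.prems(2) j \<iota>(1)[OF j z], of 0] i0 by simp
        then have "reducible ?R B0 (?s (v(j := \<iota> j 0)) 1)"
          by (rule reducible_cong[rotated]) (rule reducible_keys, simp)
        with z show "0 \<in> ?Y \<and> reducible ?R B0 (?s (v(j := \<iota> j 0)) 1)" by blast
      next
        fix \<phi> \<psi> assume \<phi>: "\<phi> \<in> ?Y" "reducible ?R B0 (?s (v(j := \<iota> j \<phi>)) 1)"
          and \<psi>: "\<psi> \<in> ?Y" "reducible ?R B0 (?s (v(j := \<iota> j \<psi>)) 1)"
        have s: "\<phi> + \<psi> \<in> ?Y" by (rule fs.subspace_add[OF Kj.indsp_subspace \<phi>(1) \<psi>(1)])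
        have i: "\<iota> j (\<phi> + \<psi>) = \<iota> j \<phi> \<oplus>\<^bsub>V j\<^esub> \<iota> j \<psi>"
          by (rule md(11)[OF j]) (use \<iota>[OF j s] \<iota>[OF j \<phi>(1)] \<iota>[OF j \<psi>(1)] md(4,5)[OF j] in auto)
        have "?s (v(j := \<iota> j (\<phi> + \<psi>))) 1 - (?s (v(j := \<iota> j \<phi>)) 1 + ?s (v(j := \<iota> j \<psi>)) 1) \<in> pm.span ?R"
          using rel_a[OF insert.prems(2) j \<iota>(1)[OF j \<phi>(1)] \<iota>(1)[OF j \<psi>(1)]] by (simp add: i diff_diff_eq)
        then have "reducible ?R B0 (?s (v(j := \<iota> j (\<phi> + \<psi>))) 1)"
          by (rule reducible_cong[rotated]) (rule reducible_add[OF \<phi>(2) \<psi>(2)])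
        with s show "\<phi> + \<psi> \<in> ?Y \<and> reducible ?R B0 (?s (v(j := \<iota> j (\<phi> + \<psi>))) 1)" by blast
      next
        fix c \<phi> assume \<phi>: "\<phi> \<in> ?Y" "reducible ?R B0 (?s (v(j := \<iota> j \<phi>)) 1)"
        have s: "(\<lambda>y. c * \<phi> y) \<in> ?Y" by (rule fs.subspace_scale[OF Kj.indsp_subspace \<phi>(1)])
        have i: "\<iota> j (\<lambda>y. c * \<phi> y) = c \<odot>\<^bsub>V j\<^esub> \<iota> j \<phi>"
          by (rule md(11)[OF j]) (use \<iota>[OF j s] \<iota>[OF j \<phi>(1)] md(6,7)[OF j] in auto)
        have "?s (v(j := \<iota> j (\<lambda>y. c * \<phi> y))) 1 - Poly_Mapping.map ((*) c) (?s (v(j := \<iota> j \<phi>)) 1) \<in> pm.span ?R"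
          using rel_c[OF insert.prems(2) j \<iota>(1)[OF j \<phi>(1)], of c] by (simp add: i)
        then have "reducible ?R B0 (?s (v(j := \<iota> j (\<lambda>y. c * \<phi> y))) 1)"
          by (rule reducible_cong[rotated]) (rule reducible_scale[OF \<phi>(2)])
        with s show "(\<lambda>y. c * \<phi> y) \<in> ?Y \<and> reducible ?R B0 (?s (v(j := \<iota> j (\<lambda>y. c * \<phi> y))) 1)" by blast
      qed
    qed
    then show ?case using \<iota>_inv[OF j vj] by simp
  qed
  have red: "reducible ?R B0 (?s v 1)" if "v \<in> B" for v
    by (rule redJ[OF D order_refl that, of "\<lambda>_. \<one>"]) auto
  have ker: "generated_submodule (free_gmodule B \<sigma>) ?R = {u. Poly_Mapping.keys u \<subseteq> B \<and> lin_ext \<theta> u = 0}"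
    by (rule generated_submodule_eq_kernel[OF rel sep red])
  have sp: "fs.span (\<theta> ` B) = indsp G H \<nu>"
  proof (rule antisym)
    \<comment> \<open>Instead of a direct check of transformation law and support for a product of
      arbitrary functions, \<open>v\<close> is replaced by its reduced form, which has the same
      image.\<close>
    have "\<theta> v \<in> indsp G H \<nu>" if v: "v \<in> B" for v
    proof -
      obtain u0 where u0: "Poly_Mapping.keys u0 \<subseteq> B0" "?s v 1 - u0 \<in> pm.span ?R"
        using red[OF v] unfolding reducible_def by blast
      have "pm.span ?R \<subseteq> {u. lin_ext \<theta> u = 0}"
        by (rule pm.span_minimal) (use rel in \<open>auto intro!: pm.subspaceI simp: lin_ext_add lin_ext_scale fun_eq_iff\<close>)
      then have "lin_ext \<theta> (?s v 1) = lin_ext \<theta> u0" using u0(2) by (auto simp: lin_ext_diff)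
      moreover have "lin_ext \<theta> (?s v 1) = \<theta> v" by (simp add: fun_eq_iff)
      ultimately have "\<theta> v = lin_ext \<theta> u0" by metis
      also have "\<dots> \<in> fs.span (\<theta> ` B0)" using lin_ext_in_span[of \<theta> u0] fs.span_mono[OF image_mono[OF u0(1)]] by blast
      also have "fs.span (\<theta> ` B0) \<subseteq> indsp G H \<nu>"
      proof (intro fs.span_minimal H.indsp_subspace image_subsetI)
        fix w assume "w \<in> B0"
        then obtain g where "g \<in> carrier G" "w = b (rep g)" by (auto simp: B0_def)
        then show "\<theta> w \<in> indsp G H \<nu>" using \<theta>b[of "rep g"] rep[of g] H.ebase_in_indsp[of "rep g"] by simp
      qed
      finally show ?thesis .
    qed
    then show "fs.span (\<theta> ` B) \<subseteq> indsp G H \<nu>"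
      by (intro fs.span_minimal H.indsp_subspace image_subsetI)
    have "ebase G H \<nu> g \<in> \<theta> ` B" if "g \<in> carrier G" for g
      using \<theta>b[OF that] bB[OF that] by (metis image_eqI)
    then show "indsp G H \<nu> \<subseteq> fs.span (\<theta> ` B)"
      unfolding H.indsp_eq_span by (intro fs.span_mono image_subsetI)
  qed
  obtain \<Psi>' where "fun_model G (carrier G)
      (quotient_gmodule (free_gmodule B \<sigma>) (generated_submodule (free_gmodule B \<sigma>) ?R)) (fs.span (\<theta> ` B)) \<Psi>'"
    by (rule quotient_fun_model[OF G order_refl \<sigma> ker])
  moreover have "tensor_product D V =
      quotient_gmodule (free_gmodule B \<sigma>) (generated_submodule (free_gmodule B \<sigma>) ?R)"
    unfolding tensor_product_def Let_def B_def \<sigma>_def ..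
  ultimately show thesis unfolding sp by (intro that) simp
qed

section \<open>The McLain group\<close>

abbreviation mclain_times ::
  "('l::linorder \<Rightarrow> 'l \<Rightarrow> 'r::ring_1) \<Rightarrow> ('l \<Rightarrow> 'l \<Rightarrow> 'r) \<Rightarrow> 'l \<Rightarrow> 'l \<Rightarrow> 'r" (infixl \<open>\<star>\<close> 70) where
  "X \<star> Y \<equiv> X \<otimes>\<^bsub>mclain\<^esub> Y"

definition msupp :: "('l::linorder \<Rightarrow> 'l \<Rightarrow> 'r::ring_1) \<Rightarrow> ('l \<times> 'l) set" where
  "msupp X = {(\<alpha>, \<beta>). \<alpha> < \<beta> \<and> X \<alpha> \<beta> \<noteq> 0}"

lemma mclain_carrier_iff:
  "X \<in> carrier mclain \<longleftrightarrow> (\<forall>\<alpha>. X \<alpha> \<alpha> = 1) \<and> (\<forall>\<alpha> \<beta>. \<beta> < \<alpha> \<longrightarrow> X \<alpha> \<beta> = 0) \<and> finite (msupp X)"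
proof -
  have "{(\<alpha>, \<beta>) \<in> Phi. X \<alpha> \<beta> \<noteq> 0} = msupp X" by (auto simp: msupp_def Phi_def)
  then show ?thesis by (simp add: mclain_def)
qed

lemma mclainD:
  assumes "X \<in> carrier mclain"
  shows "X \<alpha> \<alpha> = 1" "\<beta> < \<alpha> \<Longrightarrow> X \<alpha> \<beta> = 0" "finite (msupp X)" "X \<alpha> \<beta> \<noteq> 0 \<Longrightarrow> \<alpha> \<le> \<beta>"
  using assms by (auto simp: mclain_carrier_iff) (meson linorder_not_le)

lemma mclain_one: "\<one>\<^bsub>mclain\<^esub> = (\<lambda>\<alpha> \<beta>. if \<alpha> = \<beta> then 1 else 0)"
  by (simp add: mclain_def)

lemma mclain_one_closed: "\<one>\<^bsub>mclain\<^esub> \<in> carrier mclain"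
  by (auto simp: mclain_carrier_iff mclain_one msupp_def)

lemma mclain_mult:
  assumes "finite A" "\<And>\<beta>. X \<alpha> \<beta> \<noteq> 0 \<Longrightarrow> Y \<beta> \<gamma> \<noteq> 0 \<Longrightarrow> \<beta> \<in> A"
  shows "(X \<star> Y) \<alpha> \<gamma> = (\<Sum>\<beta>\<in>A. X \<alpha> \<beta> * Y \<beta> \<gamma>)"
  unfolding mclain_def monoid.simps
  by (rule sum.mono_neutral_left) (use assms in auto)

text \<open>Adding the row or column index in question gives a finite set over which any product can
  be summed. Several products can then share one range, as associativity requires.\<close>

definition mindex :: "('l::linorder \<Rightarrow> 'l \<Rightarrow> 'r::ring_1) \<Rightarrow> 'l set" where
  "mindex X = fst ` msupp X \<union> snd ` msupp X"

lemma finite_mindex: "X \<in> carrier mclain \<Longrightarrow> finite (mindex X)"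
  by (simp add: mindex_def mclainD)

lemma mindex_left:
  assumes "X \<in> carrier mclain" "X \<alpha> \<beta> \<noteq> 0"
  shows "\<beta> \<in> insert \<alpha> (mindex X)" "\<alpha> \<in> insert \<beta> (mindex X)"
proof -
  have "\<alpha> = \<beta> \<or> (\<alpha>, \<beta>) \<in> msupp X" using mclainD(4)[OF assms] assms(2) by (auto simp: msupp_def)
  then show "\<beta> \<in> insert \<alpha> (mindex X)" "\<alpha> \<in> insert \<beta> (mindex X)" by (force simp: mindex_def)+
qed

lemma mclain_mult_left:
  assumes "X \<in> carrier mclain" "finite A" "\<alpha> \<in> A" "mindex X \<subseteq> A"
  shows "(X \<star> Y) \<alpha> \<gamma> = (\<Sum>\<beta>\<in>A. X \<alpha> \<beta> * Y \<beta> \<gamma>)"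
  by (rule mclain_mult) (use assms mindex_left(1)[OF assms(1)] in auto)

lemma mclain_mult_right:
  assumes "Y \<in> carrier mclain" "finite A" "\<gamma> \<in> A" "mindex Y \<subseteq> A"
  shows "(X \<star> Y) \<alpha> \<gamma> = (\<Sum>\<beta>\<in>A. X \<alpha> \<beta> * Y \<beta> \<gamma>)"
  by (rule mclain_mult) (use assms mindex_left(2)[OF assms(1)] in auto)

lemma mclain_mult_nonzeroD:
  assumes "(X \<star> Y) \<alpha> \<gamma> \<noteq> 0"
  obtains \<beta> where "X \<alpha> \<beta> \<noteq> 0" "Y \<beta> \<gamma> \<noteq> 0"
proof -
  have "\<exists>\<beta>. X \<alpha> \<beta> \<noteq> 0 \<and> Y \<beta> \<gamma> \<noteq> 0"
  proof (rule ccontr)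
    assume "\<not> ?thesis"
    then have "(X \<star> Y) \<alpha> \<gamma> = (\<Sum>\<beta>\<in>{}. X \<alpha> \<beta> * Y \<beta> \<gamma>)" by (intro mclain_mult) auto
    then show False using assms by simp
  qed
  then show thesis using that by blast
qed

lemma msupp_mult:
  assumes "X \<in> carrier mclain" "Y \<in> carrier mclain"
  shows "msupp (X \<star> Y) \<subseteq> msupp X \<union> msupp Y \<union> (msupp X O msupp Y)"
proof
  fix p assume "p \<in> msupp (X \<star> Y)"
  then obtain \<alpha> \<gamma> where p: "p = (\<alpha>, \<gamma>)" "\<alpha> < \<gamma>" "(X \<star> Y) \<alpha> \<gamma> \<noteq> 0" by (auto simp: msupp_def)
  obtain \<beta> where \<beta>: "X \<alpha> \<beta> \<noteq> 0" "Y \<beta> \<gamma> \<noteq> 0" by (rule mclain_mult_nonzeroD[OF p(3)])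
  have "\<alpha> \<le> \<beta>" "\<beta> \<le> \<gamma>" using \<beta> mclainD(4) assms by blast+
  then show "p \<in> msupp X \<union> msupp Y \<union> (msupp X O msupp Y)"
    using \<beta> p by (cases "\<alpha> = \<beta>"; cases "\<beta> = \<gamma>") (auto simp: msupp_def less_le)
qed

lemma mclain_mult_closed:
  assumes X: "X \<in> carrier mclain" and Y: "Y \<in> carrier mclain"
  shows "X \<star> Y \<in> carrier mclain"
  unfolding mclain_carrier_iff
proof (intro conjI allI impI)
  fix \<alpha>
  have "(X \<star> Y) \<alpha> \<alpha> = (\<Sum>\<beta>\<in>{\<alpha>}. X \<alpha> \<beta> * Y \<beta> \<alpha>)"
  proof (rule mclain_mult)
    fix \<beta> assume "X \<alpha> \<beta> \<noteq> 0" "Y \<beta> \<alpha> \<noteq> 0"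
    then have "\<alpha> \<le> \<beta>" "\<beta> \<le> \<alpha>" using mclainD(4) X Y by blast+
    then show "\<beta> \<in> {\<alpha>}" by simp
  qed simp
  then show "(X \<star> Y) \<alpha> \<alpha> = 1" using X Y by (simp add: mclainD)
next
  fix \<alpha> \<beta> :: 'a assume "\<beta> < \<alpha>"
  show "(X \<star> Y) \<alpha> \<beta> = 0"
  proof (rule ccontr)
    assume "(X \<star> Y) \<alpha> \<beta> \<noteq> 0"
    then obtain \<gamma> where "X \<alpha> \<gamma> \<noteq> 0" "Y \<gamma> \<beta> \<noteq> 0" by (rule mclain_mult_nonzeroD)
    then have "\<alpha> \<le> \<gamma>" "\<gamma> \<le> \<beta>" using mclainD(4) X Y by blast+
    then show False using \<open>\<beta> < \<alpha>\<close> by simp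
  qed
next
  have "finite (msupp X \<union> msupp Y \<union> (msupp X O msupp Y))" using X Y by (simp add: mclainD finite_relcomp)
  then show "finite (msupp (X \<star> Y))" by (rule rev_finite_subset) (rule msupp_mult[OF X Y])
qed

lemma mclain_assoc:
  assumes X: "X \<in> carrier mclain" and Y: "Y \<in> carrier mclain" and Z: "Z \<in> carrier mclain"
  shows "(X \<star> Y) \<star> Z = X \<star> (Y \<star> Z)"
proof (intro ext)
  fix \<alpha> \<delta>
  let ?A = "insert \<alpha> (insert \<delta> (mindex X \<union> mindex Y \<union> mindex Z))"
  have fin: "finite ?A" using X Y Z by (simp add: finite_mindex)
  have "((X \<star> Y) \<star> Z) \<alpha> \<delta> = (\<Sum>\<gamma>\<in>?A. (X \<star> Y) \<alpha> \<gamma> * Z \<gamma> \<delta>)"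
    using fin by (intro mclain_mult_right Z) auto
  also have "\<dots> = (\<Sum>\<gamma>\<in>?A. (\<Sum>\<beta>\<in>?A. X \<alpha> \<beta> * Y \<beta> \<gamma>) * Z \<gamma> \<delta>)"
    by (intro sum.cong refl arg_cong2[of _ _ _ _ "(*)"] mclain_mult_left X fin) auto
  also have "\<dots> = (\<Sum>\<beta>\<in>?A. X \<alpha> \<beta> * (\<Sum>\<gamma>\<in>?A. Y \<beta> \<gamma> * Z \<gamma> \<delta>))"
    unfolding sum_distrib_left sum_distrib_right mult.assoc by (rule sum.swap)
  also have "\<dots> = (\<Sum>\<beta>\<in>?A. X \<alpha> \<beta> * (Y \<star> Z) \<beta> \<delta>)"
    by (intro sum.cong refl arg_cong2[of _ _ _ _ "(*)"] mclain_mult_right[symmetric] Z fin) auto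
  also have "\<dots> = (X \<star> (Y \<star> Z)) \<alpha> \<delta>"
    using fin by (intro mclain_mult_left[symmetric] X) auto
  finally show "((X \<star> Y) \<star> Z) \<alpha> \<delta> = (X \<star> (Y \<star> Z)) \<alpha> \<delta>" .
qed

lemma mclain_l_one: "X \<in> carrier mclain \<Longrightarrow> \<one>\<^bsub>mclain\<^esub> \<star> X = X"
proof (intro ext)
  fix \<alpha> \<gamma>
  have "(\<one>\<^bsub>mclain\<^esub> \<star> X) \<alpha> \<gamma> = (\<Sum>\<beta>\<in>{\<alpha>}. \<one>\<^bsub>mclain\<^esub> \<alpha> \<beta> * X \<beta> \<gamma>)"
    by (rule mclain_mult) (auto simp: mclain_one split: if_splits)
  then show "(\<one>\<^bsub>mclain\<^esub> \<star> X) \<alpha> \<gamma> = X \<alpha> \<gamma>" by (simp add: mclain_one)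
qed

lemma msupp_root_elem: "msupp (root_elem (\<alpha>, \<beta>) r) \<subseteq> {(\<alpha>, \<beta>)}"
  by (auto simp: msupp_def root_elem_def split: if_splits)

lemma root_elem_closed: "\<alpha> < \<beta> \<Longrightarrow> root_elem (\<alpha>, \<beta>) r \<in> carrier mclain"
proof -
  assume ab: "\<alpha> < \<beta>"
  have "finite (msupp (root_elem (\<alpha>, \<beta>) r))" by (rule finite_subset[OF msupp_root_elem]) simp
  then show ?thesis using ab by (auto simp: mclain_carrier_iff root_elem_def)
qed

lemma mult_root_elem:
  assumes "X \<in> carrier mclain" "\<alpha> < \<beta>"
  shows "(X \<star> root_elem (\<alpha>, \<beta>) r) \<gamma> \<delta> = X \<gamma> \<delta> + (if \<delta> = \<beta> then X \<gamma> \<alpha> * r else 0)"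
proof -
  have "(X \<star> root_elem (\<alpha>, \<beta>) r) \<gamma> \<delta> = (\<Sum>\<epsilon>\<in>{\<alpha>, \<delta>}. X \<gamma> \<epsilon> * root_elem (\<alpha>, \<beta>) r \<epsilon> \<delta>)"
    by (rule mclain_mult) (auto simp: root_elem_def split: if_splits)
  then show ?thesis using assms(2) by (cases "\<alpha> = \<delta>") (auto simp: root_elem_def)
qed

lemma root_elem_add:
  assumes "\<alpha> < \<beta>"
  shows "root_elem (\<alpha>, \<beta>) r \<star> root_elem (\<alpha>, \<beta>) s = root_elem (\<alpha>, \<beta>) (r + s)"
proof (intro ext)
  fix \<gamma> \<delta>
  show "(root_elem (\<alpha>, \<beta>) r \<star> root_elem (\<alpha>, \<beta>) s) \<gamma> \<delta> = root_elem (\<alpha>, \<beta>) (r + s) \<gamma> \<delta>"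
    using assms unfolding mult_root_elem[OF root_elem_closed[OF assms] assms] by (auto simp: root_elem_def)
qed

lemma root_elem_zero: "root_elem d 0 = \<one>\<^bsub>mclain\<^esub>"
  by (auto simp: root_elem_def mclain_one fun_eq_iff)

text \<open>Peeling off an entry of the first non-trivial row writes a matrix as a product of root elements.\<close>

lemma mclain_induct [consumes 1, case_names one mult]:
  assumes X: "X \<in> carrier mclain"
    and one: "P \<one>\<^bsub>mclain\<^esub>"
    and mult: "\<And>Y \<alpha> \<beta> r. Y \<in> carrier mclain \<Longrightarrow> P Y \<Longrightarrow> (\<alpha>, \<beta>) \<in> msupp X \<Longrightarrow>
      P (Y \<star> root_elem (\<alpha>, \<beta>) r)"
  shows "P X"
proof -
  have "P Z" if "Z \<in> carrier mclain" "msupp Z \<subseteq> msupp X" for Z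
    using that
  proof (induction "card (msupp Z)" arbitrary: Z)
    case 0
    then have "msupp Z = {}" by (simp add: mclainD)
    then have "Z \<alpha> \<beta> = 0" if "\<alpha> < \<beta>" for \<alpha> \<beta> using that by (auto simp: msupp_def)
    then have "Z \<alpha> \<beta> = \<one>\<^bsub>mclain\<^esub> \<alpha> \<beta>" for \<alpha> \<beta>
      using mclainD(1,2)[OF 0(2)] by (cases \<alpha> \<beta> rule: linorder_cases) (auto simp: mclain_one)
    then have "Z = \<one>\<^bsub>mclain\<^esub>" by blast
    then show ?case using one by simp
  next
    case (Suc n)
    have fin: "finite (msupp Z)" using Suc.prems(1) by (simp add: mclainD)
    have ne: "msupp Z \<noteq> {}" using Suc.hyps(2) by auto
    define \<alpha> where "\<alpha> = Min (fst ` msupp Z)"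
    have "\<alpha> \<in> fst ` msupp Z" unfolding \<alpha>_def using fin ne by (intro Min_in) auto
    then obtain \<gamma> where \<gamma>: "(\<alpha>, \<gamma>) \<in> msupp Z" by auto
    have min: "\<alpha> \<le> \<beta>" if "(\<beta>, \<delta>) \<in> msupp Z" for \<beta> \<delta>
      unfolding \<alpha>_def using fin that by (intro Min_le) force+
    define Y where "Y = (\<lambda>\<beta> \<delta>. if \<beta> = \<alpha> \<and> \<delta> = \<gamma> then 0 else Z \<beta> \<delta>)"
    have lt: "\<alpha> < \<gamma>" using \<gamma> by (simp add: msupp_def)
    have sY: "msupp Y = msupp Z - {(\<alpha>, \<gamma>)}" by (auto simp: msupp_def Y_def)
    have Y: "Y \<in> carrier mclain"
      using Suc.prems(1) lt fin sY by (auto simp: mclain_carrier_iff Y_def)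
    have "n = card (msupp Y)" using sY \<gamma> fin Suc.hyps(2) by simp
    then have PY: "P Y" using Suc.hyps(1) Y sY Suc.prems(2) by blast
    have "Z = Y \<star> root_elem (\<alpha>, \<gamma>) (Z \<alpha> \<gamma>)"
    proof (intro ext)
      fix \<beta> \<delta>
      \<comment> \<open>Right multiplication by the root element adds a multiple of column
        \<open>\<alpha>\<close> to column \<open>\<gamma>\<close>. As \<open>\<alpha>\<close> is the
        first non-trivial row, column \<open>\<alpha>\<close> is zero off the diagonal, and exactly
        one entry changes.\<close>
      have "Z \<beta> \<alpha> = 0" if "\<beta> \<noteq> \<alpha>"
      proof (cases "\<beta> < \<alpha>")
        case True
        then have "(\<beta>, \<alpha>) \<notin> msupp Z" using min by fastforce
        then show ?thesis using True by (simp add: msupp_def)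
      next
        case False
        then show ?thesis using that mclainD(2)[OF Suc.prems(1)] by simp
      qed
      moreover have "Z \<alpha> \<alpha> = 1" using mclainD(1)[OF Suc.prems(1)] .
      ultimately show "Z \<beta> \<delta> = (Y \<star> root_elem (\<alpha>, \<gamma>) (Z \<alpha> \<gamma>)) \<beta> \<delta>"
        using lt by (subst mult_root_elem[OF Y lt]) (auto simp: Y_def)
    qed
    moreover have "(\<alpha>, \<gamma>) \<in> msupp X" using \<gamma> Suc.prems(2) by blast
    ultimately show ?case using mult[OF Y PY] by metis
  qed
  then show ?thesis using X by blast
qed

text \<open>Left inverses are assembled along the factorisation into root elements, for which
  negating the entry inverts.\<close>

lemma mclain_group: "group (mclain :: ('l::linorder \<Rightarrow> 'l \<Rightarrow> 'r::ring_1) monoid)"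
proof (rule groupI)
  fix X :: "'l \<Rightarrow> 'l \<Rightarrow> 'r" assume "X \<in> carrier mclain"
  then show "\<exists>Y\<in>carrier mclain. Y \<star> X = \<one>\<^bsub>mclain\<^esub>"
  proof (induction rule: mclain_induct)
    case one
    show ?case using mclain_one_closed mclain_l_one by blast
  next
    case (mult Y \<alpha> \<beta> r)
    then obtain Z where Z: "Z \<in> carrier mclain" "Z \<star> Y = \<one>\<^bsub>mclain\<^esub>" by blast
    have lt: "\<alpha> < \<beta>" using mult by (simp add: msupp_def)
    have E: "root_elem (\<alpha>, \<beta>) s \<in> carrier mclain" for s :: 'r by (rule root_elem_closed[OF lt])
    have "(root_elem (\<alpha>, \<beta>) (- r) \<star> Z) \<star> (Y \<star> root_elem (\<alpha>, \<beta>) r)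
      = root_elem (\<alpha>, \<beta>) (- r) \<star> ((Z \<star> Y) \<star> root_elem (\<alpha>, \<beta>) r)"
      using E Z(1) mult(1) by (simp add: mclain_assoc mclain_mult_closed)
    also have "\<dots> = \<one>\<^bsub>mclain\<^esub>" using E lt by (simp add: Z mclain_l_one root_elem_add root_elem_zero)
    finally show ?case using E Z(1) mclain_mult_closed by blast
  qed
qed (auto simp: mclain_mult_closed mclain_one_closed mclain_assoc mclain_l_one)

interpretation mclain: group mclain
  by (rule mclain_group)

lemma inv_root_elem: "\<alpha> < \<beta> \<Longrightarrow> inv\<^bsub>mclain\<^esub> root_elem (\<alpha>, \<beta>) r = root_elem (\<alpha>, \<beta>) (- r)"
  by (intro mclain.inv_equality) (auto simp: root_elem_closed root_elem_add root_elem_zero)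

text \<open>No closure of \<open>\<Delta>\<close> is asked for: the factorisation of
  \<open>X\<close> only involves positions in its own support.\<close>

lemma mem_mclain_gen:
  assumes "X \<in> carrier mclain" and sub: "msupp X \<subseteq> \<Delta>"
  shows "X \<in> mclain_gen \<Delta>"
  using assms(1) unfolding mclain_gen_def
proof (induction rule: mclain_induct)
  case one
  show ?case by (rule generate.one)
next
  case (mult Y \<alpha> \<beta> r)
  then have "root_elem (\<alpha>, \<beta>) r \<in> {root_elem d r |d r. d \<in> \<Delta>}" using sub by blast
  then show ?case by (intro generate.eng mult.IH generate.incl)
qed

text \<open>Closure makes the pattern stable under products, whose support may contain compositions
  of positions from both factors. Membership thereby turns into a condition on matrix
  entries.\<close>

lemma mclain_gen_eq:
  assumes sub: "\<Delta> \<subseteq> Phi" and trans: "trans \<Delta>"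
  shows "mclain_gen \<Delta> = {X \<in> carrier mclain. msupp X \<subseteq> \<Delta>}"
proof (intro equalityI subsetI)
  fix X :: "'a \<Rightarrow> 'a \<Rightarrow> 'b" assume "X \<in> mclain_gen \<Delta>"
  then show "X \<in> {X \<in> carrier mclain. msupp X \<subseteq> \<Delta>}"
    unfolding mclain_gen_def
  proof (induction rule: generate.induct)
    case one
    have "msupp (\<one>\<^bsub>mclain\<^esub> :: 'a \<Rightarrow> 'a \<Rightarrow> 'b) = {}" by (auto simp: mclain_one msupp_def)
    then show ?case using mclain_one_closed by blast
  next
    case (incl X)
    then obtain \<alpha> \<beta> r where X: "X = root_elem (\<alpha>, \<beta>) r" "(\<alpha>, \<beta>) \<in> \<Delta>" by auto
    then have "\<alpha> < \<beta>" using sub by (auto simp: Phi_def)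
    then show ?case using X msupp_root_elem[of \<alpha> \<beta> r] root_elem_closed by auto
  next
    case (inv X)
    then obtain \<alpha> \<beta> r where X: "X = root_elem (\<alpha>, \<beta>) r" "(\<alpha>, \<beta>) \<in> \<Delta>" by auto
    then have "\<alpha> < \<beta>" using sub by (auto simp: Phi_def)
    then show ?case using X msupp_root_elem[of \<alpha> \<beta> "- r"] root_elem_closed by (auto simp: inv_root_elem)
  next
    case (eng X Y)
    have "msupp X O msupp Y \<subseteq> \<Delta>" using eng.IH trans by (auto dest: transD)
    then show ?case using eng.IH msupp_mult[of X Y] by auto
  qed
qed (auto intro: mem_mclain_gen)

lemma mclain_gen_subgroup: "\<Delta> \<subseteq> Phi \<Longrightarrow> subgroup (mclain_gen \<Delta>) mclain"
  unfolding mclain_gen_def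
  by (intro mclain.generate_is_subgroup) (auto simp: Phi_def intro!: root_elem_closed)

section \<open>Linear characters of pattern subgroups\<close>

lemma linear_character_one:
  assumes "group G" "linear_character G \<kappa>"
  shows "\<kappa> \<one>\<^bsub>G\<^esub> = 1"
proof -
  interpret group G by fact
  have "\<kappa> \<one>\<^bsub>G\<^esub> * \<kappa> \<one>\<^bsub>G\<^esub> = \<kappa> \<one>\<^bsub>G\<^esub>" "\<kappa> \<one>\<^bsub>G\<^esub> \<noteq> 0"
    using assms(2) unfolding linear_character_def by (metis one_closed l_one)+
  then show ?thesis by simp
qed

lemma linear_character_subgroup_character:
  assumes "group G" "subgroup K G" "linear_character (G\<lparr>carrier := K\<rparr>) \<kappa>"
  shows "subgroup_character G K \<kappa>"
  using assms by (auto simp: subgroup_character_def subgroup_character_axioms_def linear_character_def)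

lemma linear_character_eqI:
  assumes \<Delta>: "\<Delta> \<subseteq> Phi"
    and \<kappa>: "linear_character (mclain_sub (mclain_gen \<Delta>)) \<kappa>" and \<nu>: "linear_character (mclain_sub (mclain_gen \<Delta>)) \<nu>"
    and eq: "\<And>d r. d \<in> \<Delta> \<Longrightarrow> \<kappa> (root_elem d r) = \<nu> (root_elem d r)"
  shows "\<kappa> = \<nu>"
proof
  interpret k: subgroup_character mclain "mclain_gen \<Delta>" \<kappa>
    by (rule linear_character_subgroup_character[OF mclain_group mclain_gen_subgroup[OF \<Delta>] \<kappa>])
  interpret n: subgroup_character mclain "mclain_gen \<Delta>" \<nu>
    by (rule linear_character_subgroup_character[OF mclain_group mclain_gen_subgroup[OF \<Delta>] \<nu>])
  fix X :: "'a \<Rightarrow> 'a \<Rightarrow> 'b"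
  show "\<kappa> X = \<nu> X"
  proof (cases "X \<in> mclain_gen \<Delta>")
    case True
    then have "X \<in> generate mclain {root_elem d r |d r. d \<in> \<Delta>}" unfolding mclain_gen_def .
    then show ?thesis
    proof (induction rule: generate.induct)
      case one
      show ?case by simp
    next
      case (incl h)
      then show ?case using eq by auto
    next
      case (inv h)
      then obtain d r where h: "h = root_elem d r" "d \<in> \<Delta>" by blast
      then have m: "h \<in> mclain_gen \<Delta>" unfolding mclain_gen_def by (intro generate.incl) blast
      have "\<kappa> (inv\<^bsub>mclain\<^esub> h) * \<kappa> h = \<nu> (inv\<^bsub>mclain\<^esub> h) * \<nu> h" "\<kappa> h = \<nu> h" "\<kappa> h \<noteq> 0"
        using k.\<kappa>_inv[OF m] n.\<kappa>_inv[OF m] k.\<kappa>_nz[OF m] eq h by auto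
      then show ?case by simp
    next
      case (eng h1 h2)
      then show ?case unfolding mclain_gen_def[symmetric] by (simp add: k.\<kappa>_mult n.\<kappa>_mult)
    qed
  next
    case False
    then show ?thesis using \<kappa> \<nu> by (simp add: linear_character_def extensional_def)
  qed
qed

lemma mem_mclain_gen_root:
  "d \<in> \<Delta> \<Longrightarrow> root_elem d r \<in> mclain_gen \<Delta>"
  unfolding mclain_gen_def by (intro generate.incl) blast

lemma right_primitiveD:
  assumes "right_primitive \<mu>"
  shows "\<mu> r \<noteq> 0" "\<mu> (r + s) = \<mu> r * \<mu> s" "\<mu> 0 = 1"
proof -
  show "\<mu> r \<noteq> 0" "\<mu> (r + s) = \<mu> r * \<mu> s" using assms by (auto simp: right_primitive_def)
  have "\<mu> 0 * \<mu> 0 = \<mu> 0" "\<mu> 0 \<noteq> 0" using assms unfolding right_primitive_def by (metis add_0)+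
  then show "\<mu> 0 = 1" by simp
qed

section \<open>Elementary modules\<close>

definition Hi_roots :: "'l::linorder \<times> 'l \<Rightarrow> ('l \<times> 'l) set" where
  "Hi_roots = (\<lambda>(\<alpha>, \<beta>). Phi - {(\<alpha>', \<gamma>) \<in> Phi. \<alpha>' = \<alpha> \<and> \<gamma> < \<beta>})"

lemma Hi_roots_subset: "Hi_roots d \<subseteq> Phi"
  by (auto simp: Hi_roots_def split: prod.splits)

lemma Hi_grp_gen: "Hi_grp d = mclain_gen (Hi_roots d)"
  by (simp add: Hi_grp_def Hi_roots_def split: prod.splits)

lemma mem_Hi_grp:
  "X \<in> Hi_grp (\<alpha>, \<beta>) \<longleftrightarrow> X \<in> carrier mclain \<and> (\<forall>\<gamma>. \<alpha> < \<gamma> \<and> \<gamma> < \<beta> \<longrightarrow> X \<alpha> \<gamma> = 0)"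
proof -
  have "trans (Hi_roots (\<alpha>, \<beta>))" by (auto simp: Hi_roots_def Phi_def intro!: transI)
  then have "X \<in> Hi_grp (\<alpha>, \<beta>) \<longleftrightarrow> X \<in> carrier mclain \<and> msupp X \<subseteq> Hi_roots (\<alpha>, \<beta>)"
    unfolding Hi_grp_gen by (subst mclain_gen_eq[OF Hi_roots_subset]) auto
  also have "\<dots> \<longleftrightarrow> X \<in> carrier mclain \<and> (\<forall>\<gamma>. \<alpha> < \<gamma> \<and> \<gamma> < \<beta> \<longrightarrow> X \<alpha> \<gamma> = 0)"
    by (auto simp: msupp_def Hi_roots_def Phi_def)
  finally show ?thesis .
qed

lemma Hi_grp_subgroup: "subgroup (Hi_grp d) mclain"
  unfolding Hi_grp_gen by (rule mclain_gen_subgroup[OF Hi_roots_subset])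

lemma mclain_mult_entry:
  assumes "X \<in> carrier mclain" "Y \<in> carrier mclain" "\<alpha> < \<beta>"
    and "\<And>\<gamma>. \<alpha> < \<gamma> \<Longrightarrow> \<gamma> < \<beta> \<Longrightarrow> X \<alpha> \<gamma> = 0 \<or> Y \<gamma> \<beta> = 0"
  shows "(X \<star> Y) \<alpha> \<beta> = Y \<alpha> \<beta> + X \<alpha> \<beta>"
proof -
  have "(X \<star> Y) \<alpha> \<beta> = (\<Sum>\<gamma>\<in>{\<alpha>, \<beta>}. X \<alpha> \<gamma> * Y \<gamma> \<beta>)"
  proof (rule mclain_mult)
    fix \<gamma> assume nz: "X \<alpha> \<gamma> \<noteq> 0" "Y \<gamma> \<beta> \<noteq> 0"
    then have "\<alpha> \<le> \<gamma>" "\<gamma> \<le> \<beta>" using mclainD(4) assms(1,2) by blast+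
    then show "\<gamma> \<in> {\<alpha>, \<beta>}" using nz assms(4)[of \<gamma>] by (auto simp: less_le)
  qed simp
  then show ?thesis using assms by (simp add: mclainD)
qed

lemma root_elem_self: "\<alpha> < \<beta> \<Longrightarrow> root_elem (\<alpha>, \<beta>) r \<alpha> \<beta> = r"
  by (auto simp: root_elem_def)

lemma root_elem_other: "\<alpha> < \<beta> \<Longrightarrow> d \<noteq> (\<alpha>, \<beta>) \<Longrightarrow> root_elem d r \<alpha> \<beta> = 0"
  by (auto simp: root_elem_def)

text \<open>Once the entry at \<open>(\<alpha>, \<beta>)\<close> is additive on the group,
  \<open>\<mu>\<close> of that entry is a character with the required values, and values on
  generators determine it. This evaluates both definite descriptions, \<open>P_char\<close> and
  \<open>lambda_hat\<close>.\<close>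

lemma root_character_eq:
  fixes \<mu> :: "'r::ring_1 \<Rightarrow> 'f::field" and \<alpha> :: "'l::linorder"
  assumes lt: "\<alpha> < \<beta>" and \<mu>: "right_primitive \<mu>" and \<Delta>: "\<Delta> \<subseteq> Phi" "(\<alpha>, \<beta>) \<in> \<Delta>"
    and add: "\<And>X Y :: 'l \<Rightarrow> 'l \<Rightarrow> 'r. X \<in> mclain_gen \<Delta> \<Longrightarrow> Y \<in> mclain_gen \<Delta> \<Longrightarrow>
      (X \<star> Y) \<alpha> \<beta> = Y \<alpha> \<beta> + X \<alpha> \<beta>"
  shows "(THE \<kappa>. linear_character (mclain_sub (mclain_gen \<Delta>)) \<kappa> \<and> (\<forall>r. \<kappa> (root_elem (\<alpha>, \<beta>) r) = \<mu> r) \<and>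
      (\<forall>d'\<in>\<Delta> - {(\<alpha>, \<beta>)}. \<forall>r. \<kappa> (root_elem d' r) = 1)) = (\<lambda>X\<in>mclain_gen \<Delta>. \<mu> (X \<alpha> \<beta>))"
proof (rule the_equality)
  let ?h = "\<lambda>X\<in>mclain_gen \<Delta>. \<mu> (X \<alpha> \<beta>)"
  note \<mu>D = right_primitiveD[OF \<mu>]
  have sub: "subgroup (mclain_gen \<Delta> :: ('l \<Rightarrow> 'l \<Rightarrow> 'r) set) mclain" by (rule mclain_gen_subgroup[OF \<Delta>(1)])
  have lin: "linear_character (mclain_sub (mclain_gen \<Delta>)) ?h"
    using subgroup.m_closed[OF sub] by (auto simp: linear_character_def \<mu>D add)
  have self: "?h (root_elem (\<alpha>, \<beta>) r) = \<mu> r" for r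
    using mem_mclain_gen_root[OF \<Delta>(2), of r] by (simp add: root_elem_self lt)
  have other: "?h (root_elem d r) = 1" if "d \<in> \<Delta> - {(\<alpha>, \<beta>)}" for d r
    using that mem_mclain_gen_root[of d \<Delta> r] root_elem_other[OF lt, of d r] by (auto simp: \<mu>D)
  show "linear_character (mclain_sub (mclain_gen \<Delta>)) ?h \<and> (\<forall>r. ?h (root_elem (\<alpha>, \<beta>) r) = \<mu> r) \<and>
      (\<forall>d'\<in>\<Delta> - {(\<alpha>, \<beta>)}. \<forall>r. ?h (root_elem d' r) = 1)"
    using lin self other by blast
  fix \<kappa> assume \<kappa>: "linear_character (mclain_sub (mclain_gen \<Delta>)) \<kappa> \<and> (\<forall>r. \<kappa> (root_elem (\<alpha>, \<beta>) r) = \<mu> r) \<and>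
      (\<forall>d'\<in>\<Delta> - {(\<alpha>, \<beta>)}. \<forall>r. \<kappa> (root_elem d' r) = 1)"
  show "\<kappa> = ?h"
  proof (rule linear_character_eqI[OF \<Delta>(1) _ lin])
    fix d r assume d: "d \<in> \<Delta>"
    show "\<kappa> (root_elem d r) = ?h (root_elem d r)"
    proof (cases "d = (\<alpha>, \<beta>)")
      case True
      then show ?thesis using \<kappa> self[of r] by metis
    next
      case False
      then show ?thesis using \<kappa> other[of d r] d by (metis DiffI singletonD)
    qed
  qed (use \<kappa> in blast)
qed

lemma lambda_hat_eq:
  fixes \<mu> :: "'r::ring_1 \<Rightarrow> 'f::field" and \<alpha> :: "'l::linorder"
  assumes lt: "\<alpha> < \<beta>" and \<mu>: "right_primitive \<mu>"
  shows "lambda_hat (\<alpha>, \<beta>) \<mu> = (\<lambda>X\<in>Hi_grp (\<alpha>, \<beta>). \<mu> (X \<alpha> \<beta>))"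
proof -
  have roots: "Phi - {(\<alpha>', \<gamma>) \<in> Phi. \<alpha>' = fst (\<alpha>, \<beta>) \<and> \<gamma> \<le> snd (\<alpha>, \<beta>)} = Hi_roots (\<alpha>, \<beta>) - {(\<alpha>, \<beta>)}"
    using lt by (auto simp: Hi_roots_def Phi_def)
  show ?thesis
    unfolding lambda_hat_def roots unfolding Hi_grp_gen
  proof (rule root_character_eq[OF lt \<mu> Hi_roots_subset])
    show "(\<alpha>, \<beta>) \<in> Hi_roots (\<alpha>, \<beta>)" using lt by (simp add: Hi_roots_def Phi_def)
    fix X Y :: "'l \<Rightarrow> 'l \<Rightarrow> 'r" assume "X \<in> mclain_gen (Hi_roots (\<alpha>, \<beta>))" "Y \<in> mclain_gen (Hi_roots (\<alpha>, \<beta>))"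
    then show "(X \<star> Y) \<alpha> \<beta> = Y \<alpha> \<beta> + X \<alpha> \<beta>"
      unfolding Hi_grp_gen[symmetric] by (intro mclain_mult_entry lt) (auto simp: mem_Hi_grp)
  qed
qed

lemma subgroup_character_lambda_hat:
  fixes \<mu> :: "'r::ring_1 \<Rightarrow> 'f::field" and \<alpha> :: "'l::linorder"
  assumes lt: "\<alpha> < \<beta>" and \<mu>: "right_primitive \<mu>"
  shows "subgroup_character mclain (Hi_grp (\<alpha>, \<beta>)) (lambda_hat (\<alpha>, \<beta>) \<mu>)"
proof (intro subgroup_character.intro subgroup_character_axioms.intro mclain_group Hi_grp_subgroup)
  fix X Y :: "'l \<Rightarrow> 'l \<Rightarrow> 'r" assume X: "X \<in> Hi_grp (\<alpha>, \<beta>)" and Y: "Y \<in> Hi_grp (\<alpha>, \<beta>)"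
  have "(X \<star> Y) \<alpha> \<beta> = Y \<alpha> \<beta> + X \<alpha> \<beta>"
    using X Y by (intro mclain_mult_entry lt) (auto simp: mem_Hi_grp)
  then show "lambda_hat (\<alpha>, \<beta>) \<mu> (X \<star> Y) = lambda_hat (\<alpha>, \<beta>) \<mu> X * lambda_hat (\<alpha>, \<beta>) \<mu> Y"
    using X Y subgroup.m_closed[OF Hi_grp_subgroup X Y]
    by (simp add: lambda_hat_eq[OF assms] right_primitiveD[OF \<mu>] mult.commute)
qed (simp add: lambda_hat_eq[OF assms] right_primitiveD[OF \<mu>])

lemma mem_L_grp:
  "X \<in> L_grp (\<alpha>, \<beta>) \<longleftrightarrow> X \<in> carrier mclain \<and> (\<forall>\<gamma> \<delta>. \<gamma> < \<delta> \<and> X \<gamma> \<delta> \<noteq> 0 \<longrightarrow> \<alpha> \<le> \<gamma> \<and> \<delta> \<le> \<beta>)"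
proof -
  let ?D = "{(\<gamma>, \<delta>). \<alpha> \<le> \<gamma> \<and> \<gamma> < \<delta> \<and> \<delta> \<le> \<beta>}"
  have "trans ?D" "?D \<subseteq> Phi" by (auto simp: Phi_def intro!: transI)
  then show ?thesis
    by (auto simp: L_grp_def mclain_gen_eq msupp_def)
qed

lemma L_grp_subgroup: "subgroup (L_grp d) mclain"
  by (auto simp: L_grp_def Phi_def split: prod.splits intro!: mclain_gen_subgroup)

lemma P_roots_subset: "P_roots d \<subseteq> Phi"
  by (auto simp: P_roots_def Phi_def split: prod.splits)

text \<open>This casts an elementary module as an instance of \<open>ind_fun_model\<close>, with
  \<open>K\<close> the group \<open>Hi_grp\<close> and \<open>L\<close> the group
  \<open>L_grp\<close>.\<close>

lemma P_grp_eq: 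
  assumes "\<alpha> < \<beta>"
  shows "P_grp (\<alpha>, \<beta>) = Hi_grp (\<alpha>, \<beta>) \<inter> L_grp (\<alpha>, \<beta>)"
proof -
  have "trans (P_roots (\<alpha>, \<beta>))" by (auto simp: P_roots_def intro!: transI)
  then have 1: "P_grp (\<alpha>, \<beta>) = {X \<in> carrier mclain. msupp X \<subseteq> P_roots (\<alpha>, \<beta>)}"
    unfolding P_grp_def by (rule mclain_gen_eq[OF P_roots_subset])
  have "msupp X \<subseteq> P_roots (\<alpha>, \<beta>) \<longleftrightarrow> X \<in> Hi_grp (\<alpha>, \<beta>) \<inter> L_grp (\<alpha>, \<beta>)" if X: "X \<in> carrier mclain" for X :: "'a \<Rightarrow> 'a \<Rightarrow> 'b"
  proof
    assume *: "msupp X \<subseteq> P_roots (\<alpha>, \<beta>)"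
    then have "\<gamma> < \<delta> \<and> X \<gamma> \<delta> \<noteq> 0 \<Longrightarrow> (\<gamma>, \<delta>) \<in> P_roots (\<alpha>, \<beta>)" for \<gamma> \<delta> by (auto simp: msupp_def)
    then show "X \<in> Hi_grp (\<alpha>, \<beta>) \<inter> L_grp (\<alpha>, \<beta>)"
      using X by (fastforce simp: mem_Hi_grp mem_L_grp P_roots_def)
  next
    assume *: "X \<in> Hi_grp (\<alpha>, \<beta>) \<inter> L_grp (\<alpha>, \<beta>)"
    show "msupp X \<subseteq> P_roots (\<alpha>, \<beta>)"
    proof
      fix p assume "p \<in> msupp X"
      then obtain \<gamma> \<delta> where p: "p = (\<gamma>, \<delta>)" "\<gamma> < \<delta>" "X \<gamma> \<delta> \<noteq> 0" by (auto simp: msupp_def)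
      then have b: "\<alpha> \<le> \<gamma>" "\<delta> \<le> \<beta>" using * by (auto simp: mem_L_grp)
      have "\<gamma> = \<alpha> \<Longrightarrow> \<delta> = \<beta>" using * p b by (force simp: mem_Hi_grp)
      then show "p \<in> P_roots (\<alpha>, \<beta>)" using p b by (auto simp: P_roots_def less_le)
    qed
  qed
  moreover have "X \<in> carrier mclain" if "X \<in> Hi_grp (\<alpha>, \<beta>)" for X :: "'a \<Rightarrow> 'a \<Rightarrow> 'b"
    using that by (simp add: mem_Hi_grp)
  ultimately show ?thesis unfolding 1 by blast
qed

lemma P_char_eq:
  fixes \<mu> :: "'r::ring_1 \<Rightarrow> 'f::field" and \<alpha> :: "'l::linorder"
  assumes lt: "\<alpha> < \<beta>" and \<mu>: "right_primitive \<mu>" and X: "X \<in> P_grp (\<alpha>, \<beta>)"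
  shows "P_char (\<alpha>, \<beta>) \<mu> X = lambda_hat (\<alpha>, \<beta>) \<mu> X"
proof -
  have "P_char (\<alpha>, \<beta>) \<mu> = (\<lambda>X\<in>P_grp (\<alpha>, \<beta>). \<mu> (X \<alpha> \<beta>))"
    unfolding P_char_def unfolding P_grp_def
  proof (rule root_character_eq[OF lt \<mu> P_roots_subset])
    show "(\<alpha>, \<beta>) \<in> P_roots (\<alpha>, \<beta>)" using lt by (simp add: P_roots_def)
    fix X Y :: "'l \<Rightarrow> 'l \<Rightarrow> 'r" assume "X \<in> mclain_gen (P_roots (\<alpha>, \<beta>))" "Y \<in> mclain_gen (P_roots (\<alpha>, \<beta>))"
    then show "(X \<star> Y) \<alpha> \<beta> = Y \<alpha> \<beta> + X \<alpha> \<beta>"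
      unfolding P_grp_def[symmetric] P_grp_eq[OF lt] by (intro mclain_mult_entry lt) (auto simp: mem_Hi_grp)
  qed
  then show ?thesis using X unfolding P_grp_eq[OF lt] by (simp add: lambda_hat_eq[OF lt \<mu>])
qed

section \<open>The projection of \<open>M\<close> onto \<open>L\<close>, and elementary modules on
  all of \<open>M\<close>\<close>

definition trunc :: "'l::linorder \<times> 'l \<Rightarrow> ('l \<Rightarrow> 'l \<Rightarrow> 'r::ring_1) \<Rightarrow> 'l \<Rightarrow> 'l \<Rightarrow> 'r" where
  "trunc d X = (\<lambda>\<gamma> \<delta>. if fst d \<le> \<gamma> \<and> \<delta> \<le> snd d then X \<gamma> \<delta> else if \<gamma> = \<delta> then 1 else 0)"

lemma msupp_trunc: "msupp (trunc d X) \<subseteq> msupp X"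
  by (auto simp: msupp_def trunc_def split: if_splits)

lemma trunc_closed:
  assumes "X \<in> carrier mclain"
  shows "trunc d X \<in> carrier mclain"
  using assms finite_subset[OF msupp_trunc[of d X]] by (auto simp: mclain_carrier_iff trunc_def)

lemma trunc_in_L: "X \<in> carrier mclain \<Longrightarrow> trunc d X \<in> L_grp d"
  using trunc_closed[of X d] by (cases d) (auto simp: mem_L_grp trunc_def split: if_splits)

lemma trunc_L: "X \<in> L_grp d \<Longrightarrow> trunc d X = X"
proof (intro ext)
  fix \<gamma> \<delta> assume X: "X \<in> L_grp d"
  obtain \<alpha> \<beta> where d: "d = (\<alpha>, \<beta>)" by (cases d)
  have c: "X \<in> carrier mclain" using X d by (simp add: mem_L_grp)
  show "trunc d X \<gamma> \<delta> = X \<gamma> \<delta>"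
    using X d mclainD(1,2)[OF c] by (cases \<gamma> \<delta> rule: linorder_cases) (auto simp: mem_L_grp trunc_def)
qed

text \<open>Inside the interval, every index that contributes to an entry of the product lies
  between row and column, hence in the interval too. Outside, one factor has an identity row or
  column, which leaves the corresponding identity entry.\<close>

lemma trunc_mult:
  assumes X: "X \<in> carrier mclain" and Y: "Y \<in> carrier mclain"
  shows "trunc d (X \<star> Y) = trunc d X \<star> trunc d Y"
proof (intro ext)
  fix \<gamma> \<delta>
  let ?A = "insert \<gamma> (insert \<delta> (mindex X \<union> mindex Y))"
  have fin: "finite ?A" using X Y by (simp add: finite_mindex)
  have mi: "mindex (trunc d X) \<subseteq> mindex X" using msupp_trunc[of d X] by (auto simp: mindex_def)
  have R: "(trunc d X \<star> trunc d Y) \<gamma> \<delta> = (\<Sum>\<epsilon>\<in>?A. trunc d X \<gamma> \<epsilon> * trunc d Y \<epsilon> \<delta>)"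
    using fin mi by (intro mclain_mult_left trunc_closed X) auto
  have Lh: "(X \<star> Y) \<gamma> \<delta> = (\<Sum>\<epsilon>\<in>?A. X \<gamma> \<epsilon> * Y \<epsilon> \<delta>)"
    using fin by (intro mclain_mult_left X) auto
  consider (inside) "fst d \<le> \<gamma>" "\<delta> \<le> snd d" | (left) "\<not> fst d \<le> \<gamma>" | (right) "\<not> \<delta> \<le> snd d" by blast
  then show "trunc d (X \<star> Y) \<gamma> \<delta> = (trunc d X \<star> trunc d Y) \<gamma> \<delta>"
  proof cases
    case inside
    have "X \<gamma> \<epsilon> * Y \<epsilon> \<delta> = trunc d X \<gamma> \<epsilon> * trunc d Y \<epsilon> \<delta>" for \<epsilon>
    proof (cases "fst d \<le> \<epsilon>")
      case True
      show ?thesis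
      proof (cases "\<epsilon> \<le> snd d")
        case False
        then have "\<delta> < \<epsilon>" using inside by simp
        then have "Y \<epsilon> \<delta> = 0" by (rule mclainD(2)[OF Y])
        then show ?thesis using True inside by (simp add: trunc_def)
      qed (use True inside in \<open>simp add: trunc_def\<close>)
    next
      case False
      then have "\<epsilon> < \<gamma>" using inside by simp
      then have "X \<gamma> \<epsilon> = 0" by (rule mclainD(2)[OF X])
      moreover have "trunc d X \<gamma> \<epsilon> = 0" using \<open>\<epsilon> < \<gamma>\<close> \<open>X \<gamma> \<epsilon> = 0\<close> by (auto simp: trunc_def)
      ultimately show ?thesis by simp
    qed
    then show ?thesis using inside unfolding R by (simp add: trunc_def Lh)
  next
    case left
    then have "(\<Sum>\<epsilon>\<in>?A. trunc d X \<gamma> \<epsilon> * trunc d Y \<epsilon> \<delta>) = (\<Sum>\<epsilon>\<in>?A. if \<epsilon> = \<gamma> then trunc d Y \<gamma> \<delta> else 0)"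
      by (intro sum.cong) (auto simp: trunc_def)
    then show ?thesis using left fin unfolding R by (simp add: trunc_def)
  next
    case right
    then have "(\<Sum>\<epsilon>\<in>?A. trunc d X \<gamma> \<epsilon> * trunc d Y \<epsilon> \<delta>) = (\<Sum>\<epsilon>\<in>?A. if \<epsilon> = \<delta> then trunc d X \<gamma> \<delta> else 0)"
      by (intro sum.cong) (auto simp: trunc_def)
    then show ?thesis using right fin unfolding R by (simp add: trunc_def)
  qed
qed

lemma trunc_hom: "group_hom mclain mclain (trunc d)"
  by (intro group_hom.intro group_hom_axioms.intro mclain_group homI trunc_closed trunc_mult)

text \<open>The kernel is normal and contains the generators. Conversely an element of the kernel
  has all its off-diagonal entries at positions outside the interval, so it is a product of those
  generators and lies in every normal subgroup containing them.\<close>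

lemma N_grp_eq: "N_grp d = kernel mclain mclain (trunc d)"
proof -
  obtain \<alpha> \<beta> where d: "d = (\<alpha>, \<beta>)" by (cases d)
  define \<Delta> where "\<Delta> = {(\<gamma>, \<delta>). \<gamma> < \<delta> \<and> (\<gamma> < \<alpha> \<or> \<beta> < \<delta>)}"
  have gen: "{root_elem (\<gamma>, \<delta>) r |\<gamma> \<delta> r. \<gamma> < \<delta> \<and> (\<gamma> < \<alpha> \<or> \<beta> < \<delta>)} = {root_elem p r |p r. p \<in> \<Delta>}"
    by (auto simp: \<Delta>_def)
  interpret t: group_hom mclain mclain "trunc d" by (rule trunc_hom)
  show ?thesis
  proof (intro equalityI subsetI)
    fix X :: "'a \<Rightarrow> 'a \<Rightarrow> 'b" assume X: "X \<in> N_grp d"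
    have "root_elem p r \<in> kernel mclain mclain (trunc d)" if "p \<in> \<Delta>" for p and r :: 'b
    proof -
      have "trunc d (root_elem p r) = \<one>\<^bsub>mclain\<^esub>"
        using that by (auto simp: fun_eq_iff trunc_def root_elem_def mclain_one \<Delta>_def d)
      then show ?thesis using that by (cases p) (auto simp: kernel_def \<Delta>_def root_elem_closed)
    qed
    then show "X \<in> kernel mclain mclain (trunc d)"
      using X t.normal_kernel unfolding N_grp_def d prod.case gen by blast
  next
    fix X :: "'a \<Rightarrow> 'a \<Rightarrow> 'b" assume "X \<in> kernel mclain mclain (trunc d)"
    then have X: "X \<in> carrier mclain" "trunc d X = \<one>\<^bsub>mclain\<^esub>" by (auto simp: kernel_def)
    have "X \<gamma> \<delta> = 0" if "\<gamma> < \<delta>" "\<alpha> \<le> \<gamma>" "\<delta> \<le> \<beta>" for \<gamma> \<delta>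
      using fun_cong[OF fun_cong[OF X(2)], of \<gamma> \<delta>] that by (simp add: d trunc_def mclain_one)
    then have "msupp X \<subseteq> \<Delta>" by (force simp: msupp_def \<Delta>_def)
    then have XG: "X \<in> generate mclain {root_elem p r |p r. p \<in> \<Delta>}"
      using mem_mclain_gen[OF X(1)] by (simp add: mclain_gen_def)
    have "X \<in> K" if "K \<lhd> mclain" "{root_elem p r |p r. p \<in> \<Delta>} \<subseteq> K" for K
      using mclain.generate_subgroup_incl[OF that(2) normal_imp_subgroup[OF that(1)]] XG by blast
    then show "X \<in> N_grp d" unfolding N_grp_def d prod.case gen by blast
  qed
qed

text \<open>Truncation kills \<open>N\<close> and fixes \<open>L\<close>, so applying it to
  \<open>g = n l\<close> recovers \<open>l\<close>.\<close>

lemma L_proj_eq: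
  assumes g: "g \<in> carrier mclain"
  shows "L_proj d g = trunc d g"
proof -
  interpret t: group_hom mclain mclain "trunc d" by (rule trunc_hom)
  have tt: "trunc d (trunc d g) = trunc d g" by (rule trunc_L[OF trunc_in_L[OF g]])
  have tc: "trunc d g \<in> carrier mclain" by (rule trunc_closed[OF g])
  show ?thesis
    unfolding L_proj_def
  proof (rule the_equality)
    show "trunc d g \<in> L_grp d \<and> (\<exists>n\<in>N_grp d. g = n \<star> trunc d g)"
    proof (intro conjI bexI[of _ "g \<star> inv\<^bsub>mclain\<^esub> trunc d g"] trunc_in_L g)
      show "g = g \<star> inv\<^bsub>mclain\<^esub> trunc d g \<star> trunc d g"
        using g tc by (simp add: mclain.m_assoc)
      have "trunc d (g \<star> inv\<^bsub>mclain\<^esub> trunc d g) = \<one>\<^bsub>mclain\<^esub>"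
        using g tc by (simp add: t.hom_inv tt)
      then show "g \<star> inv\<^bsub>mclain\<^esub> trunc d g \<in> N_grp d"
        using g tc by (simp add: N_grp_eq kernel_def)
    qed
  next
    fix l assume "l \<in> L_grp d \<and> (\<exists>n\<in>N_grp d. g = n \<star> l)"
    then obtain n where l: "l \<in> L_grp d" "n \<in> N_grp d" "g = n \<star> l" by blast
    have lc: "l \<in> carrier mclain" using l(1) subgroup.mem_carrier[OF L_grp_subgroup] by blast
    have n: "n \<in> carrier mclain" "trunc d n = \<one>\<^bsub>mclain\<^esub>" using l(2) by (auto simp: N_grp_eq kernel_def)
    show "l = trunc d g" using n lc by (simp add: l(3) trunc_L[OF l(1)])
  qed
qed

text \<open>An element and its truncation give the same coset function, so the coset functions of
  elements of \<open>L\<close> already span the module induced from \<open>Hi_grp\<close> to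
  \<open>M\<close>, and the action through \<open>L\<close> is ordinary translation by
  \<open>M\<close>.\<close>

lemma elementary_fun_model:
  fixes \<mu> :: "'r::ring_1 \<Rightarrow> 'f::field" and \<alpha> :: "'l::linorder"
  assumes lt: "\<alpha> < \<beta>" and \<mu>: "right_primitive \<mu>"
  obtains \<Psi> where "fun_model mclain (carrier mclain) (elementary_module (\<alpha>, \<beta>) \<mu>)
    (indsp mclain (Hi_grp (\<alpha>, \<beta>)) (lambda_hat (\<alpha>, \<beta>) \<mu>)) \<Psi>"
proof -
  let ?d = "(\<alpha>, \<beta>)"
  let ?M = "mclain :: ('l \<Rightarrow> 'l \<Rightarrow> 'r) monoid"
  let ?K = "Hi_grp ?d :: ('l \<Rightarrow> 'l \<Rightarrow> 'r) set" and ?\<kappa> = "lambda_hat ?d \<mu>"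
  let ?L = "L_grp ?d :: ('l \<Rightarrow> 'l \<Rightarrow> 'r) set"
  let ?e = "ebase ?M ?K ?\<kappa>"
  interpret K: subgroup_character ?M ?K ?\<kappa> by (rule subgroup_character_lambda_hat[OF assms])
  interpret t: group_hom ?M ?M "trunc ?d" by (rule trunc_hom)
  note tc = trunc_closed[of _ ?d]
  \<comment> \<open>The two elements differ by some \<open>k\<close> on the right whose row
    \<open>\<alpha>\<close> is trivial up to and including column \<open>\<beta>\<close>: it lies in
    \<open>Hi_grp\<close> and its character value is 1.\<close>
  have et: "?e (trunc ?d g) = ?e g" if g: "g \<in> carrier ?M" for g
  proof -
    define k where "k = inv\<^bsub>mclain\<^esub> trunc ?d g \<star> g"
    have kc: "k \<in> carrier ?M" using g tc by (simp add: k_def)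
    have tg: "trunc ?d (trunc ?d g) = trunc ?d g" by (rule trunc_L[OF trunc_in_L[OF g]])
    have "trunc ?d k = inv\<^bsub>?M\<^esub> trunc ?d (trunc ?d g) \<otimes>\<^bsub>?M\<^esub> trunc ?d g"
      unfolding k_def using g tc by (simp add: t.hom_inv)
    then have "trunc ?d k = \<one>\<^bsub>?M\<^esub>" using g tc by (simp add: tg)
    then have "k \<alpha> \<gamma> = 0" if "\<alpha> < \<gamma>" "\<gamma> \<le> \<beta>" for \<gamma>
    proof -
      have "trunc ?d k \<alpha> \<gamma> = \<one>\<^bsub>?M\<^esub> \<alpha> \<gamma>" using \<open>trunc ?d k = \<one>\<^bsub>?M\<^esub>\<close> by simp
      then show ?thesis using that by (auto simp: trunc_def mclain_one)
    qed
    then have "k \<in> ?K" "?\<kappa> k = 1"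
      using kc lt by (auto simp: mem_Hi_grp lambda_hat_eq[OF assms] right_primitiveD[OF \<mu>])
    moreover have "trunc ?d g \<otimes>\<^bsub>?M\<^esub> k = g" using g tc by (simp add: k_def flip: mclain.m_assoc)
    ultimately show ?thesis using K.ebase_mult[OF tc[OF g], of k] by simp
  qed
  have sp: "fs.span (?e ` ?L) = indsp ?M ?K ?\<kappa>"
    unfolding K.indsp_eq_span
  proof (intro arg_cong[of _ _ fs.span] equalityI image_subsetI)
    show "?e g \<in> ?e ` carrier ?M" if "g \<in> ?L" for g
      using that subgroup.mem_carrier[OF L_grp_subgroup] by blast
    show "?e g \<in> ?e ` ?L" if "g \<in> carrier ?M" for g
      using et[OF that] trunc_in_L[OF that, of ?d] by (metis imageI)
  qed
  have lt_eq: "ltrans ?M (trunc ?d g) \<phi> = ltrans ?M g \<phi>" if g: "g \<in> carrier ?M" and \<phi>: "\<phi> \<in> indsp ?M ?K ?\<kappa>" for g \<phi>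
    using \<phi> unfolding K.indsp_eq_span
  proof (rule fs.span_induct)
    fix \<psi> assume "\<psi> \<in> ?e ` carrier ?M"
    then obtain h where h: "h \<in> carrier ?M" "\<psi> = ?e h" by blast
    have "trunc ?d (trunc ?d g \<otimes>\<^bsub>?M\<^esub> h) = trunc ?d (g \<otimes>\<^bsub>?M\<^esub> h)"
      using g h tc trunc_L[OF trunc_in_L[OF g], of ?d] by simp
    then have "?e (trunc ?d g \<otimes>\<^bsub>?M\<^esub> h) = ?e (g \<otimes>\<^bsub>?M\<^esub> h)"
      using et[of "trunc ?d g \<otimes>\<^bsub>?M\<^esub> h"] et[of "g \<otimes>\<^bsub>?M\<^esub> h"] g h tc by simp
    then show "ltrans ?M (trunc ?d g) \<psi> = ltrans ?M g \<psi>"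
      using g h tc by (simp add: K.ltrans_ebase)
  next
    show "fs.subspace {\<psi>. ltrans ?M (trunc ?d g) \<psi> = ltrans ?M g \<psi>}"
      by (rule fs.subspaceI) (simp_all add: ltrans_add ltrans_scale)
  qed
  let ?V = "ind (mclain_sub ?L) (P_grp ?d) (char_module (P_char ?d \<mu>))"
  have agree: "P_char ?d \<mu> k = ?\<kappa> k" if "k \<in> ?K \<inter> ?L" for k
    using P_char_eq[OF assms] that unfolding P_grp_eq[OF lt] by blast
  obtain \<Psi> where "fun_model ?M ?L (ind (mclain_sub ?L) (?K \<inter> ?L) (char_module (P_char ?d \<mu>))) (fs.span (?e ` ?L)) \<Psi>"
    by (rule K.ind_fun_model[OF L_grp_subgroup agree])
  then have m: "fun_model ?M ?L ?V (indsp ?M ?K ?\<kappa>) \<Psi>" unfolding sp P_grp_eq[OF lt] .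
  note mD = fun_modelD[OF m]
  have "fun_model ?M (carrier ?M) (elementary_module ?d \<mu>) (indsp ?M ?K ?\<kappa>) \<Psi>"
    unfolding fun_model_def elementary_module_def Let_def
  proof (intro conjI ballI allI)
    fix g v assume "g \<in> carrier ?M" and v: "v \<in> carrier (?V\<lparr>act := \<lambda>g. act ?V (L_proj ?d g)\<rparr>)"
    then have g: "g \<in> carrier ?M" and v: "v \<in> carrier ?V" by simp_all
    show "act (?V\<lparr>act := \<lambda>g. act ?V (L_proj ?d g)\<rparr>) g v \<in> carrier (?V\<lparr>act := \<lambda>g. act ?V (L_proj ?d g)\<rparr>)"
      using mD(8)[OF trunc_in_L[OF g] v] by (simp add: L_proj_eq[OF g])
    show "\<Psi> (act (?V\<lparr>act := \<lambda>g. act ?V (L_proj ?d g)\<rparr>) g v) = ltrans ?M g (\<Psi> v)"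
      using mD(9)[OF trunc_in_L[OF g] v] lt_eq[OF g mD(10)[OF v]] by (simp add: L_proj_eq[OF g])
  qed (use mD(1-7) in \<open>simp_all\<close>)
  then show thesis by (rule that)
qed

section \<open>The groups attached to a basic subset\<close>

locale basic_data =
  fixes D :: "('l::linorder \<times> 'l) set" and f :: "'l \<times> 'l \<Rightarrow> 'r::ring_1 \<Rightarrow> 'f::field"
  assumes basic: "basic_subset D" and prim: "\<And>d. d \<in> D \<Longrightarrow> right_primitive (f d)"
begin

abbreviation M :: "('l \<Rightarrow> 'l \<Rightarrow> 'r) monoid" where "M \<equiv> mclain"

abbreviation H :: "('l \<Rightarrow> 'l \<Rightarrow> 'r) set" where "H \<equiv> H_grp D"

abbreviation I :: "('l \<Rightarrow> 'l \<Rightarrow> 'r) set" where "I \<equiv> I_grp D"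

lemma finite_D: "finite D" and D_ne: "D \<noteq> {}"
  using basic by (auto simp: basic_subset_def)

lemma D_less: "(\<alpha>, \<beta>) \<in> D \<Longrightarrow> \<alpha> < \<beta>"
  using basic by (auto simp: basic_subset_def Phi_def)

lemma D_fst: "(\<alpha>, \<beta>) \<in> D \<Longrightarrow> (\<alpha>, \<gamma>) \<in> D \<Longrightarrow> \<beta> = \<gamma>"
  using basic inj_onD[of fst D "(\<alpha>, \<beta>)" "(\<alpha>, \<gamma>)"] by (simp add: basic_subset_def)

lemma D_snd: "(\<alpha>, \<gamma>) \<in> D \<Longrightarrow> (\<beta>, \<gamma>) \<in> D \<Longrightarrow> \<alpha> = \<beta>"
  using basic inj_onD[of snd D "(\<alpha>, \<gamma>)" "(\<beta>, \<gamma>)"] by (simp add: basic_subset_def)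

lemma mem_Gamma: "(\<alpha>, \<gamma>) \<in> Gamma D \<longleftrightarrow> \<alpha> < \<gamma> \<and> (\<forall>\<beta>. (\<alpha>, \<beta>) \<in> D \<longrightarrow> \<beta> \<le> \<gamma>)"
  by (fastforce simp: Gamma_def Phi_def)

lemma mem_Omega: "(\<alpha>, \<gamma>) \<in> Omega D \<longleftrightarrow> \<alpha> < \<gamma> \<and> (\<exists>\<beta> \<delta>. (\<alpha>, \<beta>) \<in> D \<and> (\<gamma>, \<delta>) \<in> D \<and> \<gamma> < \<beta> \<and> \<beta> < \<delta>)"
  by (auto simp: Omega_def Phi_def)

lemma Gamma_sub: "Gamma D \<subseteq> Phi" and Omega_sub: "Omega D \<subseteq> Phi"
  by (auto simp: Gamma_def Omega_def)

lemma Gamma1_sub: "Gamma D \<union> Omega D \<subseteq> Phi"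
  using Gamma_sub Omega_sub by blast

lemma trans_Gamma: "trans (Gamma D)"
  by (rule transI) (auto simp: mem_Gamma intro: order_trans less_imp_le)

text \<open>The first coordinates of \<open>D\<close> are distinct, so the root of \<open>D\<close>
  in row \<open>\<alpha>\<close> that witnesses membership in \<open>Omega D\<close> is the only
  one; hence a condition on all roots of \<open>D\<close> covers both sets at once.\<close>

lemma mem_Gamma1:
  "(\<alpha>, \<gamma>) \<in> Gamma D \<union> Omega D \<longleftrightarrow>
    \<alpha> < \<gamma> \<and> (\<forall>\<beta>. (\<alpha>, \<beta>) \<in> D \<and> \<gamma> < \<beta> \<longrightarrow> (\<exists>\<delta>. (\<gamma>, \<delta>) \<in> D \<and> \<beta> < \<delta>))"
proof
  assume *: "(\<alpha>, \<gamma>) \<in> Gamma D \<union> Omega D"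
  have "\<exists>\<delta>. (\<gamma>, \<delta>) \<in> D \<and> \<beta> < \<delta>" if b: "(\<alpha>, \<beta>) \<in> D" "\<gamma> < \<beta>" for \<beta>
  proof -
    have "(\<alpha>, \<gamma>) \<notin> Gamma D" using b by (auto simp: mem_Gamma)
    then have "(\<alpha>, \<gamma>) \<in> Omega D" using * by blast
    then obtain \<beta>' \<delta> where bd: "(\<alpha>, \<beta>') \<in> D" "(\<gamma>, \<delta>) \<in> D" "\<beta>' < \<delta>" by (auto simp: mem_Omega)
    have "\<beta>' = \<beta>" by (rule D_fst[OF bd(1) b(1)])
    then show ?thesis using bd by blast
  qed
  moreover have "\<alpha> < \<gamma>" using * by (auto simp: mem_Gamma mem_Omega)
  ultimately show "\<alpha> < \<gamma> \<and> (\<forall>\<beta>. (\<alpha>, \<beta>) \<in> D \<and> \<gamma> < \<beta> \<longrightarrow> (\<exists>\<delta>. (\<gamma>, \<delta>) \<in> D \<and> \<beta> < \<delta>))" by blast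
next
  assume "\<alpha> < \<gamma> \<and> (\<forall>\<beta>. (\<alpha>, \<beta>) \<in> D \<and> \<gamma> < \<beta> \<longrightarrow> (\<exists>\<delta>. (\<gamma>, \<delta>) \<in> D \<and> \<beta> < \<delta>))"
  then show "(\<alpha>, \<gamma>) \<in> Gamma D \<union> Omega D"
    unfolding Un_iff mem_Gamma mem_Omega by (meson linorder_not_le)
qed

text \<open>A root of \<open>D\<close> that starts at \<open>a\<close> and ends beyond
  \<open>c\<close> yields one at \<open>b\<close> with a later end, and that one yields one at
  \<open>c\<close> with a still later end.\<close>

lemma trans_Gamma1: "trans (Gamma D \<union> Omega D)"
proof (rule transI)
  fix a b c assume ab: "(a, b) \<in> Gamma D \<union> Omega D" and bc: "(b, c) \<in> Gamma D \<union> Omega D"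
  have "\<exists>\<delta>. (c, \<delta>) \<in> D \<and> \<beta> < \<delta>" if \<beta>: "(a, \<beta>) \<in> D" "c < \<beta>" for \<beta>
  proof -
    have "b < \<beta>" using bc \<beta> unfolding mem_Gamma1 by auto
    then obtain \<delta> where \<delta>: "(b, \<delta>) \<in> D" "\<beta> < \<delta>" using ab \<beta> unfolding mem_Gamma1 by blast
    then have "c < \<delta>" using \<beta> by simp
    then obtain \<epsilon> where "(c, \<epsilon>) \<in> D" "\<delta> < \<epsilon>" using bc \<delta> unfolding mem_Gamma1 by blast
    then show ?thesis using \<delta>(2) less_trans by blast
  qed
  moreover have "a < c" using ab bc unfolding mem_Gamma1 by auto
  ultimately show "(a, c) \<in> Gamma D \<union> Omega D" unfolding mem_Gamma1 by blast
qed

lemma mem_H_grp: "X \<in> H \<longleftrightarrow> X \<in> carrier M \<and> (\<forall>\<alpha> \<beta> \<gamma>. (\<alpha>, \<beta>) \<in> D \<and> \<alpha> < \<gamma> \<and> \<gamma> < \<beta> \<longrightarrow> X \<alpha> \<gamma> = 0)"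
proof -
  have "X \<in> H \<longleftrightarrow> X \<in> carrier M \<and> msupp X \<subseteq> Gamma D"
    unfolding H_grp_def by (subst mclain_gen_eq[OF Gamma_sub trans_Gamma]) simp
  moreover have "msupp X \<subseteq> Gamma D \<longleftrightarrow> (\<forall>\<alpha> \<gamma>. \<alpha> < \<gamma> \<and> X \<alpha> \<gamma> \<noteq> 0 \<longrightarrow> (\<alpha>, \<gamma>) \<in> Gamma D)"
    by (auto simp: msupp_def)
  ultimately show ?thesis unfolding mem_Gamma by (meson linorder_not_le)
qed

lemma mem_H_iff_Hi: "g \<in> carrier M \<Longrightarrow> g \<in> H \<longleftrightarrow> (\<forall>d\<in>D. g \<in> Hi_grp d)"
  by (auto simp: mem_H_grp mem_Hi_grp)

lemma mem_I_grp: "X \<in> I \<longleftrightarrow> X \<in> carrier M \<and>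
  (\<forall>\<alpha> \<beta> \<gamma>. (\<alpha>, \<beta>) \<in> D \<and> \<alpha> < \<gamma> \<and> \<gamma> < \<beta> \<and> X \<alpha> \<gamma> \<noteq> 0 \<longrightarrow> (\<exists>\<delta>. (\<gamma>, \<delta>) \<in> D \<and> \<beta> < \<delta>))"
proof -
  have "X \<in> I \<longleftrightarrow> X \<in> carrier M \<and> msupp X \<subseteq> Gamma D \<union> Omega D"
    unfolding I_grp_def by (subst mclain_gen_eq[OF Gamma1_sub trans_Gamma1]) simp
  moreover have "msupp X \<subseteq> Gamma D \<union> Omega D \<longleftrightarrow> (\<forall>\<alpha> \<gamma>. \<alpha> < \<gamma> \<and> X \<alpha> \<gamma> \<noteq> 0 \<longrightarrow> (\<alpha>, \<gamma>) \<in> Gamma D \<union> Omega D)"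
    by (auto simp: msupp_def)
  ultimately show ?thesis unfolding mem_Gamma1 by blast
qed

lemma H_carrier: "X \<in> H \<Longrightarrow> X \<in> carrier M" and I_carrier: "X \<in> I \<Longrightarrow> X \<in> carrier M"
  by (auto simp: mem_H_grp mem_I_grp)

lemma H_sub_I: "H \<subseteq> I"
  by (auto simp: mem_H_grp mem_I_grp)

lemma H_subgroup: "subgroup H M" and I_subgroup: "subgroup I M"
  unfolding H_grp_def I_grp_def by (intro mclain_gen_subgroup Gamma_sub Gamma1_sub)+

lemma Hi_lambda: "d \<in> D \<Longrightarrow> X \<in> Hi_grp d \<Longrightarrow> lambda_hat d (f d) X = f d (X (fst d) (snd d))"
  using D_less prim by (cases d) (simp add: lambda_hat_eq)

lemma lambda_char_eq: "X \<in> H \<Longrightarrow> lambda_char D f X = (\<Prod>d\<in>D. f d (X (fst d) (snd d)))"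
  using mem_H_iff_Hi[of X] H_carrier[of X] by (simp add: lambda_char_def Hi_lambda)

lemma subgroup_character_Hi: "d \<in> D \<Longrightarrow> subgroup_character M (Hi_grp d) (lambda_hat d (f d))"
  using D_less prim by (cases d) (simp add: subgroup_character_lambda_hat)

lemma lambda_char_prod: "X \<in> H \<Longrightarrow> lambda_char D f X = (\<Prod>d\<in>D. lambda_hat d (f d) X)"
  by (simp add: lambda_char_def)

lemma subgroup_character_H: "subgroup_character M H (lambda_char D f)"
proof (intro subgroup_character.intro subgroup_character_axioms.intro mclain_group H_subgroup)
  fix X Y assume X: "X \<in> H" and Y: "Y \<in> H"
  have "lambda_hat d (f d) (X \<star> Y) = lambda_hat d (f d) X * lambda_hat d (f d) Y" if d: "d \<in> D" for d
    using subgroup_character.\<kappa>_mult[OF subgroup_character_Hi[OF d], of X Y] X Y d H_carrier mem_H_iff_Hi by blast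
  then show "lambda_char D f (X \<star> Y) = lambda_char D f X * lambda_char D f Y"
    using X Y subgroup.m_closed[OF H_subgroup X Y] by (simp add: lambda_char_prod prod.distrib)
next
  fix X assume "X \<in> H"
  then show "lambda_char D f X \<noteq> 0"
    using finite_D right_primitiveD(1)[OF prim] by (simp add: lambda_char_eq)
qed

text \<open>Replacing the row of each \<open>\<alpha>\<^sub>i\<close> in the identity by that of \<open>t\<^sub>i\<inverse>\<close> gives \<open>s\<close> with \<open>s t\<^sub>i \<in> H\<^sub>i\<close> for all \<open>i\<close>.\<close>

lemma coset_independence:
  assumes t: "t \<in> D \<rightarrow> carrier M"
  shows "\<exists>x\<in>carrier M. \<forall>d\<in>D. inv\<^bsub>M\<^esub> x \<star> t d \<in> Hi_grp d"
proof -
  define u where "u = (\<lambda>d. inv\<^bsub>M\<^esub> t d)"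
  have u: "u d \<in> carrier M" if "d \<in> D" for d using t that by (auto simp: u_def)
  define s where "s = (\<lambda>\<alpha> \<gamma>. if \<alpha> \<in> fst ` D then u (the_inv_into D fst \<alpha>) \<alpha> \<gamma> else \<one>\<^bsub>M\<^esub> \<alpha> \<gamma>)"
  have inj: "inj_on fst D" using basic by (simp add: basic_subset_def)
  have sd: "s (fst d) = u d (fst d)" if "d \<in> D" for d
    using that by (simp add: s_def the_inv_into_f_f[OF inj])
  have s_cases: "(\<exists>d\<in>D. \<alpha> = fst d \<and> s \<alpha> = u d \<alpha>) \<or> s \<alpha> = \<one>\<^bsub>M\<^esub> \<alpha>" for \<alpha>
    using sd by (auto simp: s_def fun_eq_iff)
  have s: "s \<in> carrier M"
    unfolding mclain_carrier_iff
  proof (intro conjI allI impI)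
    show "s \<alpha> \<alpha> = 1" for \<alpha> using s_cases[of \<alpha>] u by (auto simp: mclainD mclain_one)
    show "s \<alpha> \<beta> = 0" if "\<beta> < \<alpha>" for \<alpha> \<beta> using s_cases[of \<alpha>] u that by (auto simp: mclainD mclain_one)
    have "msupp s \<subseteq> (\<Union>d\<in>D. msupp (u d))"
    proof
      fix p assume "p \<in> msupp s"
      then obtain \<alpha> \<gamma> where p: "p = (\<alpha>, \<gamma>)" "\<alpha> < \<gamma>" "s \<alpha> \<gamma> \<noteq> 0" by (auto simp: msupp_def)
      then show "p \<in> (\<Union>d\<in>D. msupp (u d))" using s_cases[of \<alpha>] by (auto simp: msupp_def mclain_one split: if_splits)
    qed
    then show "finite (msupp s)" by (rule finite_subset) (use finite_D u in \<open>auto simp: mclainD\<close>)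
  qed
  have "s \<star> t d \<in> Hi_grp d" if d: "d \<in> D" for d
  proof -
    obtain \<alpha> \<beta> where ab: "d = (\<alpha>, \<beta>)" by (cases d)
    have td: "t d \<in> carrier M" using t d by blast
    have "u d \<star> t d = \<one>\<^bsub>M\<^esub>" using td by (simp add: u_def)
    \<comment> \<open>A row of a product depends only on the same row of the left factor, so
      \<open>s\<close> may be prescribed row by row.\<close>
    moreover have "(s \<star> t d) \<alpha> \<gamma> = (u d \<star> t d) \<alpha> \<gamma>" for \<gamma>
      using sd[OF d] by (simp add: mclain_def ab)
    ultimately have "(s \<star> t d) \<alpha> \<gamma> = \<one>\<^bsub>M\<^esub> \<alpha> \<gamma>" for \<gamma> by simp
    moreover have "s \<star> t d \<in> carrier M" by (rule mclain_mult_closed[OF s td])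
    ultimately show ?thesis unfolding ab mem_Hi_grp by (auto simp: mclain_one)
  qed
  then show ?thesis using s by (intro bexI[of _ "inv\<^bsub>M\<^esub> s"]) auto
qed

lemma basic_fun_model:
  obtains \<Psi> where "fun_model M (carrier M) (basic_module D f) (indsp M H (lambda_char D f)) \<Psi>"
proof -
  have "\<exists>\<Psi>. fun_model M (carrier M) (elementary_module d (f d)) (indsp M (Hi_grp d) (lambda_hat d (f d))) \<Psi>"
    if d: "d \<in> D" for d
  proof -
    obtain \<alpha> \<beta> where ab: "d = (\<alpha>, \<beta>)" by (cases d)
    show ?thesis using elementary_fun_model[OF D_less prim, of \<alpha> \<beta> d] d unfolding ab by blast
  qed
  then obtain \<Psi> where "\<And>d. d \<in> D \<Longrightarrow>
      fun_model M (carrier M) (elementary_module d (f d)) (indsp M (Hi_grp d) (lambda_hat d (f d))) (\<Psi> d)"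
    by metis
  from tensor_fun_model[OF mclain_group finite_D subgroup_character_Hi this subgroup_character_H mem_H_iff_Hi
      lambda_char_prod coset_independence] obtain \<Psi>' where
    "fun_model M (carrier M) (tensor_product D (\<lambda>d. elementary_module d (f d))) (indsp M H (lambda_char D f)) \<Psi>'"
    by blast
  then show thesis by (intro that) (simp add: basic_module_def)
qed

text \<open>At the positions where \<open>H\<close> requires zeros, the product of the inverse of
  \<open>X\<close> with \<open>Y\<close> has the same entries as that with \<open>X\<close>, which
  is the identity. Thus the entries at \<open>Omega D\<close> determine the coset in
  \<open>I\<close>.\<close>

lemma inv_mult_in_H:
  assumes X: "X \<in> I" and Y: "Y \<in> I" and eq: "\<And>\<alpha> \<gamma>. (\<alpha>, \<gamma>) \<in> Omega D \<Longrightarrow> X \<alpha> \<gamma> = Y \<alpha> \<gamma>"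
  shows "inv\<^bsub>M\<^esub> X \<star> Y \<in> H"
proof -
  define Z where "Z = inv\<^bsub>M\<^esub> X"
  have Z: "Z \<in> I" using subgroup.m_inv_closed[OF I_subgroup X] by (simp add: Z_def)
  note c = I_carrier[OF X] I_carrier[OF Y] I_carrier[OF Z]
  have "(Z \<star> Y) \<alpha> \<gamma> = 0" if d: "(\<alpha>, \<beta>) \<in> D" "\<alpha> < \<gamma>" "\<gamma> < \<beta>" for \<alpha> \<beta> \<gamma>
  proof -
    let ?A = "insert \<alpha> (mindex Z)"
    have fin: "finite ?A" using c by (simp add: finite_mindex)
    \<comment> \<open>A difference between \<open>X\<close> and \<open>Y\<close> can only sit at a
      position in \<open>Gamma D\<close>. But \<open>Z \<alpha> \<epsilon> \<noteq> 0\<close> with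
      \<open>\<epsilon> \<noteq> \<alpha>\<close> forces a root of \<open>D\<close> at
      \<open>\<epsilon>\<close> that ends beyond \<open>\<beta>\<close>, which excludes
      \<open>(\<epsilon>, \<gamma>)\<close> from \<open>Gamma D\<close>.\<close>
    have zero: "Z \<alpha> \<epsilon> * Y \<epsilon> \<gamma> = Z \<alpha> \<epsilon> * X \<epsilon> \<gamma>" for \<epsilon>
    proof (rule ccontr)
      assume ne: "Z \<alpha> \<epsilon> * Y \<epsilon> \<gamma> \<noteq> Z \<alpha> \<epsilon> * X \<epsilon> \<gamma>"
      then have nz: "Z \<alpha> \<epsilon> \<noteq> 0" "Y \<epsilon> \<gamma> \<noteq> X \<epsilon> \<gamma>" by auto
      have "\<epsilon> \<noteq> \<gamma>" using nz(2) mclainD(1) c by metis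
      moreover have "\<not> \<gamma> < \<epsilon>" using nz(2) mclainD(2) c by metis
      ultimately have lt: "\<epsilon> < \<gamma>" by simp
      have nO: "(\<epsilon>, \<gamma>) \<notin> Omega D" using nz(2) eq by metis
      have "X \<epsilon> \<gamma> \<noteq> 0 \<or> Y \<epsilon> \<gamma> \<noteq> 0" using nz(2) by auto
      then have "(\<epsilon>, \<gamma>) \<in> Gamma D \<union> Omega D"
        using X Y lt unfolding mem_Gamma1 mem_I_grp by blast
      then have G: "(\<epsilon>, \<gamma>) \<in> Gamma D" using nO by blast
      show False
      proof (cases "\<epsilon> = \<alpha>")
        case True
        then show False using G d by (auto simp: mem_Gamma)
      next
        case False
        then have "\<alpha> < \<epsilon>" using mclainD(4)[OF c(3) nz(1)] by simp
        moreover have "\<epsilon> < \<beta>" using lt d by simp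
        ultimately obtain \<delta> where "(\<epsilon>, \<delta>) \<in> D" "\<beta> < \<delta>" using Z d nz(1) unfolding mem_I_grp by blast
        then show False using G d by (auto simp: mem_Gamma)
      qed
    qed
    have "(Z \<star> Y) \<alpha> \<gamma> = (Z \<star> X) \<alpha> \<gamma>"
      using mclain_mult_left[OF c(3) fin, of \<alpha> Y \<gamma>] mclain_mult_left[OF c(3) fin, of \<alpha> X \<gamma>] by (simp add: zero subset_insertI)
    also have "Z \<star> X = \<one>\<^bsub>M\<^esub>" using c by (simp add: Z_def)
    finally show ?thesis using d by (simp add: mclain_one)
  qed
  moreover have "Z \<star> Y \<in> carrier M" by (rule mclain_mult_closed[OF c(3,2)])
  ultimately show ?thesis unfolding mem_H_grp Z_def[symmetric] by blast
qed

text \<open>With \<open>s\<close> the inverse of \<open>x\<close>, the conjugate is the inverse of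
  \<open>s\<close> times \<open>h s\<close>. Row \<open>\<alpha>\<close> of \<open>h\<close> is
  trivial before \<open>\<beta>\<close>, so \<open>h s\<close> and \<open>s\<close> agree at
  \<open>Omega D\<close> and \<open>inv_mult_in_H\<close> applies.\<close>

lemma H_normal: "H \<lhd> mclain_sub I"
proof (rule group.normal_invI)
  show "group (mclain_sub I)" by (rule mclain.subgroup_imp_group[OF I_subgroup])
  show "subgroup H (mclain_sub I)"
    by (rule mclain.subgroup_incl[OF H_subgroup I_subgroup H_sub_I])
  fix x h assume "x \<in> carrier (mclain_sub I)" and h: "h \<in> H"
  then have x: "x \<in> I" by simp
  define s where "s = inv\<^bsub>M\<^esub> x"
  have s: "s \<in> I" using subgroup.m_inv_closed[OF I_subgroup x] by (simp add: s_def)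
  note c = H_carrier[OF h] I_carrier[OF s] I_carrier[OF x]
  have hs: "h \<star> s \<in> I" using subgroup.m_closed[OF I_subgroup] h s H_sub_I by blast
  have "s \<alpha> \<gamma> = (h \<star> s) \<alpha> \<gamma>" if O: "(\<alpha>, \<gamma>) \<in> Omega D" for \<alpha> \<gamma>
  proof -
    obtain \<beta> where \<beta>: "(\<alpha>, \<beta>) \<in> D" "\<gamma> < \<beta>" using O by (auto simp: mem_Omega)
    have "(h \<star> s) \<alpha> \<gamma> = (\<Sum>\<epsilon>\<in>{\<alpha>}. h \<alpha> \<epsilon> * s \<epsilon> \<gamma>)"
    proof (rule mclain_mult)
      fix \<epsilon> assume nz: "h \<alpha> \<epsilon> \<noteq> 0" "s \<epsilon> \<gamma> \<noteq> 0"
      then have "\<alpha> \<le> \<epsilon>" "\<epsilon> \<le> \<gamma>" using mclainD(4) c by blast+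
      moreover have "\<not> (\<alpha> < \<epsilon> \<and> \<epsilon> < \<beta>)" using h \<beta>(1) nz(1) unfolding mem_H_grp by blast
      ultimately show "\<epsilon> \<in> {\<alpha>}" using \<beta>(2) by auto
    qed simp
    then show ?thesis using c by (simp add: mclainD)
  qed
  then have "inv\<^bsub>M\<^esub> s \<star> (h \<star> s) \<in> H" by (rule inv_mult_in_H[OF s hs])
  then have "x \<star> h \<star> inv\<^bsub>M\<^esub> x \<in> H" using c by (simp add: s_def mclain.m_assoc)
  then show "x \<otimes>\<^bsub>mclain_sub I\<^esub> h \<otimes>\<^bsub>mclain_sub I\<^esub> inv\<^bsub>mclain_sub I\<^esub> x \<in> H"
    using mclain.m_inv_consistent[OF I_subgroup x] by simp
qed

lemma finite_Omega: "finite (Omega D)"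
  by (rule finite_subset[of _ "fst ` D \<times> fst ` D"]) (use finite_D in \<open>force simp: Omega_def\<close>)+

text \<open>One representative is chosen for each of the finitely many assignments of ring elements
  to \<open>Omega D\<close> that occur in \<open>I\<close>.\<close>

lemma finite_index:
  assumes "finite (UNIV :: 'r set)"
  obtains A where "finite A" "A \<subseteq> I" "\<And>x. x \<in> I \<Longrightarrow> \<exists>a\<in>A. inv\<^bsub>M\<^esub> a \<star> x \<in> H"
proof -
  define \<rho> where "\<rho> = (\<lambda>X :: 'l \<Rightarrow> 'l \<Rightarrow> 'r. \<lambda>p\<in>Omega D. X (fst p) (snd p))"
  define a where "a = (\<lambda>v. SOME x. x \<in> I \<and> \<rho> x = v)"
  have a: "a (\<rho> x) \<in> I \<and> \<rho> (a (\<rho> x)) = \<rho> x" if "x \<in> I" for x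
    unfolding a_def by (rule someI[of _ x]) (use that in auto)
  have "finite (Omega D \<rightarrow>\<^sub>E (UNIV :: 'r set))" using finite_Omega assms by (intro finite_PiE) auto
  then have "finite (\<rho> ` I)" by (rule rev_finite_subset) (auto simp: \<rho>_def)
  moreover have "\<exists>b\<in>a ` \<rho> ` I. inv\<^bsub>M\<^esub> b \<star> x \<in> H" if x: "x \<in> I" for x
  proof (intro bexI[of _ "a (\<rho> x)"] inv_mult_in_H x)
    show "a (\<rho> x) \<in> I" using a[OF x] by blast
    fix \<alpha> \<gamma> assume "(\<alpha>, \<gamma>) \<in> Omega D"
    then have app: "\<rho> X (\<alpha>, \<gamma>) = X \<alpha> \<gamma>" for X by (simp add: \<rho>_def)
    have "\<rho> (a (\<rho> x)) = \<rho> x" using a[OF x] by blast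
    then show "a (\<rho> x) \<alpha> \<gamma> = x \<alpha> \<gamma>" using app by metis
  qed (use x in blast)
  ultimately show thesis using a by (intro that[of "a ` \<rho> ` I"]) auto
qed

section \<open>Extending the character to \<open>I\<close>, and separating the induced
  modules\<close>

definition lambda_ext :: "('l \<Rightarrow> 'l \<Rightarrow> 'r) \<Rightarrow> 'f" where
  "lambda_ext X = (\<Prod>d\<in>D. f d (X (fst d) (snd d)))"

lemma lambda_ext_H: "X \<in> H \<Longrightarrow> lambda_ext X = lambda_char D f X"
  by (simp add: lambda_ext_def lambda_char_eq)

text \<open>If a middle index \<open>\<gamma>\<close> contributed to the entry at
  \<open>(\<alpha>, \<beta>)\<close> in \<open>D\<close>, membership of \<open>X\<close> in
  \<open>I\<close> would give \<open>(\<gamma>, \<delta>)\<close> in \<open>D\<close> with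
  \<open>\<beta> < \<delta>\<close>, and that of \<open>Y\<close> would give
  \<open>(\<beta>, \<epsilon>)\<close> with \<open>\<delta> < \<epsilon>\<close>: a special triple.
  So these entries add.\<close>

lemma subgroup_character_lambda_ext:
  assumes triple: "\<not> special_triple D"
  shows "subgroup_character M I lambda_ext"
proof (intro subgroup_character.intro subgroup_character_axioms.intro mclain_group I_subgroup)
  fix X Y assume X: "X \<in> I" and Y: "Y \<in> I"
  have "(X \<star> Y) \<alpha> \<beta> = Y \<alpha> \<beta> + X \<alpha> \<beta>" if d: "(\<alpha>, \<beta>) \<in> D" for \<alpha> \<beta>
  proof (intro mclain_mult_entry I_carrier X Y D_less d)
    fix \<gamma> assume g: "\<alpha> < \<gamma>" "\<gamma> < \<beta>"
    show "X \<alpha> \<gamma> = 0 \<or> Y \<gamma> \<beta> = 0"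
    proof (rule ccontr)
      assume "\<not> ?thesis"
      then have nz: "X \<alpha> \<gamma> \<noteq> 0" "Y \<gamma> \<beta> \<noteq> 0" by auto
      obtain \<delta> where \<delta>: "(\<gamma>, \<delta>) \<in> D" "\<beta> < \<delta>" using X d g nz(1) unfolding mem_I_grp by blast
      obtain \<epsilon> where "(\<beta>, \<epsilon>) \<in> D" "\<delta> < \<epsilon>" using Y \<delta> g nz(2) unfolding mem_I_grp by blast
      then show False using triple d \<delta> g unfolding special_triple_def by blast
    qed
  qed
  then have "f d ((X \<star> Y) (fst d) (snd d)) = f d (X (fst d) (snd d)) * f d (Y (fst d) (snd d))" if "d \<in> D" for d
    using that right_primitiveD(2)[OF prim[OF that]] by (cases d) (simp add: mult.commute)
  then show "lambda_ext (X \<star> Y) = lambda_ext X * lambda_ext Y"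
    by (simp add: lambda_ext_def prod.distrib)
qed (use finite_D right_primitiveD(1)[OF prim] in \<open>simp add: lambda_ext_def\<close>)

text \<open>A position in \<open>Omega D\<close> lies strictly before the only root of
  \<open>D\<close> in its row, so it is not in \<open>D\<close>. Thus the extension is trivial on
  these generators and \<open>\<chi>\<close> alone prescribes the values there.\<close>

lemma lambda_ext_Omega:
  assumes "d \<in> Omega D"
  shows "lambda_ext (root_elem d r) = 1"
proof -
  have "f d' (root_elem d r (fst d') (snd d')) = 1" if d': "d' \<in> D" for d'
  proof -
    obtain \<alpha> \<beta> where ab: "d' = (\<alpha>, \<beta>)" by (cases d')
    have "d \<noteq> (\<alpha>, \<beta>)"
    proof
      assume "d = (\<alpha>, \<beta>)"
      then obtain \<beta>' where "(\<alpha>, \<beta>') \<in> D" "\<beta> < \<beta>'" using assms by (auto simp: mem_Omega)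
      then show False using D_fst[of \<alpha> \<beta> \<beta>'] d' ab by simp
    qed
    then have "root_elem d r \<alpha> \<beta> = 0" using D_less d' ab by (intro root_elem_other) auto
    then show ?thesis using right_primitiveD(3)[OF prim[OF d']] by (simp add: ab)
  qed
  then show ?thesis by (simp add: lambda_ext_def)
qed

text \<open>
  With \<open>z = r e\<^bsub>a\<beta>\<^esub>\<close> one has \<open>(1 + tz) t = t (1 + zt)\<close>. If \<open>t\<close> has a forbidden entry at \<open>(\<alpha>, a)\<close> and
  \<open>(\<alpha>, \<beta>) \<in> D\<close> has \<open>\<beta>\<close> maximal for this, then both factors lie in \<open>H\<close>, but \<open>\<lambda>\<close> separates them.
\<close>

lemma no_intertwiner:
  assumes t: "t \<in> carrier M" "t \<notin> I"
  obtains h h' where "h \<in> H" "h' \<in> H" "h \<star> t = t \<star> h'" "lambda_char D f h \<noteq> lambda_char D f h'"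
proof -
  define bad where "bad = (\<lambda>\<alpha> \<beta> a. (\<alpha>, \<beta>) \<in> D \<and> \<alpha> < a \<and> a < \<beta> \<and> t \<alpha> a \<noteq> 0 \<and> \<not> (\<exists>\<delta>. (a, \<delta>) \<in> D \<and> \<beta> < \<delta>))"
  define S where "S = {\<beta>. \<exists>\<alpha> a. bad \<alpha> \<beta> a}"
  have "S \<subseteq> snd ` D" by (force simp: S_def bad_def)
  then have fin: "finite S" using finite_D by (meson finite_surj)
  have "S \<noteq> {}" using t unfolding S_def bad_def mem_I_grp by blast
  then have "Max S \<in> S" using fin by (rule Max_in[rotated])
  then obtain \<alpha> \<beta> a where b: "bad \<alpha> \<beta> a" and \<beta>: "\<beta> = Max S" by (auto simp: S_def)
  have max: "\<beta>' \<le> \<beta>" if "bad \<alpha>' \<beta>' a'" for \<alpha>' \<beta>' a'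
    unfolding \<beta> using fin that by (intro Max_ge) (auto simp: S_def)
  have d: "(\<alpha>, \<beta>) \<in> D" "\<alpha> < a" "a < \<beta>" "t \<alpha> a \<noteq> 0" "\<And>\<delta>. (a, \<delta>) \<in> D \<Longrightarrow> \<delta> \<le> \<beta>"
    using b by (auto simp: bad_def not_less)
  note tD = mclainD[OF t(1)]
  have tba: "t \<beta> a = 0" using tD(2) d by blast
  \<comment> \<open>The right ideal generated by the nonzero entry is nonzero, so right primitivity
    keeps it out of the kernel.\<close>
  obtain r where r: "f (\<alpha>, \<beta>) (t \<alpha> a * r) \<noteq> 1"
  proof (rule ccontr)
    assume nr: "\<not> thesis"
    let ?J = "{t \<alpha> a * r |r. True}"
    have "right_ideal ?J"
      unfolding right_ideal_def
      by (auto intro: exI[of _ 0] exI[of _ "_ - _"] simp: mult.assoc simp flip: right_diff_distrib)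
    moreover have "?J \<subseteq> {r. f (\<alpha>, \<beta>) r = 1}" using nr that by blast
    ultimately have "?J = {0}" using prim[OF d(1)] unfolding right_primitive_def by blast
    moreover have "t \<alpha> a * 1 \<in> ?J" by blast
    ultimately show False using d(4) by auto
  qed
  \<comment> \<open>These are \<open>1 + tz\<close> and \<open>1 + zt\<close>: the former carries a
    multiple of column \<open>a\<close> of \<open>t\<close> in column \<open>\<beta>\<close>, the
    latter a multiple of row \<open>\<beta>\<close> of \<open>t\<close> in row
    \<open>a\<close>.\<close>
  define h where "h = (\<lambda>\<gamma> \<delta>. if \<gamma> = \<delta> then 1 else if \<delta> = \<beta> then t \<gamma> a * r else 0)"
  define h' where "h' = (\<lambda>\<gamma> \<delta>. if \<gamma> = \<delta> then 1 else if \<gamma> = a then r * t \<beta> \<delta> else 0)"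
  have h: "h \<in> carrier M"
    unfolding mclain_carrier_iff
  proof (intro conjI allI impI)
    show "h \<gamma> \<delta> = 0" if "\<delta> < \<gamma>" for \<gamma> \<delta>
    proof (cases "\<delta> = \<beta>")
      case True
      then have "t \<gamma> a = 0" using that d by (intro tD(2)) simp
      then show ?thesis using that by (auto simp: h_def)
    qed (use that in \<open>auto simp: h_def\<close>)
    have "msupp h \<subseteq> insert a (mindex t) \<times> {\<beta>}"
    proof
      fix p assume "p \<in> msupp h"
      then obtain \<gamma> where p: "p = (\<gamma>, \<beta>)" "t \<gamma> a * r \<noteq> 0" by (auto simp: msupp_def h_def split: if_splits)
      have "t \<gamma> a \<noteq> 0" using p(2) by auto
      then show "p \<in> insert a (mindex t) \<times> {\<beta>}" using p(1) mindex_left(2)[OF t(1), of \<gamma> a] by simp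
    qed
    then show "finite (msupp h)" by (rule finite_subset) (simp add: finite_mindex t)
  qed (simp add: h_def)
  have h': "h' \<in> carrier M"
    unfolding mclain_carrier_iff
  proof (intro conjI allI impI)
    show "h' \<gamma> \<delta> = 0" if "\<delta> < \<gamma>" for \<gamma> \<delta>
    proof (cases "\<gamma> = a")
      case True
      then have "t \<beta> \<delta> = 0" using that d by (intro tD(2)) simp
      then show ?thesis using that by (auto simp: h'_def)
    qed (use that in \<open>auto simp: h'_def\<close>)
    have "msupp h' \<subseteq> {a} \<times> insert \<beta> (mindex t)"
    proof
      fix p assume "p \<in> msupp h'"
      then obtain \<gamma> where p: "p = (a, \<gamma>)" "r * t \<beta> \<gamma> \<noteq> 0" by (auto simp: msupp_def h'_def split: if_splits)
      have "t \<beta> \<gamma> \<noteq> 0" using p(2) by auto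
      then show "p \<in> {a} \<times> insert \<beta> (mindex t)" using p(1) mindex_left(1)[OF t(1), of \<beta> \<gamma>] by simp
    qed
    then show "finite (msupp h')" by (rule finite_subset) (simp add: finite_mindex t)
  qed (simp add: h'_def)
  have hH: "h \<in> H"
    unfolding mem_H_grp
  proof (intro conjI h allI impI, elim conjE)
    fix \<alpha>' \<beta>' \<gamma> assume e: "(\<alpha>', \<beta>') \<in> D" "\<alpha>' < \<gamma>" "\<gamma> < \<beta>'"
    \<comment> \<open>A nonzero entry here, with \<open>\<beta>'\<close> beyond
      \<open>\<beta>\<close>, would be bad for a later end than the maximal one, unless
      \<open>a\<close> starts a root of \<open>D\<close> that ends even later; the choice of
      \<open>a\<close> rules that out.\<close>
    have "t \<alpha>' a = 0" if \<gamma>: "\<gamma> = \<beta>"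
    proof (rule ccontr)
      assume nz: "t \<alpha>' a \<noteq> 0"
      have "\<alpha>' \<noteq> a" using d(5)[of \<beta>'] e \<gamma> by auto
      then have "\<alpha>' < a" using tD(4)[OF nz] by simp
      moreover have "\<not> bad \<alpha>' \<beta>' a" using max e \<gamma> by force
      ultimately obtain \<delta> where "(a, \<delta>) \<in> D" "\<beta>' < \<delta>" using e \<gamma> nz d(3) unfolding bad_def by force
      then show False using d(5)[of \<delta>] e \<gamma> by simp
    qed
    then show "h \<alpha>' \<gamma> = 0" using e by (auto simp: h_def)
  qed
  have h'H: "h' \<in> H"
    unfolding mem_H_grp
  proof (intro conjI h' allI impI, elim conjE)
    fix \<alpha>' \<beta>' \<gamma> assume e: "(\<alpha>', \<beta>') \<in> D" "\<alpha>' < \<gamma>" "\<gamma> < \<beta>'"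
    have "t \<beta> \<gamma> = 0" if "\<alpha>' = a"
      using d(5)[of \<beta>'] e that by (intro tD(2)) simp
    then show "h' \<alpha>' \<gamma> = 0" using e by (auto simp: h'_def)
  qed
  have comm: "h \<star> t = t \<star> h'"
  proof (intro ext)
    fix \<gamma> \<delta>
    have "(h \<star> t) \<gamma> \<delta> = (\<Sum>\<epsilon>\<in>{\<gamma>, \<beta>}. h \<gamma> \<epsilon> * t \<epsilon> \<delta>)"
      by (rule mclain_mult) (auto simp: h_def split: if_splits)
    also have "\<dots> = t \<gamma> \<delta> + t \<gamma> a * r * t \<beta> \<delta>"
      using tba by (cases "\<gamma> = \<beta>") (auto simp: h_def)
    also have "\<dots> = (\<Sum>\<epsilon>\<in>{\<delta>, a}. t \<gamma> \<epsilon> * h' \<epsilon> \<delta>)"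
      using tba by (cases "\<delta> = a") (auto simp: h'_def mult.assoc)
    also have "\<dots> = (t \<star> h') \<gamma> \<delta>"
      by (rule mclain_mult[symmetric]) (auto simp: h'_def split: if_splits)
    finally show "(h \<star> t) \<gamma> \<delta> = (t \<star> h') \<gamma> \<delta>" .
  qed
  have "lambda_char D f h = (\<Prod>d\<in>D. if d = (\<alpha>, \<beta>) then f (\<alpha>, \<beta>) (t \<alpha> a * r) else 1)"
    unfolding lambda_char_eq[OF hH]
  proof (rule prod.cong)
    fix e assume e: "e \<in> D"
    obtain \<alpha>' \<beta>' where ab: "e = (\<alpha>', \<beta>')" by (cases e)
    \<comment> \<open>Off the diagonal \<open>h\<close> is confined to column
      \<open>\<beta>\<close>, and ends in \<open>D\<close> are distinct, so
      \<open>(\<alpha>, \<beta>)\<close> is the only root of \<open>D\<close> that it meets.\<close>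
    have "\<beta>' = \<beta> \<Longrightarrow> \<alpha>' = \<alpha>" using D_snd e d(1) unfolding ab by blast
    then have "h \<alpha>' \<beta>' = (if e = (\<alpha>, \<beta>) then t \<alpha> a * r else 0)"
      using D_less[of \<alpha>' \<beta>'] e d unfolding ab by (auto simp: h_def)
    then show "f e (h (fst e) (snd e)) = (if e = (\<alpha>, \<beta>) then f (\<alpha>, \<beta>) (t \<alpha> a * r) else 1)"
      using right_primitiveD(3)[OF prim[OF e]] by (simp add: ab)
  qed simp
  then have lh: "lambda_char D f h = f (\<alpha>, \<beta>) (t \<alpha> a * r)" using finite_D d(1) by simp
  have "f e (h' (fst e) (snd e)) = 1" if e: "e \<in> D" for e
  proof -
    obtain \<alpha>' \<beta>' where ab: "e = (\<alpha>', \<beta>')" by (cases e)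
    have lt: "\<alpha>' < \<beta>'" using D_less e ab by blast
    \<comment> \<open>A root of \<open>D\<close> starting at \<open>a\<close> ends strictly before
      \<open>\<beta>\<close>, as the end \<open>\<beta>\<close> belongs to \<open>\<alpha>\<close>;
      the entry of \<open>t\<close> lies below the diagonal.\<close>
    have "t \<beta> \<beta>' = 0" if "\<alpha>' = a"
    proof -
      have "\<beta>' \<noteq> \<beta>" using D_snd[of \<alpha>' \<beta> \<alpha>] e d that unfolding ab by auto
      then show ?thesis using d(5)[of \<beta>'] e ab that by (intro tD(2)) auto
    qed
    then have "h' \<alpha>' \<beta>' = 0" using lt by (auto simp: h'_def)
    then show ?thesis using right_primitiveD(3)[OF prim[OF e]] by (simp add: ab)
  qed
  then have "lambda_char D f h' = 1" by (simp add: lambda_char_eq[OF h'H])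
  then show thesis using that[OF hH h'H comm] lh r by simp
qed

text \<open>The generator of the first module is an eigenvector of \<open>I\<close> for
  \<open>\<kappa>\<close>. Its image \<open>\<phi>\<close> vanishes off \<open>I\<close>, so it is
  determined by its value at the unit, where it is nonzero; the transformation law for
  \<open>\<nu>\<close> and the eigenvalue \<open>\<kappa>\<close> then have to agree.\<close>

lemma ind_not_iso:
  assumes \<kappa>: "subgroup_character M I \<kappa>" and \<nu>: "subgroup_character M I \<nu>"
    and \<kappa>H: "\<And>h. h \<in> H \<Longrightarrow> \<kappa> h = lambda_char D f h" and \<nu>H: "\<And>h. h \<in> H \<Longrightarrow> \<nu> h = lambda_char D f h"
    and iso: "gmodule_iso M (ind M I (char_module \<kappa>)) (ind M I (char_module \<nu>))"
    and s: "s \<in> I"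
  shows "\<kappa> s = \<nu> s"
proof -
  interpret k: subgroup_character M I \<kappa> by fact
  interpret n: subgroup_character M I \<nu> by fact
  let ?V = "ind M I (char_module \<kappa>)" and ?W = "ind M I (char_module \<nu>)"
  obtain \<Psi> where m: "fun_model M (carrier M) ?V (indsp M I \<kappa>) \<Psi>" by (rule k.ind_fun_model_full)
  obtain \<Psi>' where m': "fun_model M (carrier M) ?W (indsp M I \<nu>) \<Psi>'" by (rule n.ind_fun_model_full)
  note mD = fun_modelD[OF m] and mD' = fun_modelD[OF m']
  obtain \<theta> where \<theta>: "bij_betw \<theta> (carrier ?V) (carrier ?W)"
    "\<And>c v. v \<in> carrier ?V \<Longrightarrow> \<theta> (c \<odot>\<^bsub>?V\<^esub> v) = c \<odot>\<^bsub>?W\<^esub> \<theta> v"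
    "\<And>g v. g \<in> carrier M \<Longrightarrow> v \<in> carrier ?V \<Longrightarrow> \<theta> (act ?V g v) = act ?W g (\<theta> v)"
    using iso unfolding gmodule_iso_def by blast
  let ?e = "ebase M I \<kappa> \<one>\<^bsub>M\<^esub>"
  have "?e \<in> \<Psi> ` carrier ?V"
    using mD(1) k.ebase_in_indsp[OF mclain.one_closed] by (simp add: bij_betw_def)
  then obtain v where v: "v \<in> carrier ?V" "\<Psi> v = ?e" by auto
  define \<phi> where "\<phi> = \<Psi>' (\<theta> v)"
  have \<theta>v: "\<theta> v \<in> carrier ?W" using \<theta>(1) v(1) by (rule bij_betwE[THEN bspec])
  have eig: "ltrans M g \<phi> = (\<lambda>y. \<kappa> g * \<phi> y)" if g: "g \<in> I" for g
  proof -
    have gc: "g \<in> carrier M" using g I_carrier by blast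
    have "act ?V g v = \<kappa> g \<odot>\<^bsub>?V\<^esub> v"
    proof (rule mD(11))
      have "ebase M I \<kappa> (\<one>\<^bsub>M\<^esub> \<star> g) = (\<lambda>y. \<kappa> g * ?e y)" by (rule k.ebase_mult) (use g in auto)
      then show "\<Psi> (act ?V g v) = \<Psi> (\<kappa> g \<odot>\<^bsub>?V\<^esub> v)"
        using gc by (simp add: mD(7)[OF v(1)] mD(9)[OF gc v(1)] v(2) k.ltrans_ebase)
    qed (use gc v mD in auto)
    then have "act ?W g (\<theta> v) = \<kappa> g \<odot>\<^bsub>?W\<^esub> \<theta> v" using \<theta>(2,3) gc v(1) by metis
    then show ?thesis using mD'(7,9) \<theta>v gc unfolding \<phi>_def by metis
  qed
  have \<phi>Y: "\<phi> \<in> indsp M I \<nu>" using mD'(10)[OF \<theta>v] by (simp add: \<phi>_def)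
  then have \<phi>m: "\<phi> (y \<star> k) * \<nu> k = \<phi> y" if "y \<in> carrier M" "k \<in> I" for y k
    using that by (simp add: indsp_def)
  have van: "\<phi> y = 0" if y: "y \<notin> I" for y
  proof (cases "y \<in> carrier M")
    case True
    obtain h h' where h: "h \<in> H" "h' \<in> H" "h \<star> y = y \<star> h'" "lambda_char D f h \<noteq> lambda_char D f h'"
      by (rule no_intertwiner[OF True y])
    have hc: "h \<in> carrier M" "h' \<in> carrier M" using h H_carrier by auto
    have hI: "h \<in> I" "h' \<in> I" using h H_sub_I by auto
    have "\<phi> y = ltrans M h \<phi> (h \<star> y)"
      using hc True by (simp add: ltrans_def flip: mclain.m_assoc)
    also have "\<dots> = \<kappa> h * \<phi> (y \<star> h')" using eig[OF hI(1)] h(3) by simp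
    \<comment> \<open>Translation by \<open>h\<close> on the left and by \<open>h'\<close> on the
      right reach the same point but multiply by different values of the character.\<close>
    finally have "\<phi> y * \<nu> h' = \<kappa> h * \<phi> y" using \<phi>m[OF True hI(2)] by (simp add: mult.assoc)
    then have "\<phi> y * (lambda_char D f h' - lambda_char D f h) = 0"
      using h \<kappa>H \<nu>H by (simp add: algebra_simps)
    then show ?thesis using h(4) by simp
  next
    case False
    then show ?thesis using \<phi>Y by (simp add: indsp_def)
  qed
  have "\<phi> \<one>\<^bsub>M\<^esub> \<noteq> 0"
  proof
    assume "\<phi> \<one>\<^bsub>M\<^esub> = 0"
    then have "\<phi> y = 0" if "y \<in> I" for y
      using \<phi>m[of "\<one>\<^bsub>M\<^esub>" y] that n.\<kappa>_nz[OF that] I_carrier[OF that] by simp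
    then have "\<phi> = 0" using van by (auto simp: fun_eq_iff)
    then have "\<theta> v = \<zero>\<^bsub>?W\<^esub>" using mD'(11)[OF \<theta>v mD'(2)] mD'(3) by (simp add: \<phi>_def)
    \<comment> \<open>An isomorphism is only known to respect addition and scalars; zero is reached
      as 0 times a vector.\<close>
    moreover have "\<theta> \<zero>\<^bsub>?V\<^esub> = \<zero>\<^bsub>?W\<^esub>"
    proof -
      have z: "0 \<odot>\<^bsub>?V\<^esub> \<zero>\<^bsub>?V\<^esub> = \<zero>\<^bsub>?V\<^esub>" by (rule mD(11)) (use mD(2,3,6,7) in \<open>auto simp: fun_eq_iff\<close>)
      have \<theta>z: "\<theta> \<zero>\<^bsub>?V\<^esub> \<in> carrier ?W" using \<theta>(1) mD(2) by (rule bij_betwE[THEN bspec])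
      have "0 \<odot>\<^bsub>?W\<^esub> \<theta> \<zero>\<^bsub>?V\<^esub> = \<zero>\<^bsub>?W\<^esub>"
        by (rule mD'(11)) (use mD'(2,3,6,7) \<theta>z in \<open>auto simp: fun_eq_iff\<close>)
      then show ?thesis using \<theta>(2)[OF mD(2), of 0] z by simp
    qed
    ultimately have "v = \<zero>\<^bsub>?V\<^esub>" using \<theta>(1) v(1) mD(2) unfolding bij_betw_def inj_on_def by metis
    then have "?e = 0" using v(2) mD(3) by simp
    then show False using k.ebase_self[of "\<one>\<^bsub>M\<^esub>"] by simp
  qed
  moreover have "\<kappa> s * \<phi> \<one>\<^bsub>M\<^esub> = \<nu> s * \<phi> \<one>\<^bsub>M\<^esub>"
  proof -
    have sc: "s \<in> carrier M" "inv\<^bsub>M\<^esub> s \<in> I" using s I_carrier subgroup.m_inv_closed[OF I_subgroup] by auto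
    have "\<kappa> s * \<phi> \<one>\<^bsub>M\<^esub> = \<phi> (inv\<^bsub>M\<^esub> s)" using fun_cong[OF eig[OF s], of "\<one>\<^bsub>M\<^esub>"] sc by (simp add: ltrans_def)
    also have "\<dots> = \<nu> s * (\<phi> (inv\<^bsub>M\<^esub> s) * \<nu> (inv\<^bsub>M\<^esub> s))" using n.\<kappa>_inv[OF s] by (simp add: ac_simps)
    also have "\<phi> (inv\<^bsub>M\<^esub> s) * \<nu> (inv\<^bsub>M\<^esub> s) = \<phi> \<one>\<^bsub>M\<^esub>" using \<phi>m[of "\<one>\<^bsub>M\<^esub>" "inv\<^bsub>M\<^esub> s"] sc by simp
    finally show ?thesis .
  qed
  ultimately show ?thesis by simp
qed

end

section \<open>Finite groups of roots of unity\<close>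

text \<open>All of \<open>U\<close> are roots of \<open>x^i - 1\<close>, which has at most
  \<open>i\<close> of them.\<close>

lemma card_le_exponent:
  fixes U :: "'f::field set"
  assumes "0 < i" "\<And>u. u \<in> U \<Longrightarrow> u ^ i = 1"
  shows "finite U \<and> card U \<le> i"
proof -
  let ?p = "monom (1::'f) i - 1"
  have "coeff ?p i = 1" using assms(1) by simp
  then have "?p \<noteq> 0" by (metis coeff_0 zero_neq_one)
  have "degree ?p \<le> i" by (intro degree_diff_le degree_monom_le) auto
  have sub: "U \<subseteq> {x. poly ?p x = 0}" using assms(2) by (auto simp: poly_monom)
  have fin: "finite {x. poly ?p x = 0}" by (rule poly_roots_finite[OF \<open>?p \<noteq> 0\<close>])
  have "card U \<le> card {x. poly ?p x = 0}" by (rule card_mono[OF fin sub])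
  also have "\<dots> \<le> degree ?p" by (rule card_poly_roots_bound[OF \<open>?p \<noteq> 0\<close>])
  finally show ?thesis using \<open>degree ?p \<le> i\<close> finite_subset[OF sub fin] by simp
qed

text \<open>Inverses come for free: multiplication by \<open>u\<close> is injective on a finite set,
  hence onto.\<close>

locale finite_unit_group =
  fixes U :: "'f::field set"
  assumes fin: "finite U" and one: "1 \<in> U" and zero: "0 \<notin> U"
    and mult: "u \<in> U \<Longrightarrow> v \<in> U \<Longrightarrow> u * v \<in> U"
begin

definition N :: nat where "N = card U"

lemma N_pos: "0 < N"
  unfolding N_def using fin one by (auto simp: card_gt_0_iff)

lemma mult_bij:
  assumes "u \<in> U"
  shows "bij_betw ((*) u) U U"
proof -
  have "u \<noteq> 0" using assms zero by blast
  then have "inj_on ((*) u) U" by (auto intro!: inj_onI)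
  moreover have "(*) u ` U \<subseteq> U" using mult assms by auto
  ultimately show ?thesis using fin by (simp add: bij_betw_def endo_inj_surj)
qed

text \<open>Multiplication by \<open>u\<close> permutes \<open>U\<close>, so the product of all
  elements absorbs a factor \<open>u^N\<close>.\<close>

lemma power_N:
  assumes "u \<in> U"
  shows "u ^ N = 1"
proof -
  have "(\<Prod>v\<in>U. v) = (\<Prod>v\<in>U. u * v)" by (rule prod.reindex_bij_betw[OF mult_bij[OF assms], symmetric])
  also have "\<dots> = u ^ N * (\<Prod>v\<in>U. v)" by (simp add: prod.distrib N_def)
  finally show ?thesis using zero fin by (simp add: prod_zero_iff)
qed

text \<open>If the characteristic \<open>p\<close> divided \<open>N = p m\<close>, additivity of the
  \<open>p\<close>-th power would turn \<open>u^N = 1\<close> into \<open>u^m = 1\<close>. Then all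
  \<open>N\<close> elements would be roots of \<open>x^m - 1\<close> with
  \<open>m < N\<close>.\<close>

lemma of_nat_N: "of_nat N \<noteq> (0 :: 'f)"
proof
  assume z: "of_nat N = (0 :: 'f)"
  then have dvd: "CHAR('f) dvd N" by (simp add: of_nat_eq_0_iff_char_dvd)
  then have pos: "CHAR('f) > 0" using N_pos by (metis dvd_0_left_iff gr_zeroI less_irrefl)
  then have pr: "prime CHAR('f)" by (rule prime_CHAR_semidom)
  obtain m where m: "N = CHAR('f) * m" using dvd by blast
  have "u ^ m = 1" if "u \<in> U" for u
  proof -
    have "((u ^ m - 1) + 1) ^ CHAR('f) = (u ^ m - 1) ^ CHAR('f) + 1 ^ CHAR('f)"
      by (rule freshmans_dream[OF pr refl])
    moreover have "(u ^ m) ^ CHAR('f) = 1" using power_N[OF that] by (simp add: m power_mult mult.commute)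
    ultimately have "(u ^ m - 1) ^ CHAR('f) = 0" by simp
    then show ?thesis by simp
  qed
  moreover have "0 < m" using m N_pos by (cases m) auto
  ultimately have "N \<le> m" using card_le_exponent[of m U] by (simp add: N_def)
  then show False using m pr prime_gt_1_nat[OF pr] \<open>0 < m\<close> by simp
qed

text \<open>For \<open>0 < i < N\<close> some \<open>v\<close> has \<open>v^i \<noteq> 1\<close>;
  substituting \<open>v u\<close> for \<open>u\<close> multiplies the sum by a scalar other than
  1.\<close>

lemma sum_power:
  assumes "0 < i" "i < N"
  shows "(\<Sum>u\<in>U. inverse u ^ i) = 0"
proof -
  obtain v where v: "v \<in> U" "v ^ i \<noteq> 1"
    using card_le_exponent[of i U] assms by (force simp: N_def)
  have "(\<Sum>u\<in>U. inverse u ^ i) = (\<Sum>u\<in>U. inverse (v * u) ^ i)"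
    by (rule sum.reindex_bij_betw[OF mult_bij[OF v(1)], symmetric])
  also have "\<dots> = inverse (v ^ i) * (\<Sum>u\<in>U. inverse u ^ i)"
    by (simp add: sum_distrib_left power_mult_distrib power_inverse)
  finally have "(1 - inverse (v ^ i)) * (\<Sum>u\<in>U. inverse u ^ i) = 0" by (simp add: algebra_simps)
  then show ?thesis using v by simp
qed

text \<open>Think of \<open>w i\<close> as one coordinate of \<open>T^i x\<close> for an operator
  \<open>T\<close> with \<open>T^N = 1\<close>. The inner sums are the unnormalised eigenprojections
  of \<open>x\<close>, and they add up to \<open>N x\<close>. Working with scalar sequences serves
  matrices and functions alike.\<close>

lemma sum_projections: "(\<Sum>u\<in>U. \<Sum>i<N. inverse u ^ i * w i) = of_nat N * w 0"
proof -
  have "(\<Sum>u\<in>U. \<Sum>i<N. inverse u ^ i * w i) = (\<Sum>i<N. (\<Sum>u\<in>U. inverse u ^ i) * w i)"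
    by (subst sum.swap) (simp add: sum_distrib_right)
  also have "\<dots> = (\<Sum>i<N. if i = 0 then of_nat N * w 0 else 0)"
  proof (rule sum.cong)
    fix i assume "i \<in> {..<N}"
    then show "(\<Sum>u\<in>U. inverse u ^ i) * w i = (if i = 0 then of_nat N * w 0 else 0)"
      using sum_power[of i] by (auto simp: N_def)
  qed simp
  finally show ?thesis using N_pos by simp
qed

text \<open>In the same reading, the operator acts on the projection belonging to \<open>u\<close>
  by the eigenvalue \<open>u\<close>. Periodicity closes the shifted sum, whose last term is the one
  for \<open>i = 0\<close>.\<close>

lemma shift_projection:
  assumes u: "u \<in> U" and per: "w N = w 0"
  shows "(\<Sum>i<N. inverse u ^ i * w (Suc i)) = u * (\<Sum>i<N. inverse u ^ i * w i)"
proof -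
  have u0: "u \<noteq> 0" using u zero by blast
  have inv: "inverse u ^ N = 1" using power_N[OF u] by (simp add: power_inverse)
  have "(\<Sum>i<N. inverse u ^ i * w (Suc i)) = u * (\<Sum>i<N. inverse u ^ Suc i * w (Suc i))"
    using u0 by (simp add: sum_distrib_left mult.assoc[symmetric])
  also have "(\<Sum>i<N. inverse u ^ Suc i * w (Suc i)) = (\<Sum>i<N. inverse u ^ i * w i)"
    using sum.lessThan_Suc_shift[of "\<lambda>i. inverse u ^ i * w i" N] by (simp add: inv per)
  finally show ?thesis .
qed

end

section \<open>Irreducible characters of an abelian group of split exponent\<close>

lemma submoduleI_scalars:
  assumes "module scalars V" "U \<subseteq> carrier V" "\<zero>\<^bsub>V\<^esub> \<in> U"
    and add: "\<And>x y. x \<in> U \<Longrightarrow> y \<in> U \<Longrightarrow> x \<oplus>\<^bsub>V\<^esub> y \<in> U"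
    and smult: "\<And>c x. x \<in> U \<Longrightarrow> c \<odot>\<^bsub>V\<^esub> x \<in> U"
  shows "submodule U scalars V"
proof -
  interpret module scalars V by fact
  have "\<ominus>\<^bsub>V\<^esub> x \<in> U" if x: "x \<in> U" for x
  proof -
    have xc: "x \<in> carrier V" using x assms(2) by blast
    have "\<one>\<^bsub>scalars\<^esub> \<odot>\<^bsub>V\<^esub> x = x" by (rule smult_one[OF xc])
    then have "\<ominus>\<^bsub>V\<^esub> x = (\<ominus>\<^bsub>scalars\<^esub> \<one>\<^bsub>scalars\<^esub>) \<odot>\<^bsub>V\<^esub> x" using smult_l_minus[of "\<one>\<^bsub>scalars\<^esub>" x] xc by simp
    then show ?thesis using smult x by simp
  qed
  then show ?thesis using assms by (intro submoduleI) auto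
qed

lemma matrix_gmodule_simps [simp]:
  "carrier (matrix_gmodule n A) = carrier_vec n" "\<zero>\<^bsub>matrix_gmodule n A\<^esub> = 0\<^sub>v n"
  "v \<oplus>\<^bsub>matrix_gmodule n A\<^esub> w = v + w" "c \<odot>\<^bsub>matrix_gmodule n A\<^esub> v = c \<cdot>\<^sub>v v"
  "act (matrix_gmodule n A) g v = A g *\<^sub>v v"
  by (simp_all add: matrix_gmodule_def)

text \<open>In dimension 1 a submodule that contains a nonzero vector contains all multiples of it,
  hence everything.\<close>

lemma linear_character_in_Irr:
  fixes \<chi> :: "'g \<Rightarrow> 'f::field"
  assumes G: "group G" and \<chi>: "linear_character G \<chi>"
  shows "\<chi> \<in> Irr G"
proof -
  interpret group G by fact
  define A where "A = (\<lambda>g. mat 1 1 (\<lambda>_. \<chi> g))"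
  have Av: "A g *\<^sub>v v = \<chi> g \<cdot>\<^sub>v v" if "v \<in> carrier_vec 1" for g v
    using that by (intro eq_vecI) (auto simp: A_def scalar_prod_def)
  let ?V = "matrix_gmodule 1 A"
  have ab: "abelian_group ?V"
  proof (rule abelian_groupI)
    fix x :: "'f vec" assume "x \<in> carrier ?V"
    then show "\<exists>y\<in>carrier ?V. y \<oplus>\<^bsub>?V\<^esub> x = \<zero>\<^bsub>?V\<^esub>"
      by (intro bexI[of _ "- x"]) auto
  qed (auto simp: comm_add_vec[of _ 1])
  have mod: "module scalars ?V"
    by (rule moduleI[OF cring_scalars ab]) (auto simp: add_smult_distrib_vec smult_add_distrib_vec[of _ 1] smult_smult_assoc)
  have gm: "gmodule G ?V"
  proof (intro gmodule.intro gmodule_axioms.intro mod G)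
    fix v assume v: "v \<in> carrier ?V"
    show "act ?V \<one>\<^bsub>G\<^esub> v = v" using v linear_character_one[OF G \<chi>] by (simp add: Av)
    show "act ?V (g \<otimes>\<^bsub>G\<^esub> h) v = act ?V g (act ?V h v)" if "g \<in> carrier G" "h \<in> carrier G" for g h
      using that v \<chi> by (simp add: Av linear_character_def smult_smult_assoc)
    show "act ?V g (c \<odot>\<^bsub>?V\<^esub> v) = c \<odot>\<^bsub>?V\<^esub> act ?V g v" for g c
      using v by (simp add: Av smult_smult_assoc mult.commute)
    show "act ?V g (v \<oplus>\<^bsub>?V\<^esub> w) = act ?V g v \<oplus>\<^bsub>?V\<^esub> act ?V g w" if "w \<in> carrier ?V" for g w
      using v that by (simp add: Av smult_add_distrib_vec[of _ 1])
    show "act ?V g v \<in> carrier ?V" for g using v by (simp add: Av)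
  qed
  have "carrier ?V \<noteq> {\<zero>\<^bsub>?V\<^esub>}"
  proof
    assume "carrier ?V = {\<zero>\<^bsub>?V\<^esub>}"
    moreover have "unit_vec 1 0 \<in> carrier ?V" by simp
    ultimately have "unit_vec 1 0 $ 0 = (0\<^sub>v 1 $ 0 :: 'f)" by simp
    then show False by simp
  qed
  moreover have "U = {\<zero>\<^bsub>?V\<^esub>} \<or> U = carrier ?V" if U: "submodule U scalars ?V" for U
  proof (rule disjCI)
    interpret U: submodule U scalars ?V by fact
    have Usub: "U \<subseteq> carrier_vec 1" and U0: "0\<^sub>v 1 \<in> U" and Us: "\<And>c x. x \<in> U \<Longrightarrow> c \<cdot>\<^sub>v x \<in> U"
      using U.subset U.one_closed U.smult_closed by auto
    assume "U \<noteq> carrier ?V"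
    then obtain w where w: "w \<in> carrier_vec 1" "w \<notin> U" using Usub by auto
    have "v = 0\<^sub>v 1" if v: "v \<in> U" for v
    proof (rule ccontr)
      assume ne: "v \<noteq> 0\<^sub>v 1"
      have vc: "v \<in> carrier_vec 1" using v Usub by blast
      have "v $ 0 \<noteq> 0"
      proof
        assume "v $ 0 = 0"
        then have "v = 0\<^sub>v 1" using vc by (intro eq_vecI) auto
        then show False using ne by simp
      qed
      then have "w = (w $ 0 / v $ 0) \<cdot>\<^sub>v v" using vc w(1) by (intro eq_vecI) auto
      then show False using Us[OF v, of "w $ 0 / v $ 0"] w(2) by simp
    qed
    then show "U = {\<zero>\<^bsub>?V\<^esub>}" using U0 unfolding matrix_gmodule_simps by blast
  qed
  ultimately have irr: "irreducible_gmodule G ?V" using gm unfolding irreducible_gmodule_def by blast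
  have "\<chi> = (\<lambda>g\<in>carrier G. \<Sum>i<1. A g $$ (i, i))"
  proof
    fix g
    show "\<chi> g = (\<lambda>g\<in>carrier G. \<Sum>i<1. A g $$ (i, i)) g"
      using \<chi> by (cases "g \<in> carrier G") (simp_all add: linear_character_def extensional_def A_def)
  qed
  moreover have "\<forall>g\<in>carrier G. A g \<in> carrier_mat 1 1" by (simp add: A_def)
  ultimately show ?thesis unfolding Irr_def using irr by blast
qed

text \<open>Schur's lemma over \<open>F\<close> itself: the \<open>N\<close> eigenprojections of any
  \<open>g\<close> sum to \<open>N\<close>, which is invertible, so some eigenspace is nonzero and
  by irreducibility is the whole space. All \<open>g\<close> are then scalar, and irreducibility
  leaves dimension 1.\<close>

lemma (in finite_unit_group) Irr_linear_character:
  assumes S: "comm_group S" and expn: "\<And>g. g \<in> carrier S \<Longrightarrow> g [^]\<^bsub>S\<^esub> N = \<one>\<^bsub>S\<^esub>"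
    and \<chi>: "(\<chi> :: 'g \<Rightarrow> 'f) \<in> Irr S"
  shows "linear_character S \<chi>"
proof -
  interpret S: comm_group S by fact
  obtain n A where \<chi>_eq: "\<chi> = (\<lambda>g\<in>carrier S. \<Sum>i<n. A g $$ (i, i))"
    and A: "\<And>g. g \<in> carrier S \<Longrightarrow> A g \<in> carrier_mat n n"
    and irr: "irreducible_gmodule S (matrix_gmodule n A)"
    using \<chi> unfolding Irr_def by blast
  let ?V = "matrix_gmodule n A"
  interpret V: gmodule S ?V using irr by (simp add: irreducible_gmodule_def)
  have mod: "module scalars ?V" by (rule V.module_axioms)
  have Am: "A (g \<otimes>\<^bsub>S\<^esub> h) *\<^sub>v v = A g *\<^sub>v (A h *\<^sub>v v)" if "g \<in> carrier S" "h \<in> carrier S" "v \<in> carrier_vec n" for g h v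
    using V.act_mult[of g h v] that by simp
  have A1: "A \<one>\<^bsub>S\<^esub> *\<^sub>v v = v" if "v \<in> carrier_vec n" for v using V.act_one[of v] that by simp
  have Ac: "A g *\<^sub>v v \<in> carrier_vec n" if "g \<in> carrier S" "v \<in> carrier_vec n" for g v
    using V.act_closed[of g v] that by simp
  have Aadd: "A g *\<^sub>v (v + w) = A g *\<^sub>v v + A g *\<^sub>v w" if "g \<in> carrier S" "v \<in> carrier_vec n" "w \<in> carrier_vec n" for g v w
    using V.act_add[of g v w] that by simp
  have Asm: "A g *\<^sub>v (c \<cdot>\<^sub>v v) = c \<cdot>\<^sub>v (A g *\<^sub>v v)" if "g \<in> carrier S" "v \<in> carrier_vec n" for g c v
    using V.act_smult[of g v c] that by simp
  have irr': "U = {0\<^sub>v n} \<or> U = carrier_vec n"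
    if "U \<subseteq> carrier_vec n" "0\<^sub>v n \<in> U" "\<And>x y. x \<in> U \<Longrightarrow> y \<in> U \<Longrightarrow> x + y \<in> U"
      "\<And>c x. x \<in> U \<Longrightarrow> c \<cdot>\<^sub>v x \<in> U" "\<And>g u. g \<in> carrier S \<Longrightarrow> u \<in> U \<Longrightarrow> A g *\<^sub>v u \<in> U" for U
  proof -
    have "submodule U scalars ?V" by (rule submoduleI_scalars[OF mod]) (use that in auto)
    then show ?thesis using irr that(5) unfolding irreducible_gmodule_def by simp
  qed
  have npos: "0 < n"
  proof (rule ccontr)
    assume "\<not> 0 < n"
    then have "carrier ?V = {\<zero>\<^bsub>?V\<^esub>}" by auto
    then show False using irr by (simp add: irreducible_gmodule_def)
  qed
  have scalar: "\<exists>c. \<forall>v\<in>carrier_vec n. A g *\<^sub>v v = c \<cdot>\<^sub>v v" if g: "g \<in> carrier S" for g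
  proof (rule ccontr)
    assume no: "\<not> ?thesis"
    \<comment> \<open>Commutativity makes an eigenspace of \<open>g\<close> invariant under
      \<open>S\<close>. It is zero or everything, and the latter would make \<open>g\<close>
      scalar.\<close>
    have E: "{v \<in> carrier_vec n. A g *\<^sub>v v = c \<cdot>\<^sub>v v} = {0\<^sub>v n}" for c
    proof -
      let ?E = "{v \<in> carrier_vec n. A g *\<^sub>v v = c \<cdot>\<^sub>v v}"
      have "?E = {0\<^sub>v n} \<or> ?E = carrier_vec n"
      proof (rule irr')
        have z: "0 \<cdot>\<^sub>v u = 0\<^sub>v n" if "u \<in> carrier_vec n" for u :: "'f vec"
          using that by (intro eq_vecI) auto
        have z': "a \<cdot>\<^sub>v 0\<^sub>v n = (0\<^sub>v n :: 'f vec)" for a by (intro eq_vecI) auto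
        have "A g *\<^sub>v 0\<^sub>v n = A g *\<^sub>v (0 \<cdot>\<^sub>v 0\<^sub>v n)" by (simp only: z')
        also have "\<dots> = 0\<^sub>v n" by (simp only: Asm[OF g zero_carrier_vec] z[OF Ac[OF g zero_carrier_vec]])
        finally show "0\<^sub>v n \<in> ?E" by (simp add: z')
      next
        fix h u assume h: "h \<in> carrier S" and u: "u \<in> ?E"
        have "A g *\<^sub>v (A h *\<^sub>v u) = A h *\<^sub>v (A g *\<^sub>v u)"
          using Am[OF g h, of u] Am[OF h g, of u] S.m_comm[OF g h] u by simp
        then show "A h *\<^sub>v u \<in> ?E" using u Ac[OF h] Asm[OF h] by simp
      qed (use g Aadd[OF g] Asm[OF g] in \<open>auto simp: smult_add_distrib_vec[of _ n] smult_smult_assoc mult.commute\<close>)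
      then show ?thesis using no by blast
    qed
    define v :: "'f vec" where "v = unit_vec n 0"
    have v: "v \<in> carrier_vec n" by (simp add: v_def)
    define w where "w = (\<lambda>j i. (A (g [^]\<^bsub>S\<^esub> (i::nat)) *\<^sub>v v) $ j)"
    have gi: "g [^]\<^bsub>S\<^esub> i \<in> carrier S" for i :: nat using g by simp
    have wc: "A (g [^]\<^bsub>S\<^esub> i) *\<^sub>v v \<in> carrier_vec n" for i :: nat by (rule Ac[OF gi v])
    \<comment> \<open>The eigenprojections of the unit vector \<open>v\<close>, coordinate by
      coordinate. By \<open>E\<close> all of them vanish, while their sum is
      \<open>N v\<close>.\<close>
    define p where "p = (\<lambda>u. vec n (\<lambda>j. \<Sum>i<N. inverse u ^ i * w j i))"
    have wN: "w j N = w j 0" for j by (simp add: w_def expn[OF g])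
    have "A g *\<^sub>v p u = u \<cdot>\<^sub>v p u" if u: "u \<in> U" for u
    proof (rule eq_vecI)
      fix j assume "j < dim_vec (u \<cdot>\<^sub>v p u)"
      then have j: "j < n" by (simp add: p_def)
      have Agn: "dim_row (A g) = n" "dim_col (A g) = n" using A[OF g] by auto
      have step: "w j (Suc i) = (\<Sum>k<n. A g $$ (j, k) * w k i)" for i
      proof -
        have "g [^]\<^bsub>S\<^esub> Suc i = g \<otimes>\<^bsub>S\<^esub> g [^]\<^bsub>S\<^esub> i" using g S.m_comm[OF gi g] by simp
        then have "w j (Suc i) = (A g *\<^sub>v (A (g [^]\<^bsub>S\<^esub> i) *\<^sub>v v)) $ j" unfolding w_def using Am[OF g gi v] by simp
        also have "\<dots> = (\<Sum>k<n. A g $$ (j, k) * w k i)"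
          using j Agn A[OF gi, of i] by (auto simp: scalar_prod_def w_def lessThan_atLeast0 intro!: sum.cong)
        finally show ?thesis .
      qed
      have "(A g *\<^sub>v p u) $ j = (\<Sum>k<n. A g $$ (j, k) * (\<Sum>i<N. inverse u ^ i * w k i))"
        using j Agn by (auto simp: scalar_prod_def p_def lessThan_atLeast0 intro!: sum.cong)
      also have "\<dots> = (\<Sum>i<N. inverse u ^ i * w j (Suc i))"
        unfolding sum_distrib_left step by (subst sum.swap) (simp add: mult.left_commute)
      also have "\<dots> = u * (\<Sum>i<N. inverse u ^ i * w j i)" by (rule shift_projection[OF u wN])
      finally show "(A g *\<^sub>v p u) $ j = (u \<cdot>\<^sub>v p u) $ j" using j by (simp add: p_def)
    qed (use A[OF g] in \<open>simp add: p_def\<close>)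
    moreover have "p u \<in> carrier_vec n" for u by (simp add: p_def)
    ultimately have p0: "p u = 0\<^sub>v n" if "u \<in> U" for u using E[of u] that by blast
    have "(\<Sum>i<N. inverse u ^ i * w 0 i) = 0" if "u \<in> U" for u
    proof -
      have "(\<Sum>i<N. inverse u ^ i * w 0 i) = p u $ 0" using npos by (simp add: p_def)
      then show ?thesis using npos by (simp add: p0[OF that])
    qed
    then have "of_nat N * w 0 0 = 0" using sum_projections[of "w 0"] by simp
    then have "w 0 0 = 0" using of_nat_N by simp
    moreover have "w 0 0 = 1" using npos A1[OF v] by (simp add: w_def v_def)
    ultimately show False by simp
  qed
  then obtain c where c: "\<And>g v. g \<in> carrier S \<Longrightarrow> v \<in> carrier_vec n \<Longrightarrow> A g *\<^sub>v v = c g \<cdot>\<^sub>v v" by metis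
  let ?e = "unit_vec n 0 :: 'f vec"
  let ?L = "{a \<cdot>\<^sub>v ?e |a. True}"
  \<comment> \<open>As every \<open>g\<close> is scalar, the line through a unit vector is
    invariant.\<close>
  have "?L = {0\<^sub>v n} \<or> ?L = carrier_vec n"
  proof (rule irr')
    have "0\<^sub>v n = 0 \<cdot>\<^sub>v ?e" by auto
    then show "0\<^sub>v n \<in> ?L" by blast
    show "x + y \<in> ?L" if "x \<in> ?L" "y \<in> ?L" for x y
      using that by (auto simp: add_smult_distrib_vec[symmetric])
    show "a \<cdot>\<^sub>v x \<in> ?L" if "x \<in> ?L" for a x using that by (auto simp: smult_smult_assoc)
    show "A g *\<^sub>v x \<in> ?L" if "g \<in> carrier S" "x \<in> ?L" for g x
      using that c[OF that(1), of x] by (auto simp: smult_smult_assoc)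
  qed auto
  moreover have "?L \<noteq> {0\<^sub>v n}"
  proof
    assume "?L = {0\<^sub>v n}"
    moreover have "1 \<cdot>\<^sub>v ?e \<in> ?L" by blast
    ultimately have "(1 \<cdot>\<^sub>v ?e) $ 0 = (0\<^sub>v n :: 'f vec) $ 0" by (metis (lifting) singletonD)
    then show False using npos by simp
  qed
  ultimately have L: "?L = carrier_vec n" by blast
  have "n = 1"
  proof (rule ccontr)
    assume "n \<noteq> 1"
    then have n2: "1 < n" using npos by simp
    have "unit_vec n 1 \<in> ?L" unfolding L by simp
    then obtain a where "unit_vec n 1 = a \<cdot>\<^sub>v ?e" by blast
    then have "unit_vec n 1 $ 1 = (a \<cdot>\<^sub>v ?e) $ 1" by simp
    then show False using n2 by simp
  qed
  have \<chi>c: "\<chi> g = c g" if g: "g \<in> carrier S" for g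
  proof -
    have "A g $$ (0, 0) = (A g *\<^sub>v ?e) $ 0" using A[OF g] \<open>n = 1\<close> by (simp add: scalar_prod_def)
    also have "\<dots> = c g" using c[OF g, of ?e] npos by simp
    finally show ?thesis using g \<open>n = 1\<close> by (simp add: \<chi>_eq)
  qed
  have cm: "c (g \<otimes>\<^bsub>S\<^esub> h) = c g * c h" if gh: "g \<in> carrier S" "h \<in> carrier S" for g h
  proof -
    have "c (g \<otimes>\<^bsub>S\<^esub> h) \<cdot>\<^sub>v ?e = c g \<cdot>\<^sub>v (c h \<cdot>\<^sub>v ?e)"
      using Am[OF gh, of ?e] c[of "g \<otimes>\<^bsub>S\<^esub> h" ?e] c[OF gh(2), of ?e] c[OF gh(1), of "c h \<cdot>\<^sub>v ?e"] gh by simp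
    then have "(c (g \<otimes>\<^bsub>S\<^esub> h) \<cdot>\<^sub>v ?e) $ 0 = (c g \<cdot>\<^sub>v (c h \<cdot>\<^sub>v ?e)) $ 0" by simp
    then show ?thesis using npos by simp
  qed
  have c1: "c \<one>\<^bsub>S\<^esub> = 1"
  proof -
    have "(c \<one>\<^bsub>S\<^esub> \<cdot>\<^sub>v ?e) $ 0 = ?e $ 0" using c[of "\<one>\<^bsub>S\<^esub>" ?e] A1[of ?e] by simp
    then show ?thesis using npos by simp
  qed
  have "c g \<noteq> 0" if "g \<in> carrier S" for g
  proof
    assume "c g = 0"
    then show False using cm[OF that S.inv_closed[OF that]] that c1 by simp
  qed
  then show ?thesis unfolding linear_character_def
    using cm \<chi>c by (auto simp: \<chi>_eq)
qed

section \<open>The decomposition\<close>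

lemma fun_model_iso:
  assumes "fun_model G (carrier G) V Y \<Psi>" "fun_model G (carrier G) W Y \<Phi>"
  shows "gmodule_iso G V W"
proof -
  note D = fun_modelD[OF assms(1)] and E = fun_modelD[OF assms(2)]
  define \<theta> where "\<theta> = (\<lambda>v. inv_into (carrier W) \<Phi> (\<Psi> v))"
  have bij: "bij_betw \<theta> (carrier V) (carrier W)"
    unfolding \<theta>_def by (rule bij_betw_trans[OF D(1) bij_betw_inv_into[OF E(1)], unfolded comp_def])
  have \<theta>: "\<theta> v \<in> carrier W" "\<Phi> (\<theta> v) = \<Psi> v" if "v \<in> carrier V" for v
    using D(10)[OF that] E(1) unfolding \<theta>_def bij_betw_def by (auto intro: inv_into_into f_inv_into_f)
  show ?thesis
    unfolding gmodule_iso_def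
  proof (intro exI[of _ \<theta>] conjI bij ballI allI)
    show "\<theta> (v \<oplus>\<^bsub>V\<^esub> w) = \<theta> v \<oplus>\<^bsub>W\<^esub> \<theta> w" if "v \<in> carrier V" "w \<in> carrier V" for v w
      by (rule E(11)) (use that \<theta> in \<open>simp_all add: D E(2-9)\<close>)
    show "\<theta> (c \<odot>\<^bsub>V\<^esub> v) = c \<odot>\<^bsub>W\<^esub> \<theta> v" if "v \<in> carrier V" for c v
      by (rule E(11)) (use that \<theta> in \<open>simp_all add: D E(2-9)\<close>)
    show "\<theta> (act V g v) = act W g (\<theta> v)" if "g \<in> carrier G" "v \<in> carrier V" for g v
      by (rule E(11)) (use that \<theta> in \<open>simp_all add: D E(2-9)\<close>)
  qed
qed

lemma direct_sum_simps [simp]: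
  "carrier (direct_sum I V) = {v \<in> (\<Pi>\<^sub>E i\<in>I. carrier (V i)). finite {i \<in> I. v i \<noteq> \<zero>\<^bsub>V i\<^esub>}}"
  "\<zero>\<^bsub>direct_sum I V\<^esub> = (\<lambda>i\<in>I. \<zero>\<^bsub>V i\<^esub>)"
  "v \<oplus>\<^bsub>direct_sum I V\<^esub> w = (\<lambda>i\<in>I. v i \<oplus>\<^bsub>V i\<^esub> w i)"
  "c \<odot>\<^bsub>direct_sum I V\<^esub> v = (\<lambda>i\<in>I. c \<odot>\<^bsub>V i\<^esub> v i)"
  "act (direct_sum I V) g v = (\<lambda>i\<in>I. act (V i) g (v i))"
  by (simp_all add: direct_sum_def)

text \<open>For a finite index set the support condition of \<open>direct_sum\<close> is automatic.
  Adding the component functions is injective by independence, applied to differences.\<close>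

lemma direct_sum_fun_model:
  assumes I: "finite I" and m: "\<And>i. i \<in> I \<Longrightarrow> fun_model G (carrier G) (V i) (Y i) (\<Psi> i)"
    and sub: "\<And>i. i \<in> I \<Longrightarrow> fs.subspace (Y i)"
    and indep: "\<And>\<phi> i. (\<And>i. i \<in> I \<Longrightarrow> \<phi> i \<in> Y i) \<Longrightarrow> (\<Sum>i\<in>I. \<phi> i) = 0 \<Longrightarrow> i \<in> I \<Longrightarrow> \<phi> i = 0"
  shows "fun_model G (carrier G) (direct_sum I V) {\<Sum>i\<in>I. \<phi> i |\<phi>. \<forall>i\<in>I. \<phi> i \<in> Y i} (\<lambda>v. \<Sum>i\<in>I. \<Psi> i (v i))"
proof -
  note D = fun_modelD[OF m]
  have car: "carrier (direct_sum I V) = (\<Pi>\<^sub>E i\<in>I. carrier (V i))" using I by auto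
  let ?Z = "{\<Sum>i\<in>I. \<phi> i |\<phi>. \<forall>i\<in>I. \<phi> i \<in> Y i}"
  have bij: "bij_betw (\<lambda>v. \<Sum>i\<in>I. \<Psi> i (v i)) (\<Pi>\<^sub>E i\<in>I. carrier (V i)) ?Z"
    unfolding bij_betw_def
  proof
    show "inj_on (\<lambda>v. \<Sum>i\<in>I. \<Psi> i (v i)) (\<Pi>\<^sub>E i\<in>I. carrier (V i))"
    proof (rule inj_onI)
      fix v w assume v: "v \<in> (\<Pi>\<^sub>E i\<in>I. carrier (V i))" and w: "w \<in> (\<Pi>\<^sub>E i\<in>I. carrier (V i))"
        and eq: "(\<Sum>i\<in>I. \<Psi> i (v i)) = (\<Sum>i\<in>I. \<Psi> i (w i))"
      have "\<Psi> i (v i) - \<Psi> i (w i) = 0" if i: "i \<in> I" for i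
      proof (rule indep[OF _ _ i, of "\<lambda>i. \<Psi> i (v i) - \<Psi> i (w i)"])
        show "\<Psi> i (v i) - \<Psi> i (w i) \<in> Y i" if "i \<in> I" for i
          using v w that by (intro fs.subspace_diff[OF sub] D(10)) auto
        show "(\<Sum>i\<in>I. \<Psi> i (v i) - \<Psi> i (w i)) = 0" using eq by (simp only: sum_subtractf) simp
      qed
      then have "v i = w i" if "i \<in> I" for i
        using v w that by (intro D(11)[of i]) auto
      then show "v = w" using v w by (rule PiE_ext[rotated 2])
    qed
    show "(\<lambda>v. \<Sum>i\<in>I. \<Psi> i (v i)) ` (\<Pi>\<^sub>E i\<in>I. carrier (V i)) = ?Z"
    proof (intro equalityI subsetI)
      fix x assume "x \<in> (\<lambda>v. \<Sum>i\<in>I. \<Psi> i (v i)) ` (\<Pi>\<^sub>E i\<in>I. carrier (V i))"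
      then obtain v where v: "v \<in> (\<Pi>\<^sub>E i\<in>I. carrier (V i))" "x = (\<Sum>i\<in>I. \<Psi> i (v i))" by blast
      have "\<forall>i\<in>I. \<Psi> i (v i) \<in> Y i" using v(1) D(10) by auto
      then show "x \<in> ?Z" using v(2) by blast
    next
      fix x assume "x \<in> ?Z"
      then obtain \<phi> where \<phi>: "\<forall>i\<in>I. \<phi> i \<in> Y i" "x = (\<Sum>i\<in>I. \<phi> i)" by blast
      define v where "v = (\<lambda>i\<in>I. inv_into (carrier (V i)) (\<Psi> i) (\<phi> i))"
      have vi: "v i \<in> carrier (V i)" "\<Psi> i (v i) = \<phi> i" if "i \<in> I" for i
        using that \<phi>(1) D(1)[OF that] unfolding v_def bij_betw_def by (auto intro: inv_into_into f_inv_into_f)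
      then have "v \<in> (\<Pi>\<^sub>E i\<in>I. carrier (V i))" "x = (\<Sum>i\<in>I. \<Psi> i (v i))" by (auto simp: v_def \<phi>(2))
      then show "x \<in> (\<lambda>v. \<Sum>i\<in>I. \<Psi> i (v i)) ` (\<Pi>\<^sub>E i\<in>I. carrier (V i))" by blast
    qed
  qed
  show ?thesis
    unfolding fun_model_def car
  proof (intro conjI ballI allI bij)
    show "\<zero>\<^bsub>direct_sum I V\<^esub> \<in> (\<Pi>\<^sub>E i\<in>I. carrier (V i))" using D(2) by auto
    show "(\<Sum>i\<in>I. \<Psi> i (\<zero>\<^bsub>direct_sum I V\<^esub> i)) = 0" using D(3) by (intro sum.neutral) auto
    fix v assume v: "v \<in> (\<Pi>\<^sub>E i\<in>I. carrier (V i))"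
    then have vi: "v i \<in> carrier (V i)" if "i \<in> I" for i using that by auto
    show "c \<odot>\<^bsub>direct_sum I V\<^esub> v \<in> (\<Pi>\<^sub>E i\<in>I. carrier (V i))" for c using vi D(6) by auto
    show "(\<Sum>i\<in>I. \<Psi> i ((c \<odot>\<^bsub>direct_sum I V\<^esub> v) i)) = (\<lambda>y. c * (\<Sum>i\<in>I. \<Psi> i (v i)) y)" for c
      using vi D(7) by (auto simp: fun_eq_iff sum_apply sum_distrib_left intro!: sum.cong)
    show "act (direct_sum I V) g v \<in> (\<Pi>\<^sub>E i\<in>I. carrier (V i))" if "g \<in> carrier G" for g using vi D(8) that by auto
    show "(\<Sum>i\<in>I. \<Psi> i (act (direct_sum I V) g v i)) = ltrans G g (\<Sum>i\<in>I. \<Psi> i (v i))" if "g \<in> carrier G" for g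
      using vi D(9) that by (auto simp: ltrans_sum intro!: sum.cong)
    fix w assume w: "w \<in> (\<Pi>\<^sub>E i\<in>I. carrier (V i))"
    then have wi: "w i \<in> carrier (V i)" if "i \<in> I" for i using that by auto
    show "v \<oplus>\<^bsub>direct_sum I V\<^esub> w \<in> (\<Pi>\<^sub>E i\<in>I. carrier (V i))" using vi wi D(4) by auto
    have "\<Psi> i ((v \<oplus>\<^bsub>direct_sum I V\<^esub> w) i) = \<Psi> i (v i) + \<Psi> i (w i)" if "i \<in> I" for i
      using vi wi D(5) that by simp
    then show "(\<Sum>i\<in>I. \<Psi> i ((v \<oplus>\<^bsub>direct_sum I V\<^esub> w) i)) = (\<Sum>i\<in>I. \<Psi> i (v i)) + (\<Sum>i\<in>I. \<Psi> i (w i))"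
      by (simp only: sum.distrib[symmetric] cong: sum.cong)
  qed
qed

text \<open>Dedekind's argument for the linear independence of characters.\<close>

lemma indsp_independent:
  fixes \<kappa> :: "'i \<Rightarrow> 'g \<Rightarrow> 'f::field"
  assumes "finite C"
    and "\<And>i. i \<in> C \<Longrightarrow> subgroup_character G K (\<kappa> i)"
    and "\<And>i j. i \<in> C \<Longrightarrow> j \<in> C \<Longrightarrow> i \<noteq> j \<Longrightarrow> \<exists>s\<in>K. \<kappa> i s \<noteq> \<kappa> j s"
    and "\<And>i. i \<in> C \<Longrightarrow> \<phi> i \<in> indsp G K (\<kappa> i)"
    and "(\<Sum>i\<in>C. \<phi> i) = 0" "i \<in> C"
  shows "\<phi> i = 0"
proof -
  have tr: "\<phi> i (y \<otimes>\<^bsub>G\<^esub> s) * \<kappa> i s = \<phi> i y" if "i \<in> C" "y \<in> carrier G" "s \<in> K" for i y s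
    using assms(4)[OF that(1)] that by (simp add: indsp_def)
  have nz: "\<kappa> i s \<noteq> 0" if "i \<in> C" "s \<in> K" for i s
    using subgroup_character.\<kappa>_nz[OF assms(2)] that by blast
  have cl: "y \<otimes>\<^bsub>G\<^esub> s \<in> carrier G" if "y \<in> carrier G" "s \<in> K" for y s
  proof -
    interpret subgroup_character G K "\<kappa> i" using assms(2,6) by blast
    show ?thesis using that by simp
  qed
  \<comment> \<open>The induction keeps only the transformation law and drops the support condition,
    which the auxiliary functions then need not satisfy.\<close>
  have main: "\<psi> i y = 0"
    if "finite B" "B \<subseteq> C" "\<And>i y s. i \<in> B \<Longrightarrow> y \<in> carrier G \<Longrightarrow> s \<in> K \<Longrightarrow> \<psi> i (y \<otimes>\<^bsub>G\<^esub> s) * \<kappa> i s = \<psi> i y"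
      "\<And>y. y \<in> carrier G \<Longrightarrow> (\<Sum>i\<in>B. \<psi> i y) = 0" "i \<in> B" "y \<in> carrier G" for B and \<psi> :: "'i \<Rightarrow> 'g \<Rightarrow> 'f" and i y
    using that
  proof (induction B arbitrary: \<psi> i y rule: finite_induct)
    case empty
    then show ?case by simp
  next
    case (insert j B)
    have B0: "\<psi> k y = 0" if k: "k \<in> B" and y: "y \<in> carrier G" for k y
    proof -
      have "k \<noteq> j" "k \<in> C" "j \<in> C" using k insert by auto
      then obtain s where s: "s \<in> K" "\<kappa> k s \<noteq> \<kappa> j s" using assms(3) by blast
      \<comment> \<open>Translating the relation by \<open>s\<close>, multiplying by
        \<open>\<kappa> j s\<close> and subtracting the original kills the term of \<open>j\<close>,
        while the coefficient of \<open>k\<close> stays nonzero because \<open>s\<close> separates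
        the two characters.\<close>
      define \<eta> where "\<eta> = (\<lambda>i y. (\<kappa> j s / \<kappa> i s - 1) * \<psi> i y)"
      have sh: "\<psi> i (z \<otimes>\<^bsub>G\<^esub> s) = \<psi> i z / \<kappa> i s" if "i \<in> insert j B" "z \<in> carrier G" for i z
        using insert.prems(2)[OF that s(1)] nz[of i s] that s(1) insert.prems(1) by (auto simp: field_simps)
      have "\<eta> k y = 0"
      proof (rule insert.IH[OF _ _ _ k y])
        show "B \<subseteq> C" using insert.prems(1) by blast
        show "\<eta> i (z \<otimes>\<^bsub>G\<^esub> t) * \<kappa> i t = \<eta> i z" if "i \<in> B" "z \<in> carrier G" "t \<in> K" for i z t
          using insert.prems(2)[of i z t] that by (simp add: \<eta>_def mult.assoc)
        fix z assume z: "z \<in> carrier G"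
        have "(\<Sum>i\<in>insert j B. \<eta> i z) = \<kappa> j s * (\<Sum>i\<in>insert j B. \<psi> i (z \<otimes>\<^bsub>G\<^esub> s)) - (\<Sum>i\<in>insert j B. \<psi> i z)"
          unfolding sum_distrib_left sum_subtractf[symmetric]
          by (intro sum.cong refl) (use sh z in \<open>auto simp: \<eta>_def algebra_simps\<close>)
        also have "\<dots> = 0" using insert.prems(3)[OF z] insert.prems(3)[OF cl[OF z s(1)]] by simp
        finally show "(\<Sum>i\<in>B. \<eta> i z) = 0"
          using insert.hyps nz[OF \<open>j \<in> C\<close> s(1)] by (simp add: \<eta>_def)
      qed
      then show ?thesis using s(2) nz[OF \<open>k \<in> C\<close> s(1)] by (auto simp: \<eta>_def field_simps)
    qed
    show ?case
    proof (cases "i = j")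
      case True
      then show ?thesis using insert.prems(3)[OF insert.prems(5)] insert.hyps B0[OF _ insert.prems(5)] by simp
    next
      case False
      then show ?thesis using B0 insert.prems by blast
    qed
  qed
  have "\<phi> i y = 0" if y: "y \<in> carrier G" for y
  proof (rule main[OF assms(1) order_refl tr _ assms(6) y])
    show "(\<Sum>i\<in>C. \<phi> i z) = 0" for z using fun_cong[OF assms(5), of z] by (simp add: sum_apply)
  qed
  moreover have "\<phi> i y = 0" if "y \<notin> carrier G" for y
    using assms(4,6) that by (simp add: indsp_def)
  ultimately have "\<phi> i y = 0 y" for y by (cases "y \<in> carrier G") simp_all
  then show ?thesis by (rule ext)
qed

section \<open>The quotient \<open>S\<close> and its characters\<close>

locale comm_basic_data = basic_data +
  assumes finR: "finite (UNIV :: 'b set)" and triple: "\<not> special_triple D"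
    and comm: "comm_group (S_grp D :: ('a \<Rightarrow> 'a \<Rightarrow> 'b) set monoid)"
begin

abbreviation S :: "('a \<Rightarrow> 'a \<Rightarrow> 'b) set monoid" where "S \<equiv> S_grp D"

text \<open>\<open>extends_lambda\<close> speaks of left cosets, the quotient group of right ones;
  normality of \<open>H\<close> lets one map serve both.\<close>

definition q :: "('a \<Rightarrow> 'a \<Rightarrow> 'b) \<Rightarrow> ('a \<Rightarrow> 'a \<Rightarrow> 'b) set" where
  "q x = x <#\<^bsub>mclain\<^esub> H"

sublocale S: comm_group S
  by (rule comm)

sublocale LH: subgroup_character M H "lambda_char D f"
  by (rule subgroup_character_H)

sublocale LI: subgroup_character M I lambda_ext
  by (rule subgroup_character_lambda_ext[OF triple])

lemma q_rcoset: "x \<in> I \<Longrightarrow> q x = H #>\<^bsub>mclain_sub I\<^esub> x"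
  using normal.coset_eq[OF H_normal] by (simp add: q_def l_coset_def)

lemma q_closed: "x \<in> I \<Longrightarrow> q x \<in> carrier S"
  by (auto simp: q_rcoset S_grp_def FactGroup_def RCOSETS_def)

lemma carrier_S: "carrier S = q ` I"
  by (auto simp: q_rcoset S_grp_def FactGroup_def RCOSETS_def)

lemma q_mult: "x \<in> I \<Longrightarrow> y \<in> I \<Longrightarrow> q (x \<star> y) = q x \<otimes>\<^bsub>S\<^esub> q y"
  using hom_mult[OF normal.r_coset_hom_Mod[OF H_normal], of x y] LI.K.m_closed[of x y]
  by (simp add: q_rcoset S_grp_def)

lemma q_H: "h \<in> H \<Longrightarrow> q h = \<one>\<^bsub>S\<^esub>"
proof -
  assume h: "h \<in> H"
  interpret sub: group "mclain_sub I" by (rule mclain.subgroup_imp_group[OF I_subgroup])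
  have "H #>\<^bsub>mclain_sub I\<^esub> h = H"
    by (rule subgroup.rcos_const[OF normal_imp_subgroup[OF H_normal] sub.is_group h])
  then show ?thesis using h H_sub_I by (simp add: q_rcoset subset_iff S_grp_def FactGroup_def)
qed

lemma q_eqI: "x \<in> I \<Longrightarrow> y \<in> I \<Longrightarrow> inv\<^bsub>M\<^esub> x \<star> y \<in> H \<Longrightarrow> q x = q y"
proof -
  assume x: "x \<in> I" and y: "y \<in> I" and h: "inv\<^bsub>M\<^esub> x \<star> y \<in> H"
  have c: "x \<in> carrier M" "y \<in> carrier M" using x y I_carrier by auto
  have "y = x \<star> (inv\<^bsub>M\<^esub> x \<star> y)" using c by (simp flip: mclain.m_assoc)
  then have "q y = q x \<otimes>\<^bsub>S\<^esub> q (inv\<^bsub>M\<^esub> x \<star> y)" using q_mult[OF x, of "inv\<^bsub>M\<^esub> x \<star> y"] h H_sub_I by auto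
  then show ?thesis using q_H[OF h] q_closed[OF x] by simp
qed

lemma q_eqD: "x \<in> I \<Longrightarrow> y \<in> I \<Longrightarrow> q x = q y \<Longrightarrow> inv\<^bsub>M\<^esub> x \<star> y \<in> H"
proof -
  assume x: "x \<in> I" and y: "y \<in> I" and eq: "q x = q y"
  have c: "x \<in> carrier M" "y \<in> carrier M" using x y I_carrier by auto
  have "y \<star> \<one>\<^bsub>M\<^esub> \<in> q y" unfolding q_def l_coset_def using LH.K.one_closed by blast
  then have "y \<in> q x" using c eq by simp
  then obtain h where h: "h \<in> H" "y = x \<star> h" unfolding q_def l_coset_def by blast
  then have "inv\<^bsub>M\<^esub> x \<star> y = h" using c H_carrier by (simp flip: mclain.m_assoc)
  then show ?thesis using h by simp
qed

text \<open>That \<open>S\<close> is abelian, in the form that the operators on functions need: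
  \<open>x y\<close> and \<open>y x\<close> differ by an element of \<open>H\<close> on the
  right.\<close>

lemma q_comm: "x \<in> I \<Longrightarrow> y \<in> I \<Longrightarrow> inv\<^bsub>M\<^esub> (y \<star> x) \<star> (x \<star> y) \<in> H"
  by (rule q_eqD) (simp_all add: q_mult LI.K.m_closed S.m_comm q_closed)

text \<open>Any element of \<open>D\<close> serves equally well here; \<open>SOME\<close> fixes
  one.\<close>

definition unit_values :: "'c set" where "unit_values = range (f (SOME d. d \<in> D))"

lemma prim_some: "right_primitive (f (SOME d. d \<in> D))"
  using prim D_ne some_in_eq by blast

sublocale units: finite_unit_group unit_values
proof
  note \<mu> = right_primitiveD[OF prim_some]
  show "finite unit_values" using finR by (simp add: unit_values_def)
  show "1 \<in> unit_values" unfolding unit_values_def \<mu>(3)[symmetric] by (rule rangeI)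
  show "0 \<notin> unit_values" using \<mu>(1) by (auto simp: unit_values_def)
  fix u v assume "u \<in> unit_values" "v \<in> unit_values"
  then obtain a b where "u = f (SOME d. d \<in> D) a" "v = f (SOME d. d \<in> D) b" unfolding unit_values_def by blast
  then show "u * v \<in> unit_values" unfolding unit_values_def by (simp only: \<mu>(2)[symmetric] rangeI)
qed

abbreviation N :: nat where "N \<equiv> units.N"

text \<open>The right ideal \<open>N R\<close> lies in the kernel of a right primitive character.\<close>

lemma N_mult_zero: "of_nat N * (r :: 'b) = 0"
proof -
  let ?\<mu> = "f (SOME d. d \<in> D)"
  note \<mu> = right_primitiveD[OF prim_some]
  have pw: "?\<mu> (of_nat k * r) = ?\<mu> r ^ k" for k r
    by (induction k) (simp_all add: \<mu> distrib_right)
  let ?J = "{of_nat N * r |r. True} :: 'b set"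
  have "right_ideal ?J"
    unfolding right_ideal_def
    by (auto intro: exI[of _ 0] exI[of _ "_ - _"] simp: mult.assoc simp flip: right_diff_distrib)
  moreover have "?J \<subseteq> {r. ?\<mu> r = 1}" using units.power_N by (auto simp: pw unit_values_def)
  ultimately have "?J = {0}" using prim_some unfolding right_primitive_def by blast
  then show ?thesis by blast
qed

lemma root_elem_pow: "\<alpha> < \<beta> \<Longrightarrow> root_elem (\<alpha>, \<beta>) (r :: 'b) [^]\<^bsub>mclain\<^esub> (k::nat) = root_elem (\<alpha>, \<beta>) (of_nat k * r)"
  by (induction k) (simp_all add: root_elem_zero root_elem_add distrib_right add.commute)

lemma q_pow: "x \<in> I \<Longrightarrow> q (x [^]\<^bsub>M\<^esub> (k::nat)) = q x [^]\<^bsub>S\<^esub> k \<and> x [^]\<^bsub>M\<^esub> k \<in> I"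
  by (induction k) (simp_all add: q_H LH.K.one_closed LI.K.one_closed q_mult LI.K.m_closed)

lemma root_Gamma1_I: "d \<in> Gamma D \<union> Omega D \<Longrightarrow> root_elem d r \<in> I"
  unfolding I_grp_def by (rule mem_mclain_gen_root)

lemma root_Gamma_H: "d \<in> Gamma D \<Longrightarrow> root_elem d r \<in> H"
  unfolding H_grp_def by (rule mem_mclain_gen_root)

text \<open>Root elements of \<open>Gamma D\<close> are absorbed by \<open>H\<close>, and the
  inverse of a root element is again one, so neither needs a case of its own.\<close>

lemma I_induct [consumes 1, case_names root_Gamma root_Omega mult]:
  assumes "x \<in> I"
    and H: "\<And>h. h \<in> H \<Longrightarrow> P h"
    and O: "\<And>d r. d \<in> Omega D \<Longrightarrow> P (root_elem d r)"
    and mult: "\<And>x y. x \<in> I \<Longrightarrow> y \<in> I \<Longrightarrow> P x \<Longrightarrow> P y \<Longrightarrow> P (x \<star> y)"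
  shows "P x"
proof -
  have root: "P (root_elem d r)" if "d \<in> Gamma D \<union> Omega D" for d r
    using that H[OF root_Gamma_H] O by blast
  have "x \<in> generate M {root_elem d r |d r. d \<in> Gamma D \<union> Omega D}"
    using assms(1) by (simp add: I_grp_def mclain_gen_def)
  then have "x \<in> I \<and> P x"
  proof (induction rule: generate.induct)
    case one
    show ?case using H[OF LH.K.one_closed] LI.K.one_closed by blast
  next
    case (incl h)
    then show ?case using root root_Gamma1_I by blast
  next
    case (inv h)
    then obtain d r where h: "h = root_elem d r" "d \<in> Gamma D \<union> Omega D" by blast
    obtain \<alpha> \<beta> where d: "d = (\<alpha>, \<beta>)" by (cases d)
    have "\<alpha> < \<beta>" using h(2) Gamma1_sub unfolding d by (auto simp: Phi_def)
    then have "inv\<^bsub>M\<^esub> h = root_elem d (- r)" by (simp add: h(1) d inv_root_elem)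
    then show ?case using root[OF h(2)] root_Gamma1_I[OF h(2)] by simp
  next
    case (eng x y)
    then show ?case using mult LI.K.m_closed by blast
  qed
  then show ?thesis by blast
qed

text \<open>A root element raised to the power \<open>N\<close> has the entry \<open>N r\<close>,
  which is zero; in an abelian group the bound on the order extends to products.\<close>

lemma q_pow_N: "x \<in> I \<Longrightarrow> q x [^]\<^bsub>S\<^esub> N = \<one>\<^bsub>S\<^esub>"
proof (induction rule: I_induct)
  case (root_Gamma h)
  then show ?case by (simp add: q_H)
next
  case (root_Omega d r)
  obtain \<alpha> \<beta> where d: "d = (\<alpha>, \<beta>)" by (cases d)
  have lt: "\<alpha> < \<beta>" using root_Omega Omega_sub unfolding d by (auto simp: Phi_def)
  have "root_elem d r \<in> I" using root_Omega by (intro root_Gamma1_I) blast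
  then have "q (root_elem d r) [^]\<^bsub>S\<^esub> N = q (root_elem d r [^]\<^bsub>M\<^esub> N)" using q_pow by simp
  also have "root_elem d r [^]\<^bsub>M\<^esub> N = \<one>\<^bsub>M\<^esub>" using lt by (simp add: d root_elem_pow N_mult_zero root_elem_zero)
  finally show ?case using q_H[OF LH.K.one_closed] by simp
next
  case (mult x y)
  then show ?case by (simp add: q_mult S.pow_mult_distrib S.m_comm q_closed)
qed

lemma pow_N_H: "x \<in> I \<Longrightarrow> x [^]\<^bsub>M\<^esub> N \<in> H"
proof -
  assume x: "x \<in> I"
  have xN: "x [^]\<^bsub>M\<^esub> N \<in> I" using q_pow[OF x] by blast
  have "q \<one>\<^bsub>M\<^esub> = q (x [^]\<^bsub>M\<^esub> N)" using q_pow[OF x, of N] q_pow_N[OF x] q_H[OF LH.K.one_closed] by simp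
  then have "inv\<^bsub>M\<^esub> \<one>\<^bsub>M\<^esub> \<star> x [^]\<^bsub>M\<^esub> N \<in> H" by (rule q_eqD[OF LI.K.one_closed xN])
  then show ?thesis using I_carrier[OF xN] by simp
qed

lemma mem_Irr: "(\<chi> :: _ \<Rightarrow> 'c) \<in> Irr S \<longleftrightarrow> linear_character S \<chi>"
proof
  assume "\<chi> \<in> Irr S"
  then show "linear_character S \<chi>"
    by (rule units.Irr_linear_character[OF comm, rotated]) (auto simp: carrier_S q_pow_N)
next
  assume "linear_character S \<chi>"
  then show "\<chi> \<in> Irr S" by (rule linear_character_in_Irr[OF S.is_group])
qed

lemma finite_S: "finite (carrier S)"
proof -
  obtain A where A: "finite A" "A \<subseteq> I" "\<And>x. x \<in> I \<Longrightarrow> \<exists>a\<in>A. inv\<^bsub>M\<^esub> a \<star> x \<in> H"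
    by (rule finite_index[OF finR]) blast
  have "carrier S \<subseteq> q ` A"
  proof
    fix C assume "C \<in> carrier S"
    then obtain x where x: "x \<in> I" "C = q x" by (auto simp: carrier_S)
    then obtain a where "a \<in> A" "inv\<^bsub>M\<^esub> a \<star> x \<in> H" using A(3) by blast
    then show "C \<in> q ` A" using q_eqI[of a x] x A(2) by blast
  qed
  then show ?thesis using A(1) by (metis finite_imageI finite_subset)
qed

lemma linear_character_pow:
  assumes "linear_character S \<chi>" "C \<in> carrier S"
  shows "\<chi> (C [^]\<^bsub>S\<^esub> (k::nat)) = \<chi> C ^ k"
  using assms linear_character_one[OF S.is_group assms(1)]
  by (induction k) (auto simp: linear_character_def mult.commute)

text \<open>All values are \<open>N\<close>-th roots of unity, a finite set, and \<open>S\<close> is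
  finite.\<close>

lemma finite_Irr: "finite (Irr S :: (_ \<Rightarrow> 'c) set)"
proof -
  have fin: "finite {x :: 'c. x ^ N = 1}" using card_le_exponent[OF units.N_pos, of "{x :: 'c. x ^ N = 1}"] by blast
  have "\<chi> C ^ N = 1" if "linear_character S \<chi>" "C \<in> carrier S" for \<chi> :: "_ \<Rightarrow> 'c" and C
    using linear_character_pow[OF that, of N] linear_character_one[OF S.is_group that(1)] that(2)
    by (auto simp: carrier_S q_pow_N)
  then have "\<chi> \<in> carrier S \<rightarrow>\<^sub>E {x. x ^ N = 1}" if "\<chi> \<in> Irr S" for \<chi> :: "_ \<Rightarrow> 'c"
    using that mem_Irr[of \<chi>] by (intro PiE_I) (auto simp: linear_character_def extensional_def)
  then have "(Irr S :: (_ \<Rightarrow> 'c) set) \<subseteq> (carrier S \<rightarrow>\<^sub>E {x. x ^ N = 1})" by blast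
  then show ?thesis by (rule finite_subset) (intro finite_PiE finite_S fin)
qed

definition ext_char :: "(('a \<Rightarrow> 'a \<Rightarrow> 'b) set \<Rightarrow> 'c) \<Rightarrow> ('a \<Rightarrow> 'a \<Rightarrow> 'b) \<Rightarrow> 'c" where
  "ext_char \<chi> = (\<lambda>s\<in>I. lambda_ext s * \<chi> (q s))"

lemma subgroup_character_ext_char:
  assumes "\<chi> \<in> Irr S"
  shows "subgroup_character M I (ext_char \<chi>)"
proof (intro subgroup_character.intro subgroup_character_axioms.intro mclain_group I_subgroup)
  have \<chi>: "linear_character S \<chi>" using assms mem_Irr by blast
  show "ext_char \<chi> k \<noteq> 0" if "k \<in> I" for k
    using that \<chi> q_closed[OF that] LI.\<kappa>_nz[OF that] by (simp add: ext_char_def linear_character_def)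
  show "ext_char \<chi> (k \<star> l) = ext_char \<chi> k * ext_char \<chi> l" if "k \<in> I" "l \<in> I" for k l
    using that \<chi> q_closed LI.\<kappa>_mult LI.K.m_closed by (simp add: ext_char_def linear_character_def q_mult)
qed

lemma ext_char_H:
  assumes "\<chi> \<in> Irr S" "h \<in> H"
  shows "ext_char \<chi> h = lambda_char D f h"
proof -
  have "\<chi> \<one>\<^bsub>S\<^esub> = 1" using assms(1) mem_Irr linear_character_one[OF S.is_group] by blast
  then show ?thesis using assms(2) H_sub_I by (simp add: ext_char_def q_H lambda_ext_H subset_iff)
qed

text \<open>The group \<open>I\<close> is generated by the root elements of \<open>Gamma D\<close>
  and \<open>Omega D\<close>. On the former the value is forced by \<open>H\<close>; on the latter
  \<open>lambda_ext\<close> is 1, so the product takes the value of \<open>\<chi>\<close>.\<close>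

lemma extends_lambda_iff:
  assumes \<chi>: "\<chi> \<in> Irr S"
  shows "extends_lambda D f \<chi> \<kappa> \<longleftrightarrow> \<kappa> = ext_char \<chi>"
proof -
  interpret e: subgroup_character M I "ext_char \<chi>" by (rule subgroup_character_ext_char[OF \<chi>])
  have lin: "linear_character (mclain_sub I) (ext_char \<chi>)"
    using e.\<kappa>_nz e.\<kappa>_mult by (auto simp: linear_character_def) (simp add: ext_char_def)
  have Om: "ext_char \<chi> (root_elem d r) = \<chi> (root_elem d r <#\<^bsub>mclain\<^esub> H)" if "d \<in> Omega D" for d r
    using that root_Gamma1_I[of d r] by (simp add: ext_char_def lambda_ext_Omega q_def)
  show ?thesis
  proof
    assume ex: "extends_lambda D f \<chi> \<kappa>"
    show "\<kappa> = ext_char \<chi>"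
    proof (rule linear_character_eqI[OF Gamma1_sub])
      show "linear_character (mclain_sub (mclain_gen (Gamma D \<union> Omega D))) \<kappa>"
        using ex unfolding extends_lambda_def I_grp_def by blast
      show "linear_character (mclain_sub (mclain_gen (Gamma D \<union> Omega D))) (ext_char \<chi>)"
        using lin unfolding I_grp_def .
      fix d and r :: 'b assume "d \<in> Gamma D \<union> Omega D"
      then consider "d \<in> Gamma D" | "d \<in> Omega D" by blast
      then show "\<kappa> (root_elem d r) = ext_char \<chi> (root_elem d r)"
      proof cases
        case 1
        then have "root_elem d r \<in> H" by (rule root_Gamma_H)
        then show ?thesis using ex ext_char_H[OF \<chi>] unfolding extends_lambda_def by metis
      next
        case 2
        then show ?thesis using ex Om[OF 2] unfolding extends_lambda_def by metis
      qed
    qed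
  next
    assume "\<kappa> = ext_char \<chi>"
    then show "extends_lambda D f \<chi> \<kappa>"
      using lin Om ext_char_H[OF \<chi>] unfolding extends_lambda_def by blast
  qed
qed

lemma W1_eq:
  assumes "\<chi> \<in> Irr S"
  shows "W1 D f \<chi> = char_module (ext_char \<chi>)"
proof -
  have "(THE \<kappa>. extends_lambda D f \<chi> \<kappa>) = ext_char \<chi>"
    by (rule the_equality) (simp_all add: extends_lambda_iff[OF assms])
  then show ?thesis by (simp add: W1_def)
qed

lemma ext_char_inj:
  assumes "\<chi> \<in> Irr S" "\<psi> \<in> Irr S" "\<And>s. s \<in> I \<Longrightarrow> ext_char \<chi> s = ext_char \<psi> s"
  shows "\<chi> = \<psi>"
proof
  fix C
  show "\<chi> C = \<psi> C"
  proof (cases "C \<in> carrier S")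
    case True
    then obtain x where "x \<in> I" "C = q x" by (auto simp: carrier_S)
    then show ?thesis using assms(3)[of x] LI.\<kappa>_nz[of x] by (simp add: ext_char_def)
  next
    case False
    then show ?thesis using assms(1,2) by (simp add: mem_Irr linear_character_def extensional_def)
  qed
qed

section \<open>Twisted right translation and its eigenspaces\<close>

abbreviation YH :: "(('a \<Rightarrow> 'a \<Rightarrow> 'b) \<Rightarrow> 'c) set" where
  "YH \<equiv> indsp M H (lambda_char D f)"

text \<open>The factor \<open>lambda_ext s\<close> cancels the transformation law on
  \<open>H\<close>: elements of \<open>H\<close> act trivially on \<open>YH\<close>, and what
  remains is an action of \<open>S\<close>.\<close>

definition Rop :: "('a \<Rightarrow> 'a \<Rightarrow> 'b) \<Rightarrow> (('a \<Rightarrow> 'a \<Rightarrow> 'b) \<Rightarrow> 'c) \<Rightarrow> ('a \<Rightarrow> 'a \<Rightarrow> 'b) \<Rightarrow> 'c" where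
  "Rop s \<phi> = (\<lambda>y. if y \<in> carrier M then lambda_ext s * \<phi> (y \<star> s) else 0)"

lemma Rop_add: "Rop s (\<phi> + \<psi>) = Rop s \<phi> + Rop s \<psi>"
  by (auto simp: Rop_def distrib_left)

lemma Rop_scale: "Rop s (\<lambda>y. c * \<phi> y) = (\<lambda>y. c * Rop s \<phi> y)"
  by (auto simp: Rop_def)

lemma Rop_sum: "Rop s (\<lambda>y. \<Sum>i\<in>A. c i * \<phi> i y) = (\<lambda>y. \<Sum>i\<in>A. c i * Rop s (\<phi> i) y)"
  by (auto simp: Rop_def sum_distrib_left mult.left_commute)

lemma Rop_mult: "s \<in> I \<Longrightarrow> t \<in> I \<Longrightarrow> Rop s (Rop t \<phi>) = Rop (s \<star> t) \<phi>"
  using I_carrier by (auto simp: Rop_def LI.\<kappa>_mult mclain.m_assoc fun_eq_iff)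

lemma Rop_H: "h \<in> H \<Longrightarrow> \<phi> \<in> YH \<Longrightarrow> Rop h \<phi> = \<phi>"
  by (auto simp: Rop_def indsp_def lambda_ext_H fun_eq_iff mult.commute)

lemma Rop_comm:
  assumes s: "s \<in> I" and t: "t \<in> I" and \<phi>: "\<phi> \<in> YH"
  shows "Rop s (Rop t \<phi>) = Rop t (Rop s \<phi>)"
proof -
  define h where "h = inv\<^bsub>M\<^esub> (t \<star> s) \<star> (s \<star> t)"
  have h: "h \<in> H" unfolding h_def by (rule q_comm[OF s t])
  have c: "s \<in> carrier M" "t \<in> carrier M" using s t I_carrier by auto
  have ts: "t \<star> s \<in> I" using s t LI.K.m_closed by blast
  have "s \<star> t = (t \<star> s) \<star> h" unfolding h_def using c by (simp flip: mclain.m_assoc)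
  then have "Rop s (Rop t \<phi>) = Rop (t \<star> s) (Rop h \<phi>)"
    using Rop_mult[OF s t] Rop_mult[OF ts, of h] h H_sub_I by auto
  then show ?thesis using Rop_H[OF h \<phi>] Rop_mult[OF t s] by simp
qed

text \<open>Conjugation by \<open>s\<close> preserves \<open>H\<close> and its character, the latter
  because the character extends to \<open>I\<close>. So twisted translation merely moves the coset
  and rescales.\<close>

lemma Rop_ebase:
  assumes s: "s \<in> I" and g: "g \<in> carrier M"
  shows "Rop s (ebase M H (lambda_char D f) g)
    = (\<lambda>y. lambda_ext s * ebase M H (lambda_char D f) (g \<star> inv\<^bsub>M\<^esub> s) y)"
proof
  fix y
  show "Rop s (ebase M H (lambda_char D f) g) y
    = lambda_ext s * ebase M H (lambda_char D f) (g \<star> inv\<^bsub>M\<^esub> s) y"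
  proof (cases "y \<in> carrier M")
    case y: True
    define a where "a = inv\<^bsub>M\<^esub> y \<star> g"
    have sc: "s \<in> carrier M" using s I_carrier by blast
    have si: "inv\<^bsub>M\<^esub> s \<in> I" using s by simp
    have ac: "a \<in> carrier M" using y g by (simp add: a_def)
    have 1: "inv\<^bsub>M\<^esub> (y \<star> s) \<star> g = inv\<^bsub>M\<^esub> s \<star> a"
      using y g sc by (simp add: a_def mclain.inv_mult_group mclain.m_assoc)
    have 2: "inv\<^bsub>M\<^esub> y \<star> (g \<star> inv\<^bsub>M\<^esub> s) = a \<star> inv\<^bsub>M\<^esub> s"
      using y g sc by (simp add: a_def mclain.m_assoc)
    have conj: "x \<star> h \<star> inv\<^bsub>M\<^esub> x \<in> H" if x: "x \<in> I" and h: "h \<in> H" for x h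
      using normal.inv_op_closed2[OF H_normal, of x h] that mclain.m_inv_consistent[OF I_subgroup x] by simp
    have iff: "inv\<^bsub>M\<^esub> s \<star> a \<in> H \<longleftrightarrow> a \<star> inv\<^bsub>M\<^esub> s \<in> H"
    proof
      assume "inv\<^bsub>M\<^esub> s \<star> a \<in> H"
      then have "s \<star> (inv\<^bsub>M\<^esub> s \<star> a) \<star> inv\<^bsub>M\<^esub> s \<in> H" by (rule conj[OF s])
      then show "a \<star> inv\<^bsub>M\<^esub> s \<in> H" using sc ac by (simp flip: mclain.m_assoc)
    next
      assume "a \<star> inv\<^bsub>M\<^esub> s \<in> H"
      then have "inv\<^bsub>M\<^esub> s \<star> (a \<star> inv\<^bsub>M\<^esub> s) \<star> inv\<^bsub>M\<^esub> (inv\<^bsub>M\<^esub> s) \<in> H" by (rule conj[OF si])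
      then show "inv\<^bsub>M\<^esub> s \<star> a \<in> H" using sc ac by (simp add: mclain.m_assoc)
    qed
    show ?thesis
    proof (cases "inv\<^bsub>M\<^esub> s \<star> a \<in> H")
      case True
      have "s \<star> (inv\<^bsub>M\<^esub> s \<star> a) \<in> I" using True s H_sub_I LI.K.m_closed by blast
      then have aI: "a \<in> I" using sc ac by (simp flip: mclain.m_assoc)
      \<comment> \<open>The extension has commuting values, so the order of \<open>a\<close> and the
        inverse of \<open>s\<close> does not matter to it.\<close>
      have "lambda_char D f (inv\<^bsub>M\<^esub> s \<star> a) = lambda_char D f (a \<star> inv\<^bsub>M\<^esub> s)"
        using True iff LI.\<kappa>_mult[OF si aI] LI.\<kappa>_mult[OF aI si] by (simp flip: lambda_ext_H)
      then show ?thesis using True iff y sc by (simp add: Rop_def ebase_def 1 2)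
    next
      case False
      then show ?thesis using iff y sc by (simp add: Rop_def ebase_def 1 2)
    qed
  qed (simp add: Rop_def ebase_def)
qed

text \<open>Checking coset functions suffices, which spares an argument about transformation law and
  support of a translated function.\<close>

lemma Rop_YH:
  assumes s: "s \<in> I" and \<phi>: "\<phi> \<in> YH"
  shows "Rop s \<phi> \<in> YH"
  using \<phi> unfolding LH.indsp_eq_span
proof (rule fs.span_induct)
  fix \<psi> assume "\<psi> \<in> ebase M H (lambda_char D f) ` carrier M"
  then obtain g where g: "g \<in> carrier M" "\<psi> = ebase M H (lambda_char D f) g" by blast
  have "g \<star> inv\<^bsub>M\<^esub> s \<in> carrier M" using g s I_carrier by simp
  then show "Rop s \<psi> \<in> fs.span (ebase M H (lambda_char D f) ` carrier M)"
    unfolding g(2) Rop_ebase[OF s g(1)] by (intro fs.span_scale fs.span_base imageI)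
next
  show "fs.subspace {\<psi>. Rop s \<psi> \<in> fs.span (ebase M H (lambda_char D f) ` carrier M)}"
  proof (rule fs.subspaceI; clarify)
    have "Rop s 0 = 0" by (auto simp: Rop_def)
    then show "Rop s 0 \<in> fs.span (ebase M H (lambda_char D f) ` carrier M)" by (simp only: fs.span_zero)
  qed (simp_all only: Rop_add Rop_scale fs.span_add fs.span_scale)
qed

text \<open>The eigenvalue may depend on \<open>s\<close>, and the zero function is
  included.\<close>

definition Eig :: "('a \<Rightarrow> 'a \<Rightarrow> 'b) set \<Rightarrow> (('a \<Rightarrow> 'a \<Rightarrow> 'b) \<Rightarrow> 'c) set" where
  "Eig A = {\<psi> \<in> YH. \<forall>s\<in>A. \<exists>c. Rop s \<psi> = (\<lambda>y. c * \<psi> y)}"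

text \<open>Simultaneous diagonalisation, one operator at a time: the eigenprojections for a new
  \<open>s\<close> commute with the operators already treated and so keep their
  eigenvectors.\<close>

lemma YH_eigen:
  assumes "finite A" "A \<subseteq> I"
  shows "YH \<subseteq> fs.span (Eig A)"
  using assms
proof (induction A rule: finite_induct)
  case empty
  have "Eig {} = YH" by (auto simp: Eig_def)
  then show ?case using fs.span_superset by metis
next
  case (insert s A)
  have s: "s \<in> I" and AI: "A \<subseteq> I" using insert.prems by auto
  have "\<psi> \<in> fs.span (Eig (insert s A))" if \<psi>: "\<psi> \<in> Eig A" for \<psi>
  proof -
    have \<psi>Y: "\<psi> \<in> YH" using \<psi> by (simp add: Eig_def)
    have si: "s [^]\<^bsub>M\<^esub> (i::nat) \<in> I" for i using q_pow[OF s] by blast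
    define w where "w = (\<lambda>y i. Rop (s [^]\<^bsub>M\<^esub> (i::nat)) \<psi> y)"
    have wN: "w y N = w y 0" for y
      using Rop_H[OF pow_N_H[OF s] \<psi>Y] Rop_H[OF LH.K.one_closed \<psi>Y] by (simp add: w_def)
    have w0: "w y 0 = \<psi> y" for y using Rop_H[OF LH.K.one_closed \<psi>Y] by (simp add: w_def)
    \<comment> \<open>Powers of \<open>s\<close> are periodic with period \<open>N\<close> because
      \<open>s\<close> to the power \<open>N\<close> lies in \<open>H\<close>, so these are the
      eigenprojections of \<open>\<psi>\<close>.\<close>
    define p where "p = (\<lambda>u y. \<Sum>i<N. inverse u ^ i * w y i)"
    have sum_p: "p u = (\<Sum>i<N. (\<lambda>y. inverse u ^ i * Rop (s [^]\<^bsub>M\<^esub> i) \<psi> y))" for u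
      by (simp add: p_def w_def fun_eq_iff sum_apply)
    have pY: "p u \<in> YH" for u
      unfolding sum_p
      by (intro fs.subspace_sum[OF LH.indsp_subspace] fs.subspace_scale[OF LH.indsp_subspace] Rop_YH si \<psi>Y)
    have Rp: "Rop t (p u) = (\<lambda>y. \<Sum>i<N. inverse u ^ i * Rop t (Rop (s [^]\<^bsub>M\<^esub> i) \<psi>) y)" for t u
      unfolding p_def w_def by (rule Rop_sum)
    have pE: "p u \<in> Eig (insert s A)" if u: "u \<in> unit_values" for u
      unfolding Eig_def
    proof (intro CollectI conjI pY ballI)
      fix t assume "t \<in> insert s A"
      then consider "t = s" | "t \<in> A" by blast
      then show "\<exists>c. Rop t (p u) = (\<lambda>y. c * p u y)"
      proof cases
        case 1
        have "Rop s (Rop (s [^]\<^bsub>M\<^esub> i) \<psi>) y = w y (Suc i)" for i y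
          using Rop_mult[OF s si] mclain.nat_pow_Suc2[OF I_carrier[OF s], of i] by (simp add: w_def)
        then have "Rop s (p u) = (\<lambda>y. \<Sum>i<N. inverse u ^ i * w y (Suc i))"
          unfolding Rp by (simp only:)
        also have "\<dots> = (\<lambda>y. u * p u y)"
          unfolding p_def by (intro ext units.shift_projection u wN)
        finally have "Rop s (p u) = (\<lambda>y. u * p u y)" .
        then show ?thesis using 1 by blast
      next
        case 2
        then obtain c where c: "Rop t \<psi> = (\<lambda>y. c * \<psi> y)" using \<psi> by (auto simp: Eig_def)
        have "Rop t (Rop (s [^]\<^bsub>M\<^esub> i) \<psi>) = (\<lambda>y. c * w y i)" for i
          using Rop_comm[OF _ si \<psi>Y, of t i] 2 AI by (auto simp: c Rop_scale w_def)
        then have "Rop t (p u) = (\<lambda>y. c * p u y)"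
          unfolding Rp by (simp add: p_def sum_distrib_left mult.left_commute)
        then show ?thesis by blast
      qed
    qed
    \<comment> \<open>The projections sum to \<open>N \<psi>\<close>, and \<open>N\<close> is
      invertible in \<open>F\<close>.\<close>
    have "\<psi> = (\<lambda>y. inverse (of_nat N) * (\<Sum>u\<in>unit_values. p u) y)"
      using units.sum_projections[of "w _"] units.of_nat_N by (simp add: fun_eq_iff sum_apply p_def w0)
    also have "\<dots> \<in> fs.span (Eig (insert s A))"
      by (intro fs.span_scale fs.span_sum fs.span_base pE)
    finally show ?thesis .
  qed
  then have "fs.span (Eig A) \<subseteq> fs.span (Eig (insert s A))"
    by (intro fs.span_minimal) auto
  then show ?case using insert.IH[OF AI] by blast
qed

text \<open>Eigenvectors for the generators in \<open>Omega D\<close> are eigenvectors for all of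
  \<open>I\<close>, since \<open>H\<close> acts trivially. The eigenvalues are multiplicative and
  trivial on \<open>H\<close>, so they come from a character of \<open>S\<close>.\<close>

lemma eigen_in_indsp:
  assumes \<psi>: "\<psi> \<in> Eig {root_elem d r |d r. d \<in> Omega D}" "\<psi> \<noteq> 0"
  shows "\<exists>\<chi>\<in>Irr S. \<psi> \<in> indsp M I (ext_char \<chi>)"
proof -
  have \<psi>Y: "\<psi> \<in> YH" using \<psi> by (simp add: Eig_def)
  obtain y0 where y0: "\<psi> y0 \<noteq> 0" using \<psi>(2) by (auto simp: fun_eq_iff)
  have ex: "\<exists>c. Rop s \<psi> = (\<lambda>y. c * \<psi> y)" if "s \<in> I" for s
    using that
  proof (induction rule: I_induct)
    case (root_Gamma h)
    then show ?case using Rop_H[OF _ \<psi>Y] by (intro exI[of _ 1]) simp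
  next
    case (root_Omega d r)
    then show ?case using \<psi>(1) unfolding Eig_def by blast
  next
    case (mult x y)
    then obtain a b where ab: "Rop x \<psi> = (\<lambda>y. a * \<psi> y)" "Rop y \<psi> = (\<lambda>y. b * \<psi> y)" by blast
    have "Rop (x \<star> y) \<psi> = Rop x (Rop y \<psi>)" by (rule Rop_mult[OF mult(1,2), symmetric])
    also have "\<dots> = (\<lambda>z. b * Rop x \<psi> z)" unfolding ab(2) by (rule Rop_scale)
    also have "\<dots> = (\<lambda>z. (b * a) * \<psi> z)" unfolding ab(1) mult.assoc ..
    finally have "Rop (x \<star> y) \<psi> = (\<lambda>z. (b * a) * \<psi> z)" .
    then show ?case by blast
  qed
  \<comment> \<open>Reading the eigenvalue off at a point where \<open>\<psi>\<close> is nonzero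
    makes it a well-defined function of \<open>s\<close>.\<close>
  define c where "c = (\<lambda>s. Rop s \<psi> y0 / \<psi> y0)"
  have c: "Rop s \<psi> = (\<lambda>y. c s * \<psi> y)" if "s \<in> I" for s
    using ex[OF that] y0 by (auto simp: c_def)
  have cH: "c h = 1" if "h \<in> H" for h using Rop_H[OF that \<psi>Y] y0 by (simp add: c_def)
  have cm: "c (x \<star> y) = c x * c y" if "x \<in> I" "y \<in> I" for x y
  proof -
    have "Rop (x \<star> y) \<psi> = Rop x (Rop y \<psi>)" by (rule Rop_mult[OF that, symmetric])
    also have "\<dots> = (\<lambda>z. c y * Rop x \<psi> z)" unfolding c[OF that(2)] by (rule Rop_scale)
    also have "\<dots> = (\<lambda>z. c y * (c x * \<psi> z))" unfolding c[OF that(1)] ..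
    finally have "Rop (x \<star> y) \<psi> y0 = c y * (c x * \<psi> y0)" by (rule fun_cong)
    moreover have "c (x \<star> y) = Rop (x \<star> y) \<psi> y0 / \<psi> y0" by (simp only: c_def)
    ultimately show ?thesis using y0 by simp
  qed
  have cnz: "c x \<noteq> 0" if x: "x \<in> I" for x
  proof
    assume "c x = 0"
    then have "c (x \<star> inv\<^bsub>M\<^esub> x) = 0" using cm[OF x, of "inv\<^bsub>M\<^esub> x"] x by simp
    then show False using cH[OF LH.K.one_closed] I_carrier[OF x] by simp
  qed
  have cq: "c x = c y" if "x \<in> I" "y \<in> I" "q x = q y" for x y
  proof -
    have h: "inv\<^bsub>M\<^esub> x \<star> y \<in> H" by (rule q_eqD[OF that])
    have "x \<star> (inv\<^bsub>M\<^esub> x \<star> y) = y" using that I_carrier by (simp flip: mclain.m_assoc)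
    then show ?thesis using cm[OF that(1), of "inv\<^bsub>M\<^esub> x \<star> y"] cH[OF h] h H_sub_I by auto
  qed
  \<comment> \<open>The inverse appears because the transformation law has the character on the side
    of the translated value: \<open>\<psi> (y \<star> k)\<close> times \<open>lambda_ext k\<close>
    equals \<open>c k\<close> times \<open>\<psi> y\<close>.\<close>
  define \<chi> where "\<chi> = (\<lambda>C\<in>carrier S. inverse (c (SOME x. x \<in> I \<and> q x = C)))"
  have \<chi>q: "\<chi> (q x) = inverse (c x)" if x: "x \<in> I" for x
  proof -
    let ?x = "SOME z. z \<in> I \<and> q z = q x"
    have "?x \<in> I \<and> q ?x = q x" by (rule someI[of _ x]) (use x in auto)
    then have "c ?x = c x" using cq[of ?x x] x by blast
    then show ?thesis using q_closed[OF x] by (simp add: \<chi>_def)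
  qed
  have "linear_character S \<chi>"
    unfolding linear_character_def
  proof (intro conjI ballI)
    show "\<chi> \<in> extensional (carrier S)" by (simp add: \<chi>_def)
    show "\<chi> C \<noteq> 0" if C: "C \<in> carrier S" for C
    proof -
      obtain x where "x \<in> I" "C = q x" using C by (auto simp: carrier_S)
      then show ?thesis using cnz[of x] by (simp add: \<chi>q)
    qed
    show "\<chi> (C \<otimes>\<^bsub>S\<^esub> E) = \<chi> C * \<chi> E" if C: "C \<in> carrier S" "E \<in> carrier S" for C E
    proof -
      obtain x y where xy: "x \<in> I" "C = q x" "y \<in> I" "E = q y" using C by (auto simp: carrier_S)
      then have "\<chi> (C \<otimes>\<^bsub>S\<^esub> E) = \<chi> (q (x \<star> y))" by (simp add: q_mult)
      also have "\<dots> = inverse (c (x \<star> y))" using xy by (intro \<chi>q LI.K.m_closed)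
      also have "\<dots> = \<chi> C * \<chi> E" using xy by (simp add: cm \<chi>q)
      finally show ?thesis .
    qed
  qed
  then have \<chi>I: "\<chi> \<in> Irr S" using mem_Irr by blast
  have "\<psi> \<in> indsp M I (ext_char \<chi>)"
    unfolding indsp_def
  proof (intro CollectI conjI allI impI ballI)
    show "\<psi> y = 0" if "y \<notin> carrier M" for y using \<psi>Y that by (simp add: indsp_def)
    show "\<psi> (y \<star> k) * ext_char \<chi> k = \<psi> y" if y: "y \<in> carrier M" and k: "k \<in> I" for y k
    proof -
      have "lambda_ext k * \<psi> (y \<star> k) = c k * \<psi> y" using fun_cong[OF c[OF k], of y] y by (simp add: Rop_def)
      then show ?thesis using k cnz[OF k] by (simp add: ext_char_def \<chi>q field_simps)
    qed
    obtain A where A: "finite A" "A \<subseteq> carrier M"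
      "\<And>y. y \<in> carrier M \<Longrightarrow> \<psi> y \<noteq> 0 \<Longrightarrow> \<exists>a\<in>A. inv\<^bsub>M\<^esub> a \<star> y \<in> H"
      using \<psi>Y unfolding indsp_def by auto
    show "\<exists>A. finite A \<and> A \<subseteq> carrier M \<and> (\<forall>y\<in>carrier M. \<psi> y \<noteq> 0 \<longrightarrow> (\<exists>a\<in>A. inv\<^bsub>M\<^esub> a \<star> y \<in> I))"
    proof (intro exI[of _ A] conjI A(1,2) ballI impI)
      fix y assume "y \<in> carrier M" "\<psi> y \<noteq> 0"
      then obtain a where "a \<in> A" "inv\<^bsub>M\<^esub> a \<star> y \<in> H" using A(3) by blast
      then show "\<exists>a\<in>A. inv\<^bsub>M\<^esub> a \<star> y \<in> I" using H_sub_I by (intro bexI[of _ a]) auto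
    qed
  qed
  then show ?thesis using \<chi>I by blast
qed

text \<open>Each coset of \<open>I\<close> splits into finitely many cosets of \<open>H\<close>, so
  finite support modulo \<open>I\<close> gives finite support modulo \<open>H\<close>; the products
  of representatives cover it.\<close>

lemma indsp_I_sub_YH:
  assumes \<chi>: "\<chi> \<in> Irr S"
  shows "indsp M I (ext_char \<chi>) \<subseteq> YH"
proof
  fix \<phi> assume \<phi>: "\<phi> \<in> indsp M I (ext_char \<chi>)"
  then obtain B where B: "finite B" "B \<subseteq> carrier M"
    "\<forall>y\<in>carrier M. \<phi> y \<noteq> 0 \<longrightarrow> (\<exists>a\<in>B. inv\<^bsub>M\<^esub> a \<star> y \<in> I)" unfolding indsp_def by blast
  obtain A where A: "finite A" "A \<subseteq> I" "\<And>x. x \<in> I \<Longrightarrow> \<exists>a\<in>A. inv\<^bsub>M\<^esub> a \<star> x \<in> H"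
    by (rule finite_index[OF finR]) blast
  let ?C = "(\<lambda>(b, a). b \<star> a) ` (B \<times> A)"
  show "\<phi> \<in> YH"
    unfolding indsp_def
  proof (intro CollectI conjI allI impI ballI exI[of _ ?C])
    show "\<phi> y = 0" if "y \<notin> carrier M" for y using \<phi> that by (simp add: indsp_def)
    show "\<phi> (y \<star> k) * lambda_char D f k = \<phi> y" if "y \<in> carrier M" "k \<in> H" for y k
      using \<phi> that H_sub_I ext_char_H[OF \<chi> that(2)] unfolding indsp_def by force
    show "finite ?C" using A B by blast
    show "?C \<subseteq> carrier M" using A(2) B(2) I_carrier by force
    fix y assume y: "y \<in> carrier M" "\<phi> y \<noteq> 0"
    then obtain b where b: "b \<in> B" "inv\<^bsub>M\<^esub> b \<star> y \<in> I" using B(3) by blast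
    obtain a where a: "a \<in> A" "inv\<^bsub>M\<^esub> a \<star> (inv\<^bsub>M\<^esub> b \<star> y) \<in> H" using A(3)[OF b(2)] by blast
    have c: "a \<in> carrier M" "b \<in> carrier M" using a b A(2) B(2) I_carrier by auto
    have "inv\<^bsub>M\<^esub> (b \<star> a) \<star> y \<in> H"
      using a(2) c y(1) by (simp add: mclain.inv_mult_group mclain.m_assoc)
    then show "\<exists>a\<in>?C. inv\<^bsub>M\<^esub> a \<star> y \<in> H" using a(1) b(1) by force
  qed
qed

text \<open>Only that the summands fill \<open>YH\<close> is at stake here; the directness of the
  sum is \<open>indsp_independent\<close>. Each common eigenvector lies in a single summand, and
  finiteness of \<open>R\<close> leaves finitely many operators to diagonalise.\<close>

lemma indsp_decomposition:
  "{\<Sum>\<chi>\<in>Irr S. \<phi> \<chi> |\<phi>. \<forall>\<chi>\<in>Irr S. \<phi> \<chi> \<in> indsp M I (ext_char \<chi>)} = YH" (is "?Z = YH")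
proof
  show "?Z \<subseteq> YH"
  proof
    fix x assume "x \<in> ?Z"
    then obtain \<phi> where \<phi>: "\<forall>\<chi>\<in>Irr S. \<phi> \<chi> \<in> indsp M I (ext_char \<chi>)" "x = (\<Sum>\<chi>\<in>Irr S. \<phi> \<chi>)" by blast
    show "x \<in> YH" unfolding \<phi>(2)
      by (intro fs.subspace_sum[OF LH.indsp_subspace]) (use \<phi>(1) indsp_I_sub_YH in blast)
  qed
  have sub: "fs.subspace (indsp M I (ext_char \<chi>))" if "\<chi> \<in> Irr S" for \<chi>
    by (rule subgroup_character.indsp_subspace[OF subgroup_character_ext_char[OF that]])
  have Zsub: "fs.subspace ?Z"
  proof (rule fs.subspaceI)
    show "0 \<in> ?Z"
      by (intro CollectI exI[of _ "\<lambda>_. 0"] conjI) (use fs.subspace_0[OF sub] in auto)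
  next
    fix x y assume "x \<in> ?Z" "y \<in> ?Z"
    then obtain \<phi> \<psi> where \<phi>: "\<forall>\<chi>\<in>Irr S. \<phi> \<chi> \<in> indsp M I (ext_char \<chi>)" "x = (\<Sum>\<chi>\<in>Irr S. \<phi> \<chi>)"
      and \<psi>: "\<forall>\<chi>\<in>Irr S. \<psi> \<chi> \<in> indsp M I (ext_char \<chi>)" "y = (\<Sum>\<chi>\<in>Irr S. \<psi> \<chi>)" by blast
    have "\<forall>\<chi>\<in>Irr S. \<phi> \<chi> + \<psi> \<chi> \<in> indsp M I (ext_char \<chi>)" using \<phi>(1) \<psi>(1) fs.subspace_add[OF sub] by blast
    moreover have "x + y = (\<Sum>\<chi>\<in>Irr S. \<phi> \<chi> + \<psi> \<chi>)" unfolding \<phi>(2) \<psi>(2) by (rule sum.distrib[symmetric])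
    ultimately show "x + y \<in> ?Z" by blast
  next
    fix c x assume "x \<in> ?Z"
    then obtain \<phi> where \<phi>: "\<forall>\<chi>\<in>Irr S. \<phi> \<chi> \<in> indsp M I (ext_char \<chi>)" "x = (\<Sum>\<chi>\<in>Irr S. \<phi> \<chi>)" by blast
    have "\<forall>\<chi>\<in>Irr S. (\<lambda>y. c * \<phi> \<chi> y) \<in> indsp M I (ext_char \<chi>)" using \<phi>(1) fs.subspace_scale[OF sub] by blast
    moreover have "(\<lambda>y. c * x y) = (\<Sum>\<chi>\<in>Irr S. (\<lambda>y. c * \<phi> \<chi> y))" unfolding \<phi>(2)
      by (simp add: fun_eq_iff sum_apply sum_distrib_left)
    ultimately show "(\<lambda>y. c * x y) \<in> ?Z" by blast
  qed
  let ?A = "{root_elem d r |d r. d \<in> Omega D} :: ('a \<Rightarrow> 'a \<Rightarrow> 'b) set"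
  have "?A = (\<lambda>(d, r). root_elem d r) ` (Omega D \<times> UNIV)" by auto
  then have fA: "finite ?A" using finite_Omega finR by simp
  have AI: "?A \<subseteq> I" using root_Gamma1_I by blast
  have "Eig ?A \<subseteq> ?Z"
  proof
    fix \<psi> assume \<psi>: "\<psi> \<in> Eig ?A"
    show "\<psi> \<in> ?Z"
    proof (cases "\<psi> = 0")
      case True
      then show ?thesis using fs.subspace_0[OF Zsub] by simp
    next
      case False
      then obtain \<chi> where \<chi>: "\<chi> \<in> Irr S" "\<psi> \<in> indsp M I (ext_char \<chi>)" using eigen_in_indsp[OF \<psi>] by blast
      define \<phi> where "\<phi> = (\<lambda>\<chi>'. if \<chi>' = \<chi> then \<psi> else 0)"
      have "\<forall>\<chi>'\<in>Irr S. \<phi> \<chi>' \<in> indsp M I (ext_char \<chi>')" using \<chi> fs.subspace_0[OF sub] by (auto simp: \<phi>_def simp del: zero_fun_apply)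
      moreover have "\<psi> = (\<Sum>\<chi>\<in>Irr S. \<phi> \<chi>)" using \<chi>(1) finite_Irr by (simp add: \<phi>_def)
      ultimately show ?thesis by blast
    qed
  qed
  then have "fs.span (Eig ?A) \<subseteq> ?Z" using Zsub by (rule fs.span_minimal)
  then show "YH \<subseteq> ?Z" using YH_eigen[OF fA AI] by blast
qed

text \<open>The basic module and the direct sum are modelled on the same space \<open>YH\<close>, so
  composing one model with the inverse of the other is the isomorphism.\<close>

lemma decomposition:
  shows "gmodule mclain (basic_module D f)"
    and "\<chi> \<in> Irr S \<Longrightarrow> gmodule mclain (ind mclain I (W1 D f \<chi>))"
    and "gmodule_iso mclain (basic_module D f) (direct_sum (Irr S) (\<lambda>\<chi>. ind mclain I (W1 D f \<chi>)))"
    and "\<chi> \<in> Irr S \<Longrightarrow> \<psi> \<in> Irr S \<Longrightarrow> \<chi> \<noteq> \<psi> \<Longrightarrow>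
      \<not> gmodule_iso mclain (ind mclain I (W1 D f \<chi>)) (ind mclain I (W1 D f \<psi>))"
proof -
  have M: "M\<lparr>carrier := carrier M\<rparr> = M" by simp
  obtain \<Psi> where m: "fun_model M (carrier M) (basic_module D f) YH \<Psi>" by (rule basic_fun_model)
  show "gmodule mclain (basic_module D f)"
    by (rule fun_model_gmodule[OF mclain_group mclain.subgroup_self m, unfolded M]) (rule LH.indsp_supp)
  have ex: "\<exists>\<Psi>. fun_model M (carrier M) (ind M I (W1 D f \<chi>)) (indsp M I (ext_char \<chi>)) \<Psi>" if \<chi>: "\<chi> \<in> Irr S" for \<chi>
  proof -
    interpret e: subgroup_character M I "ext_char \<chi>" by (rule subgroup_character_ext_char[OF \<chi>])
    obtain \<Psi> where "fun_model M (carrier M) (ind M I (char_module (ext_char \<chi>))) (indsp M I (ext_char \<chi>)) \<Psi>"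
      by (rule e.ind_fun_model_full)
    then show ?thesis unfolding W1_eq[OF \<chi>] by blast
  qed
  then obtain \<Phi> where m': "\<And>\<chi>. \<chi> \<in> Irr S \<Longrightarrow> fun_model M (carrier M) (ind M I (W1 D f \<chi>)) (indsp M I (ext_char \<chi>)) (\<Phi> \<chi>)"
    by metis
  show "gmodule mclain (ind mclain I (W1 D f \<chi>))" if \<chi>: "\<chi> \<in> Irr S"
    by (rule fun_model_gmodule[OF mclain_group mclain.subgroup_self m'[OF \<chi>], unfolded M])
      (rule subgroup_character.indsp_supp[OF subgroup_character_ext_char[OF \<chi>]])
  have dist: "\<exists>s\<in>I. ext_char \<chi> s \<noteq> ext_char \<psi> s" if "\<chi> \<in> Irr S" "\<psi> \<in> Irr S" "\<chi> \<noteq> \<psi>" for \<chi> \<psi> :: "_ \<Rightarrow> 'c"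
    using ext_char_inj[OF that(1,2)] that(3) by blast
  have "fun_model M (carrier M) (direct_sum (Irr S) (\<lambda>\<chi>. ind M I (W1 D f \<chi>)))
      {\<Sum>\<chi>\<in>Irr S. \<phi> \<chi> |\<phi>. \<forall>\<chi>\<in>Irr S. \<phi> \<chi> \<in> indsp M I (ext_char \<chi>)} (\<lambda>v. \<Sum>\<chi>\<in>Irr S. \<Phi> \<chi> (v \<chi>))"
  proof (rule direct_sum_fun_model[OF finite_Irr m'])
    show "fs.subspace (indsp M I (ext_char \<chi>))" if "\<chi> \<in> Irr S" for \<chi>
      by (rule subgroup_character.indsp_subspace[OF subgroup_character_ext_char[OF that]])
    fix \<phi> and \<chi> :: "_ \<Rightarrow> 'c"
    assume \<phi>: "\<And>\<chi>. \<chi> \<in> Irr S \<Longrightarrow> \<phi> \<chi> \<in> indsp M I (ext_char \<chi>)" "(\<Sum>\<chi>\<in>Irr S. \<phi> \<chi>) = 0" "\<chi> \<in> Irr S"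
    show "\<phi> \<chi> = 0"
    proof (rule indsp_independent[where \<phi> = \<phi> and C = "Irr S" and \<kappa> = ext_char and G = M and K = I])
      show "subgroup_character M I (ext_char \<chi>)" if "\<chi> \<in> Irr S" for \<chi>
        by (rule subgroup_character_ext_char[OF that])
      show "\<exists>s\<in>I. ext_char \<chi> s \<noteq> ext_char \<psi> s" if "\<chi> \<in> Irr S" "\<psi> \<in> Irr S" "\<chi> \<noteq> \<psi>" for \<chi> \<psi>
        by (rule dist[OF that])
    qed (use finite_Irr \<phi> in auto)
  qed
  then show "gmodule_iso mclain (basic_module D f) (direct_sum (Irr S) (\<lambda>\<chi>. ind mclain I (W1 D f \<chi>)))"
    unfolding indsp_decomposition by (rule fun_model_iso[OF m])
  show "\<not> gmodule_iso mclain (ind mclain I (W1 D f \<chi>)) (ind mclain I (W1 D f \<psi>))"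
    if \<chi>: "\<chi> \<in> Irr S" and \<psi>: "\<psi> \<in> Irr S" and ne: "\<chi> \<noteq> \<psi>"
  proof
    assume iso: "gmodule_iso mclain (ind mclain I (W1 D f \<chi>)) (ind mclain I (W1 D f \<psi>))"
    have "ext_char \<chi> s = ext_char \<psi> s" if "s \<in> I" for s
    proof (rule ind_not_iso[OF subgroup_character_ext_char[OF \<chi>] subgroup_character_ext_char[OF \<psi>]])
      show "gmodule_iso M (ind M I (char_module (ext_char \<chi>))) (ind M I (char_module (ext_char \<psi>)))"
        using iso unfolding W1_eq[OF \<chi>] W1_eq[OF \<psi>] .
    qed (use that ext_char_H[OF \<chi>] ext_char_H[OF \<psi>] in auto)
    then show False using ext_char_inj[OF \<chi> \<psi>] ne by blast
  qed
qed

end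

theorem corollary8p16:
  fixes D :: "('l::linorder \<times> 'l) set"
    and f :: "'l \<times> 'l \<Rightarrow> 'r::ring_1 \<Rightarrow> 'f::field"
  assumes "basic_subset D"
    and "\<forall>d\<in>D. right_primitive (f d)"
    and "finite (UNIV :: 'r set)"
    and "\<not> special_triple D"
    and "comm_group (S_grp D :: ('l \<Rightarrow> 'l \<Rightarrow> 'r) set monoid)"
    and "strongly_ascendant TYPE('x::wellorder) CHAR('f)
           (I_grp D) (mclain :: ('l \<Rightarrow> 'l \<Rightarrow> 'r) monoid)"
  shows "(\<forall>\<chi> \<in> Irr (S_grp D). \<exists>!\<kappa>. extends_lambda D f \<chi> \<kappa>)
    \<and> gmodule mclain (basic_module D f)
    \<and> (\<forall>\<chi> \<in> Irr (S_grp D). gmodule mclain (ind mclain (I_grp D) (W1 D f \<chi>)))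
    \<and> gmodule_iso mclain (basic_module D f)
        (direct_sum (Irr (S_grp D)) (\<lambda>\<chi>. ind mclain (I_grp D) (W1 D f \<chi>)))
    \<and> (\<forall>\<chi> \<in> Irr (S_grp D). \<forall>\<psi> \<in> Irr (S_grp D). \<chi> \<noteq> \<psi> \<longrightarrow>
        \<not> gmodule_iso mclain (ind mclain (I_grp D) (W1 D f \<chi>))
                              (ind mclain (I_grp D) (W1 D f \<psi>)))"
proof -
  interpret comm_basic_data D f
    using assms(1-5) by (intro comm_basic_data.intro basic_data.intro comm_basic_data_axioms.intro) auto
  show ?thesis
    using decomposition extends_lambda_iff by auto
qed

end
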